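(* Let $T$ be an integral operator with real-valued kernel $K$ as described in the context. Assume that $K\in H_r$ for some $1<r\le\infty$ and that $K^*\in H_1$, where $K^*(x,y)=K(y,x)$. Suppose that there exists $C>0$ such that for every cube $Q$ and every measurable subset $E\subset Q$, $$\int_Q|T^*\chi_E|\,dx\le C|Q|.$$ Then there is a constant $C(n,T)$, depending only on $n$ and $T$, such that for every $f\in L^\infty_c$ there exists a $\frac{1}{2\cdot3^n}$-sparse family $\mathcal S$ of cubes such that for a.e. $x\in\mathbb R^n$, $$|Tf(x)|\le C(n,T)\sum_{Q\in\mathcal S}\langle f\rangle_{r',Q}\,\chi_Q(x).$$
   Context: $L^\infty_c$ is the space of bounded functions on $\mathbb R^n$ with compact support. The kernel $K:\mathbb R^n\times\mathbb R^n\setminus\{(x,x):x\in\mathbb R^n\}\to\mathbb R$ is real valued, and $T$ is a linear operator, properly defined on $L^\infty_c$, represented by $$Tf(x)=\int_{\mathbb R^n}K(x,y)f(y)\,dy\quad\text{for all }x\notin\operatorname{supp}f.$$ $T^*$ denotes the transpose of $T$ ($\int (Tf)g\,dx=\int f\,(T^*g)\,dx$), which is associated to the kernel $K^*(x,y)=K(y,x)$. Cubes are cubes in $\mathbb R^n$ (with sides parallel to the axes); for $\lambda>0$, $\lambda Q$ is the cube concentric with $Q$ with side length $\lambda$ times that of $Q$; $r'$ is the conjugate exponent of $r$, $1/r+1/r'=1$. A kernel $K$ belongs to $H_r$, $1\le r\le\infty$ (the $L^r$-H\"ormander condition), if $$\sup_Q\sup_{x,x'\in\frac12Q}\sum_{k=1}^\infty|2^kQ|^{\frac1{r'}}\|K(x,\cdot)-K(x',\cdot)\|_{L^r(2^kQ\setminus2^{k-1}Q)}<\infty.$$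 $\langle f\rangle_{p,Q}=\big(\frac1{|Q|}\int_Q|f|^p\big)^{1/p}$. A family $\mathcal S$ of cubes is $\eta$-sparse, $0<\eta\le1$, if for every $Q\in\mathcal S$ there is a measurable set $E_Q\subset Q$ with $|E_Q|\ge\eta|Q|$ and the sets $\{E_Q\}_{Q\in\mathcal S}$ are pairwise disjoint. *)

theory Defs
  imports "HOL-Analysis.Analysis" "HOL-Probability.Essential_Supremum"
begin

text \<open>
  Cubes are closed. They are parametrised by centre and side length, so the concentric cube
  \<open>\<lambda>Q\<close> of \<open>Q = cube c l\<close> is \<open>cube c (\<lambda> * l)\<close>.
\<close>

definition cube :: "real ^ 'n \<Rightarrow> real \<Rightarrow> (real ^ 'n) set" where
  "cube c l = cbox (c - vec (l / 2)) (c + vec (l / 2))"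

definition is_cube :: "(real ^ 'n) set \<Rightarrow> bool" where
  "is_cube Q \<longleftrightarrow> (\<exists>c l. l > 0 \<and> Q = cube c l)"

definition supp :: "(real ^ 'n \<Rightarrow> real) \<Rightarrow> (real ^ 'n) set" where
  "supp f = closure {x. f x \<noteq> 0}"

definition Linfc :: "(real ^ 'n \<Rightarrow> real) set" where
  "Linfc = {f. f \<in> borel_measurable lebesgue \<and> bounded (range f) \<and> compact (supp f)}"

text \<open>
  An operator on \<open>L\<^sup>\<infinity>\<^sub>c\<close> returns representatives of measurable functions modulo null sets, so
  linearity is only required almost everywhere.
\<close>

definition linear_operator :: "((real ^ 'n \<Rightarrow> real) \<Rightarrow> real ^ 'n \<Rightarrow> real) \<Rightarrow> bool" where
  "linear_operator T \<longleftrightarrow>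
     (\<forall>f\<in>Linfc. T f \<in> borel_measurable lebesgue) \<and>
     (\<forall>f\<in>Linfc. \<forall>g\<in>Linfc. \<forall>a b.
        AE x in lebesgue. T (\<lambda>y. a * f y + b * g y) x = a * T f x + b * T g x)"

text \<open>
  A kernel is a measurable function off the diagonal; it is represented by a total function
  whose values on the diagonal are irrelevant.
\<close>

definition is_kernel :: "(real ^ 'n \<Rightarrow> real ^ 'n \<Rightarrow> real) \<Rightarrow> bool" where
  "is_kernel K \<longleftrightarrow> (\<lambda>(x, y). K x y) \<in> borel_measurable (lebesgue_on {(x, y). x \<noteq> y})"

definition has_kernel ::
  "((real ^ 'n \<Rightarrow> real) \<Rightarrow> real ^ 'n \<Rightarrow> real) \<Rightarrow> (real ^ 'n \<Rightarrow> real ^ 'n \<Rightarrow> real) \<Rightarrow> bool" where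
  "has_kernel T K \<longleftrightarrow>
     (\<forall>f\<in>Linfc. \<forall>x. x \<notin> supp f \<longrightarrow>
        integrable lebesgue (\<lambda>y. K x y * f y) \<and> T f x = (LINT y|lebesgue. K x y * f y))"

text \<open>
  Both pairings are required to converge absolutely. In particular \<open>T f\<close> and \<open>Tt f\<close> are locally
  integrable and depend, up to null sets, only on the class of \<open>f\<close> modulo null sets.
  That the transpose of an operator with kernel \<open>K\<close> has kernel \<open>K x y\<close> with \<open>x\<close>, \<open>y\<close> swapped
  (for almost every point off the support) follows from Fubini when \<open>K\<close> satisfies a
  Hormander condition below, and is not part of the definition.
\<close>

definition is_transpose ::
  "((real ^ 'n \<Rightarrow> real) \<Rightarrow> real ^ 'n \<Rightarrow> real) \<Rightarrow>
   ((real ^ 'n \<Rightarrow> real) \<Rightarrow> real ^ 'n \<Rightarrow> real) \<Rightarrow> bool" where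
  "is_transpose T Tt \<longleftrightarrow>
     (\<forall>f\<in>Linfc. \<forall>g\<in>Linfc.
        integrable lebesgue (\<lambda>x. T f x * g x) \<and> integrable lebesgue (\<lambda>x. f x * Tt g x) \<and>
        (LINT x|lebesgue. T f x * g x) = (LINT x|lebesgue. f x * Tt g x))"

text \<open>\<open>1/r + 1/r' = 1\<close> for \<open>1 \<le> r \<le> \<infinity>\<close>, using \<open>1/0 = \<infinity>\<close> and \<open>1/\<infinity> = 0\<close> in \<open>[0,\<infinity>]\<close>.\<close>

definition conj_exponent :: "ennreal \<Rightarrow> ennreal" where
  "conj_exponent r = inverse (1 - inverse r)"

text \<open>
  The norm in \<open>L\<^sup>r(A)\<close>, \<open>1 \<le> r \<le> \<infinity>\<close>. It is infinite for functions that are not measurable on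
  \<open>A\<close>, so that it is finite exactly on \<open>L\<^sup>r(A)\<close>.
\<close>

definition Lr_norm :: "ennreal \<Rightarrow> (real ^ 'n) set \<Rightarrow> (real ^ 'n \<Rightarrow> real) \<Rightarrow> ennreal" where
  "Lr_norm r A g =
     (if g \<notin> borel_measurable (lebesgue_on A) then \<infinity>
      else if r = \<infinity> then esssup (lebesgue_on A) (\<lambda>y. ennreal \<bar>g y\<bar>)
      else let I = (\<integral>\<^sup>+y. ennreal (\<bar>g y\<bar> powr enn2real r) \<partial>lebesgue_on A)
           in if I = \<infinity> then \<infinity> else ennreal (enn2real I powr (1 / enn2real r)))"

text \<open>
  The \<open>L\<^sup>r\<close>-Hormander condition. The summation index \<open>k\<close> is shifted by one: the summand for
  \<open>k \<ge> 0\<close> belongs to the annulus between \<open>2\<^sup>kQ\<close> and \<open>2\<^sup>k\<^sup>+\<^sup>1Q\<close>.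
\<close>

definition Hormander :: "ennreal \<Rightarrow> (real ^ 'n \<Rightarrow> real ^ 'n \<Rightarrow> real) set" where
  "Hormander r =
     {K. (SUP (c, l) \<in> {(c, l). l > 0}. SUP x \<in> cube c (l / 2). SUP x' \<in> cube c (l / 2).
            \<Sum>k. ennreal (measure lebesgue (cube c (2 ^ Suc k * l))
                            powr enn2real (inverse (conj_exponent r))) *
                 Lr_norm r (cube c (2 ^ Suc k * l) - cube c (2 ^ k * l)) (\<lambda>y. K x y - K x' y))
         < \<infinity>}"

definition cube_avg :: "real \<Rightarrow> (real ^ 'n) set \<Rightarrow> (real ^ 'n \<Rightarrow> real) \<Rightarrow> real" where
  "cube_avg p Q f =
     (1 / measure lebesgue Q * (LINT x:Q|lebesgue. \<bar>f x\<bar> powr p)) powr (1 / p)"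

definition sparse_family :: "real \<Rightarrow> (real ^ 'n) set set \<Rightarrow> bool" where
  "sparse_family \<eta> S \<longleftrightarrow>
     (\<forall>Q\<in>S. is_cube Q) \<and>
     (\<exists>E. (\<forall>Q\<in>S. E Q \<in> sets lebesgue \<and> E Q \<subseteq> Q \<and> measure lebesgue (E Q) \<ge> \<eta> * measure lebesgue Q) \<and>
          disjoint_family_on E S)"

end

theory Submission
  imports Defs
begin

text \<open>
  Testing \<open>\<bar>T f\<bar>\<close> against its own sign turns the hypothesis on \<open>T\<^sup>*\<close> into
  \<open>\<integral>\<^sub>Q \<bar>T g\<bar> \<le> C \<parallel>g\<parallel>\<^sub>\<infinity> \<bar>Q\<bar>\<close> for \<open>g\<close> supported in \<open>Q\<close>. This replaces the \<open>L\<^sup>2\<close> bound in the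
  Calderon-Zygmund argument: for the good part of \<open>f\<close> one uses this bound, for the bad part the
  condition \<open>K\<^sup>* \<in> H\<^sub>1\<close>, and the result is a weak \<open>(1,1)\<close> bound localized to a cube. The condition
  \<open>K \<in> H\<^sub>r\<close> bounds the oscillation of \<open>T (f \<chi>)\<close>, \<open>\<chi>\<close> the indicator of the complement of \<open>3Q\<close>,
  on \<open>Q\<close> by averages \<open>\<langle>f\<rangle>\<close> with exponent \<open>r'\<close> over the cubes \<open>2\<^sup>kQ\<close>, which a maximal function controls.
  So off a small exceptional part of \<open>Q\<close> everything is bounded by the average over \<open>3Q\<close>. Covering the exceptional part by maximal subcubes and iterating on these
  gives a sparse tree. Triadic rather than dyadic cubes are used because the origin is
  then the centre of a cube of each generation, so that space splits into cubes \<open>Q\<close> with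
  \<open>supp f \<subseteq> 3Q\<close>, the roots of the trees.
\<close>

section \<open>Cubes and triadic cubes\<close>

text \<open>The delicate step is the passage from \<open>Q\<close> to a selected subcube
  \<open>Q'\<close>: with F the restriction of f to 3Q minus 3Q', T F must be bounded on
  \<open>Q'\<close>, where nothing is known yet about T of f restricted to 3Q. Density settles this.
  The selected cubes are Calderon-Zygmund cubes of the indicator of the exceptional set of
  \<open>Q\<close>, so this set fills at most a quarter of \<open>Q'\<close>; the exceptional set of
  \<open>Q'\<close> itself fills at most an eighth. Hence some point of \<open>Q'\<close> is good
  for both cubes. There T F is a difference of two controlled values, and the oscillation bound
  carries the estimate to all of \<open>Q'\<close>. A weak-type bound for T itself is therefore
  enough, and no maximal truncation of T enters.

  The operator is additive only up to null sets and no continuity is assumed. So additivity is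
  applied only to sums of two functions, and infinite decompositions occur only inside integrals of
  real functions.

  The sparseness constant combines two losses: half of each triadic cube survives the removal of its
  selected subcubes, and the cube is a fraction 1 / 3^n of its triple.\<close>

lemma mem_cube: "x \<in> cube c l \<longleftrightarrow> (\<forall>i. \<bar>x $ i - c $ i\<bar> \<le> l / 2)"
proof -
  have "\<bar>x $ i - c $ i\<bar> \<le> l / 2 \<longleftrightarrow> c $ i - l / 2 \<le> x $ i \<and> x $ i \<le> c $ i + l / 2" for i
    by arith
  then show ?thesis by (simp add: cube_def mem_box_cart)
qed

lemma cube_ne_empty: "l \<ge> 0 \<Longrightarrow> cube c l \<noteq> {}"
  using mem_cube[of c c l] by auto

lemma cube_subset:
  assumes "\<And>i. \<bar>c $ i - c' $ i\<bar> \<le> (l' - l) / 2"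
  shows "cube c l \<subseteq> cube c' l'"
proof
  fix x assume "x \<in> cube c l"
  then have *: "\<bar>x $ i - c $ i\<bar> \<le> l / 2" for i by (simp add: mem_cube)
  have "\<bar>x $ i - c' $ i\<bar> \<le> l' / 2" for i
    using assms[of i] *[of i] unfolding diff_divide_distrib by arith
  then show "x \<in> cube c' l'" by (simp add: mem_cube)
qed

lemma cube_mono: "l \<le> l' \<Longrightarrow> cube c l \<subseteq> cube c l'"
  by (rule cube_subset) auto

lemma cube_meas [measurable, simp]: "cube c l \<in> sets lebesgue"
  and cube_borel [measurable, simp]: "cube c l \<in> sets borel"
  and cube_lmeasurable [simp]: "cube c l \<in> lmeasurable"
  and closed_cube [simp]: "closed (cube c l)"
  and compact_cube [simp]: "compact (cube c l)"
  by (auto simp: cube_def)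

lemma content_cube [simp]:
  fixes c :: "real ^ 'n"
  assumes "l \<ge> 0" shows "measure lborel (cube c l) = l ^ CARD('n)"
proof -
  have "cbox (c - vec (l / 2)) (c + vec (l / 2)) \<noteq> {}"
    using cube_ne_empty[OF assms, of c] by (simp add: cube_def)
  from content_cbox_cart[OF this] show ?thesis
    by (simp add: cube_def)
qed

lemma measure_cube [simp]:
  fixes c :: "real ^ 'n"
  shows "l \<ge> 0 \<Longrightarrow> measure lebesgue (cube c l) = l ^ CARD('n)"
  by simp

lemma emeasure_cube [simp]:
  fixes c :: "real ^ 'n"
  assumes "l \<ge> 0"
  shows "emeasure lebesgue (cube c l) = ennreal (l ^ CARD('n))"
    and "emeasure lborel (cube c l) = ennreal (l ^ CARD('n))"
  using emeasure_eq_measure2[OF cube_lmeasurable[of c l]] assms by simp_all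

lemma cube_inj:
  assumes "cube c l = cube c' l'" "l \<ge> 0" "l' \<ge> 0"
  shows "c = c' \<and> l = l'"
proof -
  have "cbox (c - vec (l / 2)) (c + vec (l / 2)) \<noteq> {}"
    using cube_ne_empty[of l c] assms by (simp add: cube_def)
  then have *: "c - vec (l / 2) = c' - vec (l' / 2)" "c + vec (l / 2) = c' + vec (l' / 2)"
    using assms(1) unfolding cube_def by (auto simp: eq_cbox)
  have "c $ i = c' $ i \<and> l = l'" for i
    using arg_cong[where f = "\<lambda>v. v $ i", OF *(1)] arg_cong[where f = "\<lambda>v. v $ i", OF *(2)] by simp
  then show ?thesis by (auto simp: vec_eq_iff)
qed

lemma bounded_subset_cube:
  fixes S :: "(real ^ 'n) set"
  assumes "bounded S"
  obtains B where "B > 0" "\<And>l. l \<ge> B \<Longrightarrow> S \<subseteq> cube 0 l"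
proof -
  obtain b where b: "b > 0" "\<And>x. x \<in> S \<Longrightarrow> norm x \<le> b" using assms bounded_pos by blast
  show thesis
  proof (rule that[of "2 * b"])
    fix l assume "l \<ge> 2 * b"
    show "S \<subseteq> cube 0 l"
    proof
      fix x assume "x \<in> S"
      then have "\<bar>x $ i\<bar> \<le> l / 2" for i
        using b(2)[of x] component_le_norm_cart[of x i] \<open>l \<ge> 2 * b\<close> by simp
      then show "x \<in> cube 0 l" by (simp add: mem_cube)
    qed
  qed (use b in auto)
qed

type_synonym 'n tindex = "int \<times> (int ^ 'n)"

text \<open>The index \<open>(k, m)\<close> stands for the half-open cube with side \<open>3\<^sup>k\<close> centred at \<open>3\<^sup>k m\<close>.\<close>

definition tside :: "'n tindex \<Rightarrow> real" where
  "tside q = 3 powi fst q"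

definition tcenter :: "'n tindex \<Rightarrow> real ^ 'n" where
  "tcenter q = (\<chi> i. tside q * of_int (snd q $ i))"

text \<open>The summand \<open>1 / 2\<close> rounds to the nearest integer, so that the cell with
  index 0 is centred at the origin.\<close>

definition tindex :: "int \<Rightarrow> real ^ 'n \<Rightarrow> 'n tindex" where
  "tindex k x = (k, \<chi> i. \<lfloor>x $ i / 3 powi k + 1 / 2\<rfloor>)"

text \<open>As fibres of \<open>tindex k\<close>, the cubes of one level partition space by
  construction, and membership is an equation between indices.\<close>

definition tcube :: "'n tindex \<Rightarrow> (real ^ 'n) set" where
  "tcube q = {x. tindex (fst q) x = q}"

lemma tside_pos [simp]: "tside q > 0" "tside q \<ge> 0" "tside q \<noteq> 0"
  by (auto simp: tside_def)

lemma fst_tindex [simp]: "fst (tindex k x) = k"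
  by (simp add: tindex_def)

lemma mem_tindex [simp]: "x \<in> tcube (tindex k x)"
  by (simp add: tcube_def)

lemma mem_tcube: "x \<in> tcube q \<longleftrightarrow> tindex (fst q) x = q"
  by (simp add: tcube_def)

lemma mem_tcube_iff:
  "x \<in> tcube q \<longleftrightarrow> (\<forall>i. - tside q / 2 \<le> x $ i - tcenter q $ i \<and> x $ i - tcenter q $ i < tside q / 2)"
proof -
  have "\<lfloor>x $ i / 3 powi fst q + 1 / 2\<rfloor> = snd q $ i \<longleftrightarrow>
     - tside q / 2 \<le> x $ i - tcenter q $ i \<and> x $ i - tcenter q $ i < tside q / 2" for i
  proof -
    have p: "tside q > 0" by simp
    have "\<lfloor>x $ i / tside q + 1 / 2\<rfloor> = snd q $ i \<longleftrightarrow>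
      of_int (snd q $ i) \<le> x $ i / tside q + 1 / 2 \<and> x $ i / tside q + 1 / 2 < of_int (snd q $ i) + 1"
      by (simp add: floor_eq_iff)
    also have "\<dots> \<longleftrightarrow> tside q * of_int (snd q $ i) \<le> x $ i + tside q / 2 \<and> x $ i + tside q / 2 < tside q * of_int (snd q $ i) + tside q"
      using p by (simp add: field_simps)
    also have "\<dots> \<longleftrightarrow> - tside q / 2 \<le> x $ i - tcenter q $ i \<and> x $ i - tcenter q $ i < tside q / 2"
      by (auto simp: tcenter_def)
    finally show ?thesis by (simp add: tside_def)
  qed
  then show ?thesis
    by (cases q) (auto simp: mem_tcube tindex_def vec_eq_iff)
qed

lemma tcube_subset_cube: "tcube q \<subseteq> cube (tcenter q) (tside q)"
proof
  fix x assume "x \<in> tcube q"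
  then have "- tside q / 2 \<le> x $ i - tcenter q $ i \<and> x $ i - tcenter q $ i < tside q / 2" for i
    by (simp add: mem_tcube_iff)
  then have "\<bar>x $ i - tcenter q $ i\<bar> \<le> tside q / 2" for i by (smt (verit) minus_divide_left)
  then show "x \<in> cube (tcenter q) (tside q)" by (simp add: mem_cube)
qed

lemma tcenter_mem [simp]: "tcenter q \<in> tcube q"
  by (simp add: mem_tcube_iff)

lemma tcube_borel [measurable, simp]: "tcube q \<in> sets borel"
proof -
  have "tcube q = (\<Inter>i. {x. - tside q / 2 \<le> x $ i - tcenter q $ i \<and> x $ i - tcenter q $ i < tside q / 2})"
    by (auto simp: mem_tcube_iff)
  also have "\<dots> \<in> sets borel" by measurable
  finally show ?thesis .
qed

lemma tcube_meas [measurable, simp]: "tcube q \<in> sets lebesgue"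
  using tcube_borel[of q] by (simp add: sets_completionI_sets)

lemma tcube_lmeasurable [simp]: "tcube q \<in> lmeasurable"
  by (rule fmeasurableI2[OF cube_lmeasurable tcube_subset_cube]) simp

lemma measure_tcube [simp]:
  fixes q :: "'n::finite tindex"
  shows "measure lebesgue (tcube q) = tside q ^ CARD('n)"
    and "measure lborel (tcube q) = tside q ^ CARD('n)"
proof -
  let ?b = "box (tcenter q - vec (tside q / 2)) (tcenter q + vec (tside q / 2))"
  have "measure lebesgue ?b = measure lebesgue (cube (tcenter q) (tside q))"
    unfolding cube_def by (simp add: measure_lborel_box_eq measure_lborel_cbox_eq)
  moreover have "?b \<subseteq> tcube q"
  proof
    fix x assume "x \<in> ?b"
    then have *: "tcenter q $ i - tside q / 2 < x $ i \<and> x $ i < tcenter q $ i + tside q / 2" for i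
      by (simp add: mem_box_cart)
    have "- tside q / 2 \<le> x $ i - tcenter q $ i \<and> x $ i - tcenter q $ i < tside q / 2" for i
      using *[of i] by argo
    then show "x \<in> tcube q" by (simp add: mem_tcube_iff)
  qed
  then have "measure lebesgue ?b \<le> measure lebesgue (tcube q)"
    by (rule measure_mono_fmeasurable) auto
  moreover have "measure lebesgue (tcube q) \<le> measure lebesgue (cube (tcenter q) (tside q))"
    by (rule measure_mono_fmeasurable[OF tcube_subset_cube]) auto
  ultimately show "measure lebesgue (tcube q) = tside q ^ CARD('n)" by simp
  then show "measure lborel (tcube q) = tside q ^ CARD('n)" by simp
qed

lemma emeasure_tcube [simp]:
  fixes q :: "'n::finite tindex"
  shows "emeasure lebesgue (tcube q) = ennreal (tside q ^ CARD('n))"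
    and "emeasure lborel (tcube q) = ennreal (tside q ^ CARD('n))"
  using emeasure_eq_measure2[OF tcube_lmeasurable[of q]] by simp_all

text \<open>With s = t / 3^k, the identity s / 3 + 1 / 2 = (s + 1 / 2 + 1) / 3 turns an index m at
  level k into (m + 1) div 3 at level k + 1. This is where an odd ratio matters: with ratio 2, cells
  of which one is centred at the origin do not nest.\<close>

lemma tindex_Suc:
  assumes "tindex k x = tindex k y" shows "tindex (k + 1) x = tindex (k + 1) y"
proof -
  have *: "\<lfloor>t / 3 powi (k + 1) + 1 / 2\<rfloor> = (\<lfloor>t / 3 powi k + 1 / 2\<rfloor> + 1) div 3" for t :: real
  proof -
    have "t / 3 powi (k + 1) + 1 / 2 = (t / 3 powi k + 1 / 2 + 1) / real_of_int 3"
      by (simp add: power_int_add add_divide_distrib)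
    then have "\<lfloor>t / 3 powi (k + 1) + 1 / 2\<rfloor> = \<lfloor>(t / 3 powi k + 1 / 2 + 1) / real_of_int 3\<rfloor>" by (rule arg_cong)
    also have "\<dots> = \<lfloor>t / 3 powi k + 1 / 2 + 1\<rfloor> div 3"
      using floor_divide_real_eq_div[of 3 "t / 3 powi k + 1 / 2 + 1"] by simp
    also have "\<lfloor>t / 3 powi k + 1 / 2 + 1\<rfloor> = \<lfloor>t / 3 powi k + 1 / 2\<rfloor> + 1" by linarith
    finally show ?thesis .
  qed
  have "\<lfloor>x $ i / 3 powi k + 1 / 2\<rfloor> = \<lfloor>y $ i / 3 powi k + 1 / 2\<rfloor>" for i
    using assms by (auto simp: tindex_def vec_eq_iff)
  then show ?thesis by (simp add: tindex_def *)
qed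

lemma tindex_mono:
  assumes "tindex k x = tindex k y" "k \<le> k'" shows "tindex k' x = tindex k' y"
  using assms(2,1) by (induction k' rule: int_ge_induct) (auto intro: tindex_Suc)

lemma tcube_nested:
  assumes "fst q \<le> fst q'" "tcube q \<inter> tcube q' \<noteq> {}"
  shows "tcube q \<subseteq> tcube q'"
proof
  obtain z where z: "tindex (fst q) z = q" "tindex (fst q') z = q'" using assms(2) by (auto simp: mem_tcube)
  fix x assume "x \<in> tcube q"
  then have "tindex (fst q) x = tindex (fst q) z" using z by (simp add: mem_tcube)
  then have "tindex (fst q') x = tindex (fst q') z" using assms(1) tindex_mono by blast
  then show "x \<in> tcube q'" using z by (simp add: mem_tcube)
qed

lemma tcube_subset_tindex:
  "k \<le> k' \<Longrightarrow> tcube (tindex k x) \<subseteq> tcube (tindex k' x)"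
  by (rule tcube_nested) (auto intro: mem_tindex)

lemma tside_tindex: "tside (tindex k x) = 3 powi k"
  by (simp add: tside_def)

text \<open>Lets f on the tripled parent be split into f on the tripled child and a remainder that
  vanishes there. Inclusion of the cubes keeps the centres within half the difference of the sides,
  while tripling would even allow three halves of it.\<close>

lemma tcube_triple:
  assumes "tcube q \<subseteq> tcube q'"
  shows "cube (tcenter q) (3 * tside q) \<subseteq> cube (tcenter q') (3 * tside q')"
proof (rule cube_subset)
  fix i
  let ?d = "tcenter q $ i - tcenter q' $ i"
  have 1: "- tside q' / 2 \<le> tcenter q $ i + t - tcenter q' $ i \<and> tcenter q $ i + t - tcenter q' $ i < tside q' / 2"
    if "- tside q / 2 \<le> t" "t < tside q / 2" for t
  proof -
    have "tcenter q + vec t \<in> tcube q" using that by (simp add: mem_tcube_iff)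
    then have "tcenter q + vec t \<in> tcube q'" using assms by blast
    then show ?thesis by (auto simp: mem_tcube_iff)
  qed
  have a: "- tside q' / 2 \<le> ?d - tside q / 2" using 1[of "- tside q / 2"] tside_pos(1)[of q] by linarith
  \<comment> \<open>The upper face is missing from the half-open cube, so this bound is reached only
    as a limit.\<close>
  have b: "?d + tside q / 2 \<le> tside q' / 2"
  proof (rule field_le_epsilon)
    fix e :: real assume "e > 0"
    define t where "t = tside q / 2 - min e (tside q / 2)"
    have "- tside q / 2 \<le> t" "t < tside q / 2" using \<open>e > 0\<close> tside_pos(1)[of q] unfolding t_def by linarith+
    from 1[OF this] have "?d + t < tside q' / 2" by linarith
      then show "?d + tside q / 2 \<le> tside q' / 2 + e" unfolding t_def by linarith
  qed
  have "tside q \<le> tside q'" using a b by linarith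
  then show "\<bar>tcenter q $ i - tcenter q' $ i\<bar> \<le> (3 * tside q' - 3 * tside q) / 2"
    using a b unfolding abs_le_iff by argo
qed

lemma tindex_small:
  fixes x :: "real ^ 'n"
  assumes "open V" "x \<in> V"
  obtains k where "tcube (tindex k x) \<subseteq> V"
proof -
  obtain e where e: "e > 0" "ball x e \<subseteq> V" using assms openE by blast
  have "\<exists>m. (1/3::real) ^ m < e / CARD('n)" using e by (intro real_arch_pow_inv) auto
  then obtain m where m: "(1/3::real) ^ m * CARD('n) < e" by (auto simp: field_simps)
  show thesis
  proof (rule that[of "- int m"])
    have s: "3 powi (- int m) = (1/3::real) ^ m" by (simp add: power_int_minus power_one_over field_simps)
    show "tcube (tindex (- int m) x) \<subseteq> V"
    proof
      fix y assume y: "y \<in> tcube (tindex (- int m) x)"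
      have "x \<in> tcube (tindex (- int m) x)" by simp
      with y have *: "- ((1/3) ^ m) / 2 \<le> y $ i - tcenter (tindex (- int m) x) $ i \<and>
          y $ i - tcenter (tindex (- int m) x) $ i < (1/3) ^ m / 2 \<and>
          - ((1/3) ^ m) / 2 \<le> x $ i - tcenter (tindex (- int m) x) $ i \<and>
          x $ i - tcenter (tindex (- int m) x) $ i < (1/3) ^ m / 2" for i
        unfolding mem_tcube_iff tside_tindex s by blast
      have "\<bar>y $ i - x $ i\<bar> \<le> (1/3) ^ m" for i
        using *[of i] by argo
      then have "(\<Sum>i\<in>UNIV. \<bar>(y - x) $ i\<bar>) \<le> CARD('n) * (1/3::real) ^ m"
        using sum_bounded_above[of UNIV "\<lambda>i. \<bar>(y - x) $ i\<bar>" "(1/3::real) ^ m"] by simp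
      then have "norm (y - x) < e" using norm_le_l1_cart[of "y - x"] m by (simp add: mult.commute)
      then show "y \<in> V" using e by (auto simp: dist_norm norm_minus_commute)
    qed
  qed
qed

section \<open>Maximal triadic cubes and the Calderon-Zygmund decomposition\<close>

lemma tcube_subset_level:
  fixes q q' :: "'n::finite tindex"
  assumes "tcube q \<subseteq> tcube q'" shows "fst q \<le> fst q'"
proof (rule ccontr)
  assume "\<not> fst q \<le> fst q'"
  then have "tside q' < tside q" by (simp add: tside_def power_int_strict_increasing)
  moreover have "measure lebesgue (tcube q) \<le> measure lebesgue (tcube q')"
    by (rule measure_mono_fmeasurable[OF assms]) auto
  ultimately show False by simp
qed

definition maximal_tcubes :: "('n::finite tindex \<Rightarrow> bool) \<Rightarrow> 'n tindex set" where
  "maximal_tcubes P = {q. P q \<and> (\<forall>q'. P q' \<and> tcube q \<subseteq> tcube q' \<longrightarrow> q' = q)}"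

lemma maximal_tcubes_disjoint: "disjoint_family_on tcube (maximal_tcubes P)"
  unfolding disjoint_family_on_def
proof (intro ballI impI)
  fix q q' assume *: "q \<in> maximal_tcubes P" "q' \<in> maximal_tcubes P" "q \<noteq> q'"
  show "tcube q \<inter> tcube q' = {}"
  proof (rule ccontr)
    assume "tcube q \<inter> tcube q' \<noteq> {}"
    then have "tcube q \<subseteq> tcube q' \<or> tcube q' \<subseteq> tcube q"
      using tcube_nested[of q q'] tcube_nested[of q' q] by (metis Int_commute linear)
    then show False using * unfolding maximal_tcubes_def by blast
  qed
qed

text \<open>The triadic cubes that contain \<open>tcube q\<close> are among the cubes
  \<open>tindex k\<close> of its centre, one for each level. A bound on the levels leaves finitely
  many candidates, and the highest one is maximal.\<close>

lemma maximal_tcubes_cover: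
  fixes P :: "'n::finite tindex \<Rightarrow> bool"
  assumes bd: "\<And>q. P q \<Longrightarrow> fst q \<le> N" and q: "P q"
  obtains q' where "q' \<in> maximal_tcubes P" "tcube q \<subseteq> tcube q'"
proof -
  let ?x = "tcenter q"
  have x: "tindex (fst q) ?x = q" using tcenter_mem mem_tcube by blast
  let ?A = "{k. fst q \<le> k \<and> P (tindex k ?x)}"
  have "?A \<subseteq> {fst q..N}" using bd[of "tindex _ ?x"] by fastforce
  then have fin: "finite ?A" using finite_subset by blast
  have ne: "fst q \<in> ?A" using q x by simp
  define k where "k = Max ?A"
  have k: "k \<in> ?A" unfolding k_def using Max_in[OF fin] ne by blast
  have max: "j \<le> k" if "j \<in> ?A" for j unfolding k_def using Max_ge[OF fin that] .
  show thesis
  proof (rule that[of "tindex k ?x"])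
    show "tcube q \<subseteq> tcube (tindex k ?x)" using tcube_subset_tindex[of "fst q" k ?x] k x by simp
    show "tindex k ?x \<in> maximal_tcubes P"
      unfolding maximal_tcubes_def
    proof (intro CollectI conjI allI impI)
      show "P (tindex k ?x)" using k by simp
      fix q' assume q': "P q' \<and> tcube (tindex k ?x) \<subseteq> tcube q'"
      then have "?x \<in> tcube q'" by auto
      then have eq: "q' = tindex (fst q') ?x" by (simp add: mem_tcube)
      have "k \<le> fst q'" using tcube_subset_level[of "tindex k ?x" q'] q' by simp
      moreover have "fst q' \<le> k" using eq q' k \<open>k \<le> fst q'\<close> by (intro max) auto
      ultimately show "q' = tindex k ?x" using eq by simp
    qed
  qed
qed

text \<open>Supplies the bound on the levels that maximal cubes need: in every application the
  candidates have bounded volume.\<close>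

lemma tside_level_bound:
  fixes B :: real
  obtains N where "\<And>q :: 'n::finite tindex. tside q ^ CARD('n) \<le> B \<Longrightarrow> fst q \<le> N"
proof -
  obtain m where m: "\<bar>B\<bar> + 1 < 3 ^ m" using real_arch_pow[of 3 "\<bar>B\<bar> + 1"] by auto
  show thesis
  proof (rule that[of "int m"])
    fix q :: "'n tindex" assume q: "tside q ^ CARD('n) \<le> B"
    show "fst q \<le> int m"
    proof (rule ccontr)
      assume "\<not> fst q \<le> int m"
      then have "(3::real) powi int m \<le> tside q" unfolding tside_def by (intro power_int_increasing) auto
      then have s: "3 ^ m \<le> tside q" by simp
      then have "1 \<le> tside q" using one_le_power[of "3::real" m] by linarith
      then have "tside q \<le> tside q ^ CARD('n)" using self_le_power[of "tside q" "CARD('n)"] by simp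
      then show False using s m q by linarith
    qed
  qed
qed

text \<open>Here and in most later estimates a sum over a family of cubes is an integral over
  \<open>count_space I\<close>, which needs neither an enumeration nor a convergence
  argument.\<close>

lemma disjoint_UN_le:
  fixes A :: "'i \<Rightarrow> 'a set"
  assumes "countable I" "disjoint_family_on A I" "\<And>i. i \<in> I \<Longrightarrow> A i \<in> sets M"
    and "B \<in> sets M" "(\<Union>i\<in>I. A i) \<subseteq> B"
  shows "(\<integral>\<^sup>+i. emeasure M (A i) \<partial>count_space I) \<le> emeasure M B"
  using emeasure_UN_countable[of I A M] assms
  by (metis (no_types, lifting) emeasure_mono image_subset_iff)

lemma nn_integral_UN_le:
  fixes f :: "'a \<Rightarrow> ennreal"
  assumes I: "countable I" and m: "\<And>i. i \<in> I \<Longrightarrow> (\<lambda>x. f x * indicator (A i) x) \<in> borel_measurable M"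
  shows "(\<integral>\<^sup>+x\<in>(\<Union>i\<in>I. A i). f x \<partial>M) \<le> (\<integral>\<^sup>+i. (\<integral>\<^sup>+x\<in>A i. f x \<partial>M) \<partial>count_space I)"
proof -
  have "(\<integral>\<^sup>+x\<in>(\<Union>i\<in>I. A i). f x \<partial>M) \<le> (\<integral>\<^sup>+x. (\<integral>\<^sup>+i. f x * indicator (A i) x \<partial>count_space I) \<partial>M)"
  proof (rule nn_integral_mono)
    fix x
    show "f x * indicator (\<Union>i\<in>I. A i) x \<le> (\<integral>\<^sup>+i. f x * indicator (A i) x \<partial>count_space I)"
    proof (cases "x \<in> (\<Union>i\<in>I. A i)")
      case True
      then obtain i where i: "i \<in> I" "x \<in> A i" by blast
      then show ?thesis
        using nn_integral_ge_point[of i I "\<lambda>i. f x * indicator (A i) x"] True by simp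
    qed simp
  qed
  also have "\<dots> = (\<integral>\<^sup>+i. (\<integral>\<^sup>+x\<in>A i. f x \<partial>M) \<partial>count_space I)"
    using I m by (rule nn_integral_count_space_nn_integral)
  finally show ?thesis .
qed

lemma emeasure_UN_le:
  assumes "countable I" "\<And>i. i \<in> I \<Longrightarrow> A i \<in> sets M"
  shows "emeasure M (\<Union>i\<in>I. A i) \<le> (\<integral>\<^sup>+i. emeasure M (A i) \<partial>count_space I)"
proof -
  have "(\<integral>\<^sup>+x\<in>(\<Union>i\<in>I. A i). 1 \<partial>M) \<le> (\<integral>\<^sup>+i. (\<integral>\<^sup>+x\<in>A i. 1 \<partial>M) \<partial>count_space I)"
    using assms by (intro nn_integral_UN_le) auto
  moreover have "(\<integral>\<^sup>+i. (\<integral>\<^sup>+x\<in>A i. 1 \<partial>M) \<partial>count_space I) = (\<integral>\<^sup>+i. emeasure M (A i) \<partial>count_space I)"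
    using assms by (intro nn_integral_cong) auto
  moreover have "(\<Union>i\<in>I. A i) \<in> sets M" using assms by (intro sets.countable_UN') auto
  ultimately show ?thesis by simp
qed

text \<open>A substitute for Lebesgue's density theorem: cover \<open>S\<close> by the maximal triadic cubes of an open
  set that is only slightly larger.\<close>

lemma density_zero:
  fixes S :: "(real ^ 'n) set"
  assumes S: "S \<in> lmeasurable" and th: "\<theta> < 1"
    and q: "\<And>q. tcube q \<inter> S \<noteq> {} \<Longrightarrow> measure lebesgue (S \<inter> tcube q) \<le> \<theta> * measure lebesgue (tcube q)"
  shows "measure lebesgue S = 0"
proof (rule ccontr)
  assume "measure lebesgue S \<noteq> 0"
  then have pos: "measure lebesgue S > 0" by (simp add: zero_less_measure_iff)
  define t where "t = max \<theta> 0"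
  have t: "0 \<le> t" "t < 1" "\<theta> \<le> t" using th by (auto simp: t_def)
  \<comment> \<open>Chosen so that the final inequality, measure of S at most t times (measure of S
    plus e), becomes e \<le> t * e, which is absurd for t < 1.\<close>
  define e where "e = (1 - t) * measure lebesgue S"
  have "e > 0" using t pos by (simp add: e_def)
  have Sm: "S \<in> sets lebesgue" using S by (rule fmeasurableD)
  obtain V where V: "open V" "S \<subseteq> V" "V - S \<in> lmeasurable" "emeasure lebesgue (V - S) < ennreal e"
    using sets_lebesgue_outer_open[OF Sm \<open>e > 0\<close>] by blast
  have VS: "measure lebesgue (V - S) < e"
    using V(4) emeasure_eq_measure2[OF V(3)] \<open>e > 0\<close> by (simp add: ennreal_less_iff)
  have "V = S \<union> (V - S)" using V(2) by blast
  then have Vm: "V \<in> lmeasurable" using fmeasurable.Un[OF S V(3)] by simp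
  have "measure lebesgue V = measure lebesgue S + measure lebesgue (V - S)"
    using measure_Un3[OF S V(3)] \<open>V = _\<close> by simp
  then have Vle: "measure lebesgue V < measure lebesgue S + e" using VS by simp
  \<comment> \<open>Cubes that miss \<open>S\<close> are left out, since the density hypothesis
    speaks only of cubes that meet \<open>S\<close>.\<close>
  define P where "P = (\<lambda>q :: 'n tindex. tcube q \<subseteq> V \<and> tcube q \<inter> S \<noteq> {})"
  obtain N where N: "\<And>q :: 'n tindex. tside q ^ CARD('n) \<le> measure lebesgue V \<Longrightarrow> fst q \<le> N"
    using tside_level_bound by blast
  have PN: "fst q \<le> N" if "P q" for q
    using measure_mono_fmeasurable[of "tcube q" V lebesgue] that Vm by (intro N) (auto simp: P_def)
  let ?M = "maximal_tcubes P"
  have cov: "S \<subseteq> (\<Union>q\<in>?M. S \<inter> tcube q)"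
  proof
    fix x assume x: "x \<in> S"
    then obtain k where "tcube (tindex k x) \<subseteq> V" using tindex_small[OF V(1)] V(2) by blast
    then have "P (tindex k x)" using x mem_tindex[of x k] unfolding P_def by blast
    from maximal_tcubes_cover[where P = P, OF PN this] obtain q' where "q' \<in> ?M" "tcube (tindex k x) \<subseteq> tcube q'" by blast
    then show "x \<in> (\<Union>q\<in>?M. S \<inter> tcube q)" using x mem_tindex[of x k] by blast
  qed
  have cnt: "countable ?M" by simp
  have "emeasure lebesgue S = emeasure lebesgue (\<Union>q\<in>?M. S \<inter> tcube q)"
    using cov by (intro arg_cong[where f = "emeasure lebesgue"]) blast
  also have "\<dots> = (\<integral>\<^sup>+q. emeasure lebesgue (S \<inter> tcube q) \<partial>count_space ?M)"
  proof (rule emeasure_UN_countable)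
    show "disjoint_family_on (\<lambda>q. S \<inter> tcube q) ?M"
      using maximal_tcubes_disjoint[of P] unfolding disjoint_family_on_def by blast
  qed (use Sm in auto)
  also have "\<dots> \<le> (\<integral>\<^sup>+q. ennreal t * emeasure lebesgue (tcube q) \<partial>count_space ?M)"
  proof (rule nn_integral_mono)
    fix q assume "q \<in> space (count_space ?M)"
    then have "tcube q \<inter> S \<noteq> {}" by (auto simp: maximal_tcubes_def P_def)
    from \<open>tcube q \<inter> S \<noteq> {}\<close> q have "measure lebesgue (S \<inter> tcube q) \<le> \<theta> * measure lebesgue (tcube q)" by blast
    also have "\<dots> \<le> t * measure lebesgue (tcube q)" using t by (intro mult_right_mono) auto
    finally have "ennreal (measure lebesgue (S \<inter> tcube q)) \<le> ennreal (t * measure lebesgue (tcube q))"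
      by (rule ennreal_leI)
    moreover have "S \<inter> tcube q \<in> lmeasurable" using S by (intro fmeasurable.Int) auto
    ultimately show "emeasure lebesgue (S \<inter> tcube q) \<le> ennreal t * emeasure lebesgue (tcube q)"
      using t by (simp add: emeasure_eq_measure2 ennreal_mult)
  qed
  also have "\<dots> = ennreal t * (\<integral>\<^sup>+q. emeasure lebesgue (tcube q) \<partial>count_space ?M)"
    by (rule nn_integral_cmult) auto
  also have "\<dots> \<le> ennreal t * emeasure lebesgue V"
    using maximal_tcubes_disjoint[of P] Vm
    by (intro mult_left_mono disjoint_UN_le) (auto simp: maximal_tcubes_def P_def)
  finally have "ennreal (measure lebesgue S) \<le> ennreal (t * measure lebesgue V)"
    using S Vm t by (simp add: emeasure_eq_measure2 ennreal_mult)
  then have "measure lebesgue S \<le> t * measure lebesgue V" using t by (simp add: ennreal_le_iff)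
  also have "\<dots> \<le> t * (measure lebesgue S + e)" using t Vle by (intro mult_left_mono) auto
  finally have "(1 - t) * measure lebesgue S \<le> t * e" by (simp add: algebra_simps)
  then have "e \<le> t * e" by (simp add: e_def)
  then show False using t \<open>e > 0\<close> by (metis mult_le_cancel_right1 not_le)
qed

text \<open>Integrals of \<open>h\<close> over disjoint sets are their measures for the density
  \<open>h\<close>, so additivity of that measure is all that is used.\<close>

lemma sum_set_integral_le:
  fixes h :: "'a \<Rightarrow> real"
  assumes h: "integrable M h" and h0: "\<And>x. h x \<ge> 0"
    and I: "countable I" "disjoint_family_on A I" "\<And>i. i \<in> I \<Longrightarrow> A i \<in> sets M"
  shows "(\<integral>\<^sup>+i. ennreal (LINT x:A i|M. h x) \<partial>count_space I) \<le> ennreal (LINT x|M. h x)"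
proof -
  have hm[measurable]: "h \<in> borel_measurable M" using h by auto
  let ?D = "density M (\<lambda>x. ennreal (h x))"
  have e: "emeasure ?D A = ennreal (LINT x:A|M. h x)" if "A \<in> sets M" for A
  proof -
    have "emeasure ?D A = (\<integral>\<^sup>+x. ennreal (h x) * indicator A x \<partial>M)"
      using that by (intro emeasure_density) auto
    also have "\<dots> = (\<integral>\<^sup>+x. ennreal (indicator A x * h x) \<partial>M)"
      by (intro nn_integral_cong) (auto simp: indicator_def)
    also have "\<dots> = ennreal (LINT x:A|M. h x)"
      unfolding set_lebesgue_integral_def using integrable_mult_indicator[OF that h] h0
      by (subst nn_integral_eq_integral) (auto simp: indicator_def)
    finally show ?thesis .
  qed
  have "(\<integral>\<^sup>+i. ennreal (LINT x:A i|M. h x) \<partial>count_space I) = (\<integral>\<^sup>+i. emeasure ?D (A i) \<partial>count_space I)"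
    using I by (intro nn_integral_cong) (simp add: e)
  also have "\<dots> \<le> emeasure ?D (space M)"
    using I by (intro disjoint_UN_le) (auto dest: sets.sets_into_space)
  also have "\<dots> = ennreal (LINT x|M. h x)"
    using set_integral_space[OF h] by (simp add: e)
  finally show ?thesis .
qed

lemma set_integral_le_integral:
  fixes h :: "'a \<Rightarrow> real"
  assumes h: "integrable M h" and h0: "\<And>x. h x \<ge> 0" and A: "A \<in> sets M"
  shows "(LINT x:A|M. h x) \<le> (LINT x|M. h x)"
  unfolding set_lebesgue_integral_def using integrable_mult_indicator[OF A h] h h0
  by (intro integral_mono) (auto simp: indicator_def)

section \<open>Calderon-Zygmund cubes: the maximal triadic cubes on which the average of
  \<open>h\<close> exceeds \<open>lam\<close>\<close>

definition cz_cubes :: "(real ^ 'n \<Rightarrow> real) \<Rightarrow> real \<Rightarrow> 'n::finite tindex set" where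
  "cz_cubes h lam = maximal_tcubes (\<lambda>q. lam * tside q ^ CARD('n) < (LINT x:tcube q|lebesgue. h x))"

context
  fixes h :: "real ^ 'n \<Rightarrow> real" and lam :: real
  assumes h: "integrable lebesgue h" and h0: "\<And>x. h x \<ge> 0" and lam_pos: "lam > 0"
begin

lemma set_integrable_h: "A \<in> sets lebesgue \<Longrightarrow> set_integrable lebesgue A h"
  unfolding set_integrable_def using integrable_mult_indicator[OF _ h] by blast

lemmas set_integral_h_le = set_integral_le_integral[OF h h0]

lemma cz_level: obtains N where
  "\<And>q. lam * tside q ^ CARD('n) < (LINT x:tcube q|lebesgue. h x) \<Longrightarrow> fst (q :: 'n tindex) \<le> N"
proof -
  obtain N where N: "\<And>q :: 'n tindex. tside q ^ CARD('n) \<le> (LINT x|lebesgue. h x) / lam \<Longrightarrow> fst q \<le> N"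
    using tside_level_bound by blast
  show thesis
  proof (rule that, rule N)
    fix q :: "'n tindex" assume "lam * tside q ^ CARD('n) < (LINT x:tcube q|lebesgue. h x)"
    then have "lam * tside q ^ CARD('n) \<le> (LINT x|lebesgue. h x)" using set_integral_h_le[of "tcube q"] by simp
    then show "tside q ^ CARD('n) \<le> (LINT x|lebesgue. h x) / lam" using lam_pos by (simp add: field_simps)
  qed
qed

lemma cz_disjoint: "disjoint_family_on tcube (cz_cubes h lam)"
  unfolding cz_cubes_def by (rule maximal_tcubes_disjoint)

lemma cz_lower: "q \<in> cz_cubes h lam \<Longrightarrow> lam * tside q ^ CARD('n) < (LINT x:tcube q|lebesgue. h x)"
  by (simp add: cz_cubes_def maximal_tcubes_def)

lemma cz_cover:
  assumes "lam * tside q ^ CARD('n) < (LINT x:tcube q|lebesgue. h x)"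
  shows "tcube q \<subseteq> (\<Union>q\<in>cz_cubes h lam. tcube q)"
proof -
  obtain N where N: "\<And>q. lam * tside q ^ CARD('n) < (LINT x:tcube q|lebesgue. h x) \<Longrightarrow> fst (q :: 'n tindex) \<le> N"
    using cz_level by blast
  show ?thesis
    using maximal_tcubes_cover[where P = "\<lambda>q. lam * tside q ^ CARD('n) < (LINT x:tcube q|lebesgue. h x)", OF N assms]
    unfolding cz_cubes_def by blast
qed

text \<open>By maximality the parent cube has average at most \<open>lam\<close>, and its volume is
  3^n times larger.\<close>

lemma cz_upper:
  assumes "q \<in> cz_cubes h lam"
  shows "(LINT x:tcube q|lebesgue. h x) \<le> 3 ^ CARD('n) * lam * tside q ^ CARD('n)"
proof -
  let ?q = "tindex (fst q + 1) (tcenter q)"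
  have q: "tindex (fst q) (tcenter q) = q" using tcenter_mem mem_tcube by blast
  have sub: "tcube q \<subseteq> tcube ?q" using tcube_subset_tindex[of "fst q" "fst q + 1" "tcenter q"] q by simp
  have "?q \<noteq> q" by (metis fst_tindex add_cancel_left_right zero_neq_one)
  then have "(LINT x:tcube ?q|lebesgue. h x) \<le> lam * tside ?q ^ CARD('n)"
    using assms sub unfolding cz_cubes_def maximal_tcubes_def mem_Collect_eq by (meson not_le)
  moreover have "tside ?q = 3 * tside q" by (simp add: tside_def power_int_add)
  moreover have "(LINT x:tcube q|lebesgue. h x) \<le> (LINT x:tcube ?q|lebesgue. h x)"
    unfolding set_lebesgue_integral_def using set_integrable_h[unfolded set_integrable_def] sub h0
    by (intro integral_mono) (auto simp: indicator_def)
  ultimately show ?thesis by (simp add: power_mult_distrib algebra_simps)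
qed

text \<open>The factor 2 avoids Lebesgue's differentiation theorem. A triadic cube that meets the
  set \<open>S\<close> where h > 2 * lam outside the selected cubes has average at most
  \<open>lam\<close>, so \<open>S\<close> fills at most half of it, and \<open>density_zero\<close>
  applies.\<close>

lemma cz_small: "AE x in lebesgue. x \<notin> (\<Union>q\<in>cz_cubes h lam. tcube q) \<longrightarrow> h x \<le> 2 * lam"
proof -
  have hm[measurable]: "h \<in> borel_measurable lebesgue" using h by auto
  let ?U = "\<Union>q\<in>cz_cubes h lam. tcube q"
  have U: "?U \<in> sets lebesgue" by (intro sets.countable_UN') auto
  define S where "S = {x. h x > 2 * lam} - ?U"
  have "{x \<in> space lebesgue. h x > 2 * lam} \<in> sets lebesgue" by measurable
  then have S1: "{x. h x > 2 * lam} \<in> sets lebesgue" by simp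
  then have Sm: "S \<in> sets lebesgue" using U unfolding S_def by blast
  have key: "2 * lam * indicator (S \<inter> A) x \<le> indicator A x * h x" for A x
    using h0[of x] by (auto simp: indicator_def S_def)
  have "S \<in> lmeasurable"
  proof (rule fmeasurableI[OF Sm])
    have "ennreal (2 * lam) * emeasure lebesgue S = (\<integral>\<^sup>+x. ennreal (2 * lam) * indicator S x \<partial>lebesgue)"
      using Sm by (simp add: nn_integral_cmult_indicator)
    also have "\<dots> \<le> (\<integral>\<^sup>+x. ennreal (h x) \<partial>lebesgue)"
      by (intro nn_integral_mono) (auto simp: indicator_def S_def intro!: ennreal_leI)
    also have "\<dots> < \<infinity>" using h h0 by (simp add: nn_integral_eq_integral)
    finally show "emeasure lebesgue S < \<infinity>"
      using lam_pos by (auto simp: ennreal_mult_less_top less_top[symmetric] ennreal_mult_eq_top_iff)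
  qed
  have "measure lebesgue S = 0"
  proof (rule density_zero[OF \<open>S \<in> lmeasurable\<close>, of "1/2"])
    fix q :: "'n tindex" assume "tcube q \<inter> S \<noteq> {}"
    then have "\<not> lam * tside q ^ CARD('n) < (LINT x:tcube q|lebesgue. h x)"
      using cz_cover[of q] unfolding S_def by blast
    moreover have "2 * lam * measure lebesgue (S \<inter> tcube q) \<le> (LINT x:tcube q|lebesgue. h x)"
    proof -
      have m: "S \<inter> tcube q \<in> lmeasurable" using \<open>S \<in> lmeasurable\<close> by (intro fmeasurable.Int) auto
      have "2 * lam * measure lebesgue (S \<inter> tcube q) = (LINT x|lebesgue. 2 * lam * indicator (S \<inter> tcube q) x)"
        using m by simp
      also have "\<dots> \<le> (LINT x:tcube q|lebesgue. h x)"
        unfolding set_lebesgue_integral_def using set_integrable_h[unfolded set_integrable_def, of "tcube q"] m key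
        by (intro integral_mono) (auto simp: fmeasurable_def)
      finally show ?thesis .
    qed
    ultimately have "lam * (2 * measure lebesgue (S \<inter> tcube q)) \<le> lam * tside q ^ CARD('n)" by linarith
    then show "measure lebesgue (S \<inter> tcube q) \<le> 1/2 * measure lebesgue (tcube q)"
      using lam_pos by simp
  qed simp
  then have "emeasure lebesgue S = 0" using emeasure_eq_measure2[OF \<open>S \<in> lmeasurable\<close>] by simp
  then have "S \<in> null_sets lebesgue" using Sm by (simp add: null_sets_def)
  from AE_not_in[OF this] show ?thesis by eventually_elim (auto simp: S_def)
qed

text \<open>Stated for the sum of the measures rather than for the union, because later the cubes
  are doubled and may then overlap.\<close>

lemma cz_measure:
  "ennreal lam * (\<integral>\<^sup>+q. emeasure lebesgue (tcube q) \<partial>count_space (cz_cubes h lam)) \<le> ennreal (LINT x|lebesgue. h x)"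
proof -
  have "ennreal lam * (\<integral>\<^sup>+q. emeasure lebesgue (tcube q) \<partial>count_space (cz_cubes h lam)) =
     (\<integral>\<^sup>+q. ennreal lam * emeasure lebesgue (tcube q) \<partial>count_space (cz_cubes h lam))"
    by (rule nn_integral_cmult[symmetric]) auto
  also have "\<dots> \<le> (\<integral>\<^sup>+q. ennreal (LINT x:tcube q|lebesgue. h x) \<partial>count_space (cz_cubes h lam))"
    using cz_lower lam_pos
    by (intro nn_integral_mono) (simp add: ennreal_mult[symmetric] less_imp_le ennreal_leI)
  also have "\<dots> \<le> ennreal (LINT x|lebesgue. h x)"
    using cz_disjoint by (intro sum_set_integral_le h h0) auto
  finally show ?thesis .
qed

end

section \<open>The maximal function and Holder's inequality\<close>

text \<open>The weak (1,1) bound for the uncentred maximal function over all cubes, since the cubes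
  2^k Q of the kernel estimates are not triadic. The exceptional set is given as a countable union
  of cubes, so the maximal function itself need not be measurable. Vitali's lemma is used for balls:
  a cube of side l lies in the ball of radius n * l, and the fivefold ball lies in the cube of side
  10 * n * l.\<close>

lemma maximal_function:
  obtains C :: real where "C > 0"
    "\<And>(h :: real ^ 'n \<Rightarrow> real) lam. integrable lebesgue h \<Longrightarrow> (\<And>x. h x \<ge> 0) \<Longrightarrow> lam > 0 \<Longrightarrow>
      \<exists>U\<in>lmeasurable. measure lebesgue U \<le> C * (LINT x|lebesgue. h x) / lam \<and>
        (\<forall>x c l. x \<notin> U \<longrightarrow> l > 0 \<longrightarrow> x \<in> cube c l \<longrightarrow> (LINT y:cube c l|lebesgue. h y) \<le> lam * l ^ CARD('n))"
proof -
  let ?n = "real CARD('n)"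
  have n1: "?n \<ge> 1" by (simp add: Suc_leI)
  have main: "\<exists>U\<in>lmeasurable. measure lebesgue U \<le> (10 * ?n) ^ CARD('n) * (LINT x|lebesgue. h x) / lam \<and>
        (\<forall>x c l. x \<notin> U \<longrightarrow> l > 0 \<longrightarrow> x \<in> cube c l \<longrightarrow> (LINT y:cube c l|lebesgue. h y) \<le> lam * l ^ CARD('n))"
    if h: "integrable lebesgue h" and h0: "\<And>x. h x \<ge> 0" and lam: "lam > 0" for h :: "real ^ 'n \<Rightarrow> real" and lam
  proof -
    let ?I = "LINT x|lebesgue. h x"
    let ?N = "(10 * ?n) ^ CARD('n)"
    have I0: "?I \<ge> 0" using h0 by simp
    define K where "K = {(c :: real ^ 'n, l). l > 0 \<and> lam * l ^ CARD('n) < (LINT y:cube c l|lebesgue. h y)}"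
    define a where "a = (fst :: (real ^ 'n) \<times> real \<Rightarrow> _)"
    define r where "r = (\<lambda>i :: (real ^ 'n) \<times> real. ?n * snd i)"
    have norm: "norm v \<le> ?n * b" if "\<And>i. \<bar>v $ i\<bar> \<le> b" for v :: "real ^ 'n" and b
      using norm_le_l1_cart[of v] sum_bounded_above[of UNIV "\<lambda>i. \<bar>v $ i\<bar>" b] that by simp
    have sub: "cube c l \<subseteq> cball c (?n * l)" if "l \<ge> 0" for c :: "real ^ 'n" and l
    proof
      fix x assume "x \<in> cube c l"
      then have *: "\<bar>x $ i - c $ i\<bar> \<le> l / 2" for i by (simp add: mem_cube)
      have "\<bar>(x - c) $ i\<bar> \<le> l" for i using *[of i] that by simp
      then show "x \<in> cball c (?n * l)" using norm[of "x - c" l] by (simp add: dist_norm norm_minus_commute)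
    qed
    have sub5: "cball c (5 * (?n * l)) \<subseteq> cube c (10 * ?n * l)" for c :: "real ^ 'n" and l
    proof
      fix x assume "x \<in> cball c (5 * (?n * l))"
      then have "norm (x - c) \<le> 5 * (?n * l)" by (simp add: dist_norm norm_minus_commute)
      then have "\<bar>(x - c) $ i\<bar> \<le> 5 * (?n * l)" for i
        using component_le_norm_cart[of "x - c" i] by linarith
      then show "x \<in> cube c (10 * ?n * l)" by (simp add: mem_cube mult_ac)
    qed
    \<comment> \<open>Vitali's lemma needs bounded radii. The volume of a cube in \<open>K\<close>
      is below \<open>?I / lam\<close>, and a side above 1 is at most the volume.\<close>
    have rb: "0 < r i \<and> r i \<le> ?n * max 1 (?I / lam)" if "i \<in> K" for i
    proof -
      obtain c l where i: "i = (c, l)" by (cases i)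
      then have l: "l > 0" "lam * l ^ CARD('n) < (LINT y:cube c l|lebesgue. h y)" using that by (auto simp: K_def)
      have "lam * l ^ CARD('n) < ?I" using l(2) set_integral_le_integral[OF h h0, of "cube c l"] by simp
      then have p: "l ^ CARD('n) < ?I / lam" using lam by (simp add: field_simps)
      have "l \<le> max 1 (?I / lam)"
      proof (cases "l \<le> 1")
        case False
        then have "l \<le> l ^ CARD('n)" using self_le_power[of l "CARD('n)"] by simp
        then show ?thesis using p by simp
      qed simp
      then show ?thesis using l n1 by (simp add: r_def i)
    qed
    have covK: "(\<Union>i\<in>K. cube (fst i) (snd i)) \<subseteq> (\<Union>i\<in>K. cball (a i) (r i))"
    proof (rule UN_mono[OF subset_refl])
      fix i assume "i \<in> K"
      then show "cube (fst i) (snd i) \<subseteq> cball (a i) (r i)"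
        using sub[of "snd i" "fst i"] by (simp add: a_def r_def K_def split_beta)
    qed
    obtain C where
      C: "countable C" "C \<subseteq> K" "pairwise (\<lambda>i j. disjnt (cball (a i) (r i)) (cball (a j) (r j))) C"
      and cov: "(\<Union>i\<in>K. cube (fst i) (snd i)) \<subseteq> (\<Union>i\<in>C. cball (a i) (5 * r i))"
      by (rule Vitali_covering_lemma_cballs[OF covK rb])
    define U where "U = (\<Union>i\<in>C. cube (fst i) (10 * ?n * snd i))"
    have Um: "U \<in> sets lebesgue" unfolding U_def using C(1) by (intro sets.countable_UN') auto
    have pos: "snd i > 0" if "i \<in> C" for i using C(2) that by (auto simp: K_def)
    have dis: "disjoint_family_on (\<lambda>i. cube (fst i) (snd i)) C"
      unfolding disjoint_family_on_def
    proof (intro ballI impI)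
      fix i j assume ij: "i \<in> C" "j \<in> C" "i \<noteq> j"
      then have "disjnt (cball (a i) (r i)) (cball (a j) (r j))" using C(3) by (auto simp: pairwise_def)
      then show "cube (fst i) (snd i) \<inter> cube (fst j) (snd j) = {}"
        using sub[of "snd i" "fst i"] sub[of "snd j" "fst j"] pos[OF ij(1)] pos[OF ij(2)]
        unfolding disjnt_def a_def r_def by (meson disjoint_iff less_imp_le subsetD)
    qed
    have "emeasure lebesgue U \<le> (\<integral>\<^sup>+i. emeasure lebesgue (cube (fst i) (10 * ?n * snd i)) \<partial>count_space C)"
      unfolding U_def using C(1) by (intro emeasure_UN_le) auto
    also have "\<dots> \<le> (\<integral>\<^sup>+i. ennreal (?N / lam) * ennreal (LINT y:cube (fst i) (snd i)|lebesgue. h y) \<partial>count_space C)"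
    proof (rule nn_integral_mono)
      fix i assume "i \<in> space (count_space C)"
      then have i: "i \<in> C" by simp
      have k: "lam * snd i ^ CARD('n) < (LINT y:cube (fst i) (snd i)|lebesgue. h y)" using i C(2) by (auto simp: K_def)
      have "emeasure lebesgue (cube (fst i) (10 * ?n * snd i)) = ennreal (?N * snd i ^ CARD('n))"
        using pos[OF i] by (simp add: power_mult_distrib)
      also have "\<dots> \<le> ennreal (?N / lam * (LINT y:cube (fst i) (snd i)|lebesgue. h y))"
      proof (rule ennreal_leI)
        have "snd i ^ CARD('n) \<le> (LINT y:cube (fst i) (snd i)|lebesgue. h y) / lam"
          using k lam by (simp add: field_simps)
        then have "?N * snd i ^ CARD('n) \<le> ?N * ((LINT y:cube (fst i) (snd i)|lebesgue. h y) / lam)"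
          by (intro mult_left_mono) auto
        then show "?N * snd i ^ CARD('n) \<le> ?N / lam * (LINT y:cube (fst i) (snd i)|lebesgue. h y)" by simp
      qed
      also have "\<dots> = ennreal (?N / lam) * ennreal (LINT y:cube (fst i) (snd i)|lebesgue. h y)"
        using lam by (intro ennreal_mult) (auto simp: set_lebesgue_integral_def h0)
      finally show "emeasure lebesgue (cube (fst i) (10 * ?n * snd i)) \<le> \<dots>" .
    qed
    also have "\<dots> = ennreal (?N / lam) * (\<integral>\<^sup>+i. ennreal (LINT y:cube (fst i) (snd i)|lebesgue. h y) \<partial>count_space C)"
      by (rule nn_integral_cmult) auto
    also have "\<dots> \<le> ennreal (?N / lam) * ennreal ?I"
      by (intro mult_left_mono sum_set_integral_le[OF h h0 C(1) dis]) auto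
    also have "\<dots> = ennreal (?N * ?I / lam)" using lam I0 by (simp add: ennreal_mult[symmetric])
    finally have Ule: "emeasure lebesgue U \<le> ennreal (?N * ?I / lam)" .
    then have Ul: "U \<in> lmeasurable" using Um by (intro fmeasurableI) (auto simp: le_less_trans)
    have "measure lebesgue U \<le> ?N * ?I / lam"
      using Ule lam I0 by (simp add: emeasure_eq_measure2[OF Ul] ennreal_le_iff)
    moreover have "(LINT y:cube c l|lebesgue. h y) \<le> lam * l ^ CARD('n)"
      if x: "x \<notin> U" "l > 0" "x \<in> cube c l" for x c l
    proof (rule ccontr)
      assume "\<not> ?thesis"
      then have "(c, l) \<in> K" using x by (simp add: K_def)
      then have "x \<in> (\<Union>i\<in>K. cube (fst i) (snd i))" using x by force
      then obtain i where "i \<in> C" "x \<in> cball (a i) (5 * r i)" using cov by blast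
      then have "x \<in> U" using sub5[of "fst i" "snd i"] by (auto simp: U_def a_def r_def)
      then show False using x by simp
    qed
    ultimately show ?thesis using Ul by blast
  qed
  show thesis
    by (rule that[of "(10 * ?n) ^ CARD('n)"]) (use main n1 in auto)
qed

section \<open>Holder's inequality for \<open>Lr_norm\<close>\<close>

lemma Holder_nn_integral:
  fixes f g :: "'a \<Rightarrow> real"
  assumes [measurable]: "f \<in> borel_measurable M" "g \<in> borel_measurable M"
    and f0: "\<And>x. f x \<ge> 0" and g0: "\<And>x. g x \<ge> 0"
    and pq: "p > 1" "q > 1" "1 / p + 1 / q = 1"
    and F: "(\<integral>\<^sup>+x. ennreal (f x powr p) \<partial>M) \<le> ennreal F" "F \<ge> 0"
    and G: "(\<integral>\<^sup>+x. ennreal (g x powr q) \<partial>M) \<le> ennreal G" "G \<ge> 0"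
  shows "(\<integral>\<^sup>+x. ennreal (f x * g x) \<partial>M) \<le> ennreal (F powr (1 / p) * G powr (1 / q))"
proof (cases "F = 0 \<or> G = 0")
  case True
  have "AE x in M. f x * g x = 0"
  proof (cases "F = 0")
    case True
    then have "(\<integral>\<^sup>+x. ennreal (f x powr p) \<partial>M) = 0" using F by simp
    then have "AE x in M. ennreal (f x powr p) = 0" by (subst (asm) nn_integral_0_iff_AE) auto
    then show ?thesis by eventually_elim (auto simp: ennreal_eq_0_iff)
  next
    case False
    then have "(\<integral>\<^sup>+x. ennreal (g x powr q) \<partial>M) = 0" using G \<open>F = 0 \<or> G = 0\<close> by simp
    then have "AE x in M. ennreal (g x powr q) = 0" by (subst (asm) nn_integral_0_iff_AE) auto
    then show ?thesis by eventually_elim (auto simp: ennreal_eq_0_iff)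
  qed
  then have "AE x in M. ennreal (f x * g x) = 0" by eventually_elim (simp only: ennreal_0)
  then have "(\<integral>\<^sup>+x. ennreal (f x * g x) \<partial>M) = 0" by (subst nn_integral_0_iff_AE) auto
  then show ?thesis by simp
next
  case False
  then have FG: "F > 0" "G > 0" using F G by auto
  \<comment> \<open>After division of f by \<open>a\<close> and of g by \<open>b\<close>, the
    right-hand side of Young's inequality integrates to at most 1 / p + 1 / q = 1.\<close>
  define a where "a = F powr (1 / p)"
  define b where "b = G powr (1 / q)"
  have ab: "a > 0" "b > 0" using FG by (auto simp: a_def b_def)
  have ap: "a powr p = F" "b powr q = G" using FG pq by (auto simp: a_def b_def powr_powr)
  have pt: "f x * g x \<le> a * b / (p * F) * f x powr p + a * b / (q * G) * g x powr q" for x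
  proof -
    have "(f x / a) * (g x / b) \<le> (f x / a) powr p / p + (g x / b) powr q / q"
      using Youngs_inequality[of p q "f x / a" "g x / b"] pq f0 g0 ab by simp
    then have "(f x / a) * (g x / b) \<le> f x powr p / F / p + g x powr q / G / q"
      using f0 g0 ab by (simp add: powr_divide ap)
    then have "a * b * ((f x / a) * (g x / b)) \<le> a * b * (f x powr p / F / p + g x powr q / G / q)"
      using ab by (intro mult_left_mono) auto
    then show ?thesis using ab by (simp add: field_simps)
  qed
  have "(\<integral>\<^sup>+x. ennreal (f x * g x) \<partial>M) \<le>
     (\<integral>\<^sup>+x. ennreal (a * b / (p * F)) * ennreal (f x powr p) + ennreal (a * b / (q * G)) * ennreal (g x powr q) \<partial>M)"
    using pt ab FG pq
    by (intro nn_integral_mono) (simp add: ennreal_mult[symmetric] ennreal_plus[symmetric] ennreal_leI del: ennreal_plus)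
  also have "\<dots> = ennreal (a * b / (p * F)) * (\<integral>\<^sup>+x. ennreal (f x powr p) \<partial>M) + ennreal (a * b / (q * G)) * (\<integral>\<^sup>+x. ennreal (g x powr q) \<partial>M)"
    by (simp add: nn_integral_add nn_integral_cmult)
  also have "\<dots> \<le> ennreal (a * b / (p * F)) * ennreal F + ennreal (a * b / (q * G)) * ennreal G"
    using F G by (intro add_mono mult_left_mono) auto
  also have "\<dots> = ennreal (a * b / (p * F) * F + a * b / (q * G) * G)"
    using ab FG pq by (simp add: ennreal_mult[symmetric] ennreal_plus[symmetric] del: ennreal_plus)
  also have "a * b / (p * F) * F + a * b / (q * G) * G = a * b * (1 / p + 1 / q)"
    using FG by (simp add: field_simps)
  finally show ?thesis using pq by (simp add: a_def b_def)
qed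

lemma conj_exponent_cases:
  assumes "1 < r"
  obtains (infinite) "r = \<infinity>" "conj_exponent r = ennreal 1"
    | (finite) s p where "r = ennreal s" "conj_exponent r = ennreal p" "s > 1" "p > 1" "1 / s + 1 / p = 1"
proof (cases r)
  case top
  then show ?thesis using infinite by (simp add: conj_exponent_def)
next
  case (real s)
  then have s: "s > 1" using assms by (simp add: ennreal_less_iff flip: ennreal_1)
  define p where "p = 1 / (1 - 1 / s)"
  have p: "p > 1" "1 / s + 1 / p = 1" using s by (auto simp: p_def field_simps)
  have "conj_exponent r = inverse (ennreal 1 - ennreal (1 / s))"
    using s real by (simp add: conj_exponent_def inverse_ennreal divide_simps)
  also have "\<dots> = inverse (ennreal (1 - 1 / s))" using s by (subst ennreal_minus) auto
  also have "\<dots> = ennreal p" using s by (subst inverse_ennreal) (auto simp: p_def divide_simps)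
  finally show ?thesis using finite real s p by blast
qed

text \<open>It is \<open>1 < r\<close> that makes the conjugate exponent finite, so that averages
  with a real exponent at least 1 can be used throughout.\<close>

lemma conj_exponent_real:
  assumes "1 < r"
  shows "conj_exponent r = ennreal (enn2real (conj_exponent r))" "enn2real (conj_exponent r) \<ge> 1"
    "enn2real (inverse (conj_exponent r)) = 1 / enn2real (conj_exponent r)"
  using assms by (cases rule: conj_exponent_cases; simp add: inverse_ennreal divide_simps del: ennreal_1)+

lemma Holder_Lr_norm:
  fixes k F :: "real ^ 'n \<Rightarrow> real"
  assumes r: "1 < r" and p: "p = enn2real (conj_exponent r)"
    and A[measurable]: "A \<in> sets lebesgue" and F[measurable]: "F \<in> borel_measurable lebesgue"
    and G: "(\<integral>\<^sup>+x\<in>A. ennreal (\<bar>F x\<bar> powr p) \<partial>lebesgue) \<le> ennreal G" "G \<ge> 0"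
    and fin: "Lr_norm r A k < \<infinity>"
  shows "(\<integral>\<^sup>+x\<in>A. ennreal (\<bar>k x\<bar> * \<bar>F x\<bar>) \<partial>lebesgue) \<le> Lr_norm r A k * ennreal (G powr (1 / p))"
proof -
  \<comment> \<open>\<open>Lr_norm\<close> is infinite on functions that are not measurable on
    \<open>A\<close>, so finiteness provides measurability.\<close>
  have k[measurable]: "k \<in> borel_measurable (lebesgue_on A)" using fin by (auto simp: Lr_norm_def split: if_splits)
  have F'[measurable]: "F \<in> borel_measurable (lebesgue_on A)" using F by (rule measurable_restrict_space1)
  have G': "(\<integral>\<^sup>+x. ennreal (\<bar>F x\<bar> powr p) \<partial>lebesgue_on A) \<le> ennreal G"
    using G by (subst nn_integral_restrict_space) auto
  have "(\<integral>\<^sup>+x. ennreal (\<bar>k x\<bar> * \<bar>F x\<bar>) \<partial>lebesgue_on A) \<le> Lr_norm r A k * ennreal (G powr (1 / p))"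
    using r
  proof (cases rule: conj_exponent_cases)
    case infinite
    then have p1: "p = 1" using p by simp
    have L: "Lr_norm r A k = esssup (lebesgue_on A) (\<lambda>y. ennreal \<bar>k y\<bar>)" using infinite k by (simp add: Lr_norm_def)
    have "AE x in lebesgue_on A. ennreal \<bar>k x\<bar> \<le> Lr_norm r A k" unfolding L by (rule esssup_AE)
    then have "AE x in lebesgue_on A. ennreal (\<bar>k x\<bar> * \<bar>F x\<bar>) \<le> Lr_norm r A k * ennreal \<bar>F x\<bar>"
      by eventually_elim (auto simp: ennreal_mult intro: mult_right_mono)
    then have "(\<integral>\<^sup>+x. ennreal (\<bar>k x\<bar> * \<bar>F x\<bar>) \<partial>lebesgue_on A) \<le> (\<integral>\<^sup>+x. Lr_norm r A k * ennreal \<bar>F x\<bar> \<partial>lebesgue_on A)"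
      by (rule nn_integral_mono_AE)
    also have "\<dots> = Lr_norm r A k * (\<integral>\<^sup>+x. ennreal \<bar>F x\<bar> \<partial>lebesgue_on A)" by (rule nn_integral_cmult) auto
    also have "\<dots> \<le> Lr_norm r A k * ennreal G" using G' p1 by (intro mult_left_mono) auto
    finally show ?thesis using p1 G by simp
  next
    case (finite s p')
    then have pp: "p = p'" using p by simp
    let ?I = "\<integral>\<^sup>+y. ennreal (\<bar>k y\<bar> powr s) \<partial>lebesgue_on A"
    have L: "Lr_norm r A k = (if ?I = \<infinity> then \<infinity> else ennreal (enn2real ?I powr (1 / s)))"
      using finite k by (simp add: Lr_norm_def Let_def)
    then have I: "?I \<noteq> \<infinity>" using fin by (auto split: if_splits)
    then have I': "?I = ennreal (enn2real ?I)" by (simp add: less_top)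
    have "(\<integral>\<^sup>+x. ennreal (\<bar>k x\<bar> * \<bar>F x\<bar>) \<partial>lebesgue_on A) \<le> ennreal (enn2real ?I powr (1 / s) * G powr (1 / p))"
      using finite pp G G' I' by (intro Holder_nn_integral) auto
    then show ?thesis using L I by (simp add: ennreal_mult)
  qed
  then show ?thesis by (subst (asm) nn_integral_restrict_space) auto
qed

section \<open>Operators with a transpose\<close>

lemma supp_subset:
  assumes "\<And>x. f x \<noteq> 0 \<Longrightarrow> x \<in> C" "closed C" shows "supp f \<subseteq> C"
  unfolding supp_def using assms by (intro closure_minimal) auto

lemma LinfcI:
  assumes "f \<in> borel_measurable lebesgue" "\<And>x. \<bar>f x\<bar> \<le> M" "\<And>x. f x \<noteq> 0 \<Longrightarrow> x \<in> cube c l"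
  shows "f \<in> Linfc"
proof -
  have "supp f \<subseteq> cube c l" by (rule supp_subset[OF assms(3)]) auto
  then have "compact (supp f)"
    using compact_Int_closed[OF compact_cube[of c l], of "supp f"] by (simp add: Int_absorb1 supp_def)
  moreover have "bounded (range f)" using assms(2) by (auto simp: bounded_iff)
  ultimately show ?thesis using assms(1) by (simp add: Linfc_def)
qed

lemma LinfcE:
  fixes f :: "real ^ 'n \<Rightarrow> real"
  assumes "f \<in> Linfc"
  obtains M l where "M > 0" "l > 0" "\<forall>x. \<bar>f x\<bar> \<le> M" "\<forall>x l'. f x \<noteq> 0 \<longrightarrow> l \<le> l' \<longrightarrow> x \<in> cube 0 l'"
proof -
  have "bounded (range f)" "compact (supp f)" using assms by (auto simp: Linfc_def)
  obtain M where M: "M > 0" "\<forall>x. \<bar>f x\<bar> \<le> M" using \<open>bounded (range f)\<close> by (auto simp: bounded_pos)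
  obtain l where l: "l > 0" "\<And>l'. l \<le> l' \<Longrightarrow> supp f \<subseteq> cube 0 l'"
    using bounded_subset_cube[OF compact_imp_bounded[OF \<open>compact (supp f)\<close>]] by metis
  have "x \<in> supp f" if "f x \<noteq> 0" for x using that closure_subset by (fastforce simp: supp_def)
  then have *: "x \<in> cube 0 l'" if "f x \<noteq> 0" "l \<le> l'" for x l' using l(2)[of l'] that by blast
  show thesis using that[OF M(1) l(1) M(2)] * by simp
qed

lemma Linfc_measurable: "f \<in> Linfc \<Longrightarrow> f \<in> borel_measurable lebesgue"
  by (simp add: Linfc_def)

lemma bounded_on_cube_integrable:
  fixes f :: "real ^ 'n \<Rightarrow> real"
  assumes "f \<in> borel_measurable lebesgue" "\<And>x. \<bar>f x\<bar> \<le> M" "\<And>x. f x \<noteq> 0 \<Longrightarrow> x \<in> cube c l"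
  shows "integrable lebesgue f"
proof (rule Bochner_Integration.integrable_bound)
  show "integrable lebesgue (\<lambda>x. M * indicator (cube c l) x)"
    using fmeasurableD2[OF cube_lmeasurable[of c l]] by (auto simp: less_top)
  show "AE x in lebesgue. norm (f x) \<le> norm (M * indicator (cube c l) x)"
  proof (rule AE_I2)
    fix x show "norm (f x) \<le> norm (M * indicator (cube c l) x)"
      using assms(2)[of x] assms(3)[of x] by (cases "f x = 0") (auto simp: indicator_def)
  qed
qed fact

lemma Linfc_integrable:
  assumes "f \<in> Linfc" shows "integrable lebesgue f"
proof -
  obtain M l where M: "M > 0" "l > 0" "\<And>x. \<bar>f x\<bar> \<le> M" "\<And>x l'. f x \<noteq> 0 \<Longrightarrow> l \<le> l' \<Longrightarrow> x \<in> cube 0 l'"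
    using LinfcE[OF assms] by metis
  show ?thesis
    using bounded_on_cube_integrable[OF Linfc_measurable[OF assms] M(3), of 0 l] M(4)[of _ l] by simp
qed

lemma Linfc_powr_integrable:
  assumes "f \<in> Linfc" "p > 0" shows "integrable lebesgue (\<lambda>x. \<bar>f x\<bar> powr p)"
proof -
  obtain M l where M: "M > 0" "l > 0" "\<And>x. \<bar>f x\<bar> \<le> M" "\<And>x l'. f x \<noteq> 0 \<Longrightarrow> l \<le> l' \<Longrightarrow> x \<in> cube 0 l'"
    using LinfcE[OF assms(1)] by metis
  have [measurable]: "f \<in> borel_measurable lebesgue" using assms(1) by (rule Linfc_measurable)
  show ?thesis
  proof (rule bounded_on_cube_integrable)
    show "\<bar>\<bar>f x\<bar> powr p\<bar> \<le> M powr p" for x using M(3)[of x] assms(2) by (simp add: powr_mono2)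
    show "\<bar>f x\<bar> powr p \<noteq> 0 \<Longrightarrow> x \<in> cube 0 l" for x using M(4)[of x l] by auto
  qed measurable
qed

lemma Linfc_dominated:
  assumes "f \<in> Linfc" "g \<in> borel_measurable lebesgue" "\<And>x. \<bar>g x\<bar> \<le> C * \<bar>f x\<bar>"
  shows "g \<in> Linfc"
proof -
  obtain M l where M: "M > 0" "l > 0" "\<And>x. \<bar>f x\<bar> \<le> M" "\<And>x l'. f x \<noteq> 0 \<Longrightarrow> l \<le> l' \<Longrightarrow> x \<in> cube 0 l'"
    using LinfcE[OF assms(1)] by metis
  show ?thesis
  proof (rule LinfcI[OF assms(2)])
    show "\<bar>g x\<bar> \<le> \<bar>C\<bar> * M" for x
    proof -
      have "\<bar>g x\<bar> \<le> \<bar>C\<bar> * \<bar>f x\<bar>" using assms(3)[of x] abs_ge_self[of C] mult_right_mono[of C "\<bar>C\<bar>" "\<bar>f x\<bar>"] by linarith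
      also have "\<dots> \<le> \<bar>C\<bar> * M" using M(3)[of x] by (intro mult_left_mono) auto
      finally show ?thesis .
    qed
    show "x \<in> cube 0 l" if "g x \<noteq> 0" for x
      using M(4)[of x l] assms(3)[of x] that by (cases "f x = 0") auto
  qed
qed

lemma Linfc_mult_indicator:
  assumes "f \<in> Linfc" "A \<in> sets lebesgue" shows "(\<lambda>x. f x * indicator A x) \<in> Linfc"
proof (rule Linfc_dominated[OF assms(1), of _ 1])
  show "(\<lambda>x. f x * indicator A x) \<in> borel_measurable lebesgue"
    using Linfc_measurable[OF assms(1)] assms(2) by measurable
qed (auto simp: indicator_def)

lemma Linfc_add:
  assumes "f \<in> Linfc" "g \<in> Linfc" shows "(\<lambda>x. a * f x + b * g x) \<in> Linfc"
proof -
  obtain M l where M: "M > 0" "l > 0" "\<And>x. \<bar>f x\<bar> \<le> M" "\<And>x l'. f x \<noteq> 0 \<Longrightarrow> l \<le> l' \<Longrightarrow> x \<in> cube 0 l'"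
    using LinfcE[OF assms(1)] by metis
  obtain M' l' where M': "M' > 0" "l' > 0" "\<And>x. \<bar>g x\<bar> \<le> M'" "\<And>x l2. g x \<noteq> 0 \<Longrightarrow> l' \<le> l2 \<Longrightarrow> x \<in> cube 0 l2"
    using LinfcE[OF assms(2)] by metis
  have [measurable]: "f \<in> borel_measurable lebesgue" "g \<in> borel_measurable lebesgue"
    using assms Linfc_measurable by auto
  show ?thesis
  proof (rule LinfcI)
    show "\<bar>a * f x + b * g x\<bar> \<le> \<bar>a\<bar> * M + \<bar>b\<bar> * M'" for x
      using mult_left_mono[OF M(3)[of x], of "\<bar>a\<bar>"] mult_left_mono[OF M'(3)[of x], of "\<bar>b\<bar>"]
        abs_triangle_ineq[of "a * f x" "b * g x"] by (simp add: abs_mult)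
    show "a * f x + b * g x \<noteq> 0 \<Longrightarrow> x \<in> cube 0 (max l l')" for x
      using M(4)[of x "max l l'"] M'(4)[of x "max l l'"] by (cases "f x = 0") auto
  qed measurable
qed

lemma Linfc_indicator:
  assumes "A \<in> sets lebesgue" "A \<subseteq> cube c l" shows "indicator A \<in> Linfc"
  by (rule LinfcI[where M = 1 and c = c and l = l]) (use assms in \<open>auto simp: indicator_def\<close>)

section \<open>Estimates obtained by pairing with the transpose\<close>

locale transposed_operator =
  fixes T Tt :: "(real ^ 'n \<Rightarrow> real) \<Rightarrow> real ^ 'n \<Rightarrow> real"
  assumes linear: "linear_operator T" and transpose: "is_transpose T Tt"
begin

lemma T_measurable [measurable]: "f \<in> Linfc \<Longrightarrow> T f \<in> borel_measurable lebesgue"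
  using linear by (simp add: linear_operator_def)

lemma T_linear:
  "f \<in> Linfc \<Longrightarrow> g \<in> Linfc \<Longrightarrow> AE x in lebesgue. T (\<lambda>y. a * f y + b * g y) x = a * T f x + b * T g x"
  using linear by (simp add: linear_operator_def)

lemma T_add: "f \<in> Linfc \<Longrightarrow> g \<in> Linfc \<Longrightarrow> AE x in lebesgue. T (\<lambda>y. f y + g y) x = T f x + T g x"
  using T_linear[of f g 1 1] by simp

lemma pairing:
  assumes "f \<in> Linfc" "g \<in> Linfc"
  shows "integrable lebesgue (\<lambda>x. T f x * g x)" "integrable lebesgue (\<lambda>x. f x * Tt g x)"
    "(LINT x|lebesgue. T f x * g x) = (LINT x|lebesgue. f x * Tt g x)"
  using transpose assms by (auto simp: is_transpose_def)

text \<open>The sign of \<open>T f\<close> on \<open>A\<close> is an admissible test function that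
  recovers the integral of the modulus of \<open>T f\<close> over \<open>A\<close>. On the other
  side of the pairing \<open>f\<close> appears undisturbed and can be decomposed.\<close>

lemma T_dual:
  assumes f: "f \<in> Linfc" and A: "A \<in> sets lebesgue" "A \<subseteq> cube c l"
  defines "g \<equiv> \<lambda>x. sgn (T f x) * indicator A x"
  shows "g \<in> Linfc" "\<And>x. \<bar>g x\<bar> \<le> indicator A x"
    "(\<integral>\<^sup>+x\<in>A. ennreal \<bar>T f x\<bar> \<partial>lebesgue) = ennreal (LINT x|lebesgue. f x * Tt g x)"
proof -
  have [measurable]: "T f \<in> borel_measurable lebesgue" "A \<in> sets lebesgue" using f A by auto
  show b: "\<bar>g x\<bar> \<le> indicator A x" for x by (auto simp: g_def indicator_def sgn_if)
  have "g \<in> borel_measurable lebesgue" unfolding g_def by measurable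
  then show g: "g \<in> Linfc"
    using Linfc_dominated[OF Linfc_indicator[OF A], of g 1] b by (auto simp: indicator_def)
  have "(\<integral>\<^sup>+x\<in>A. ennreal \<bar>T f x\<bar> \<partial>lebesgue) = (\<integral>\<^sup>+x. ennreal (T f x * g x) \<partial>lebesgue)"
    by (intro nn_integral_cong) (auto simp: g_def indicator_def abs_sgn mult.commute)
  also have "\<dots> = ennreal (LINT x|lebesgue. T f x * g x)"
    using pairing(1)[OF f g] by (intro nn_integral_eq_integral) (auto simp: g_def indicator_def sgn_if)
  finally show "(\<integral>\<^sup>+x\<in>A. ennreal \<bar>T f x\<bar> \<partial>lebesgue) = ennreal (LINT x|lebesgue. f x * Tt g x)"
    using pairing(3)[OF f g] by simp
qed

text \<open>\<open>T\<close> acts on functions, not on classes modulo null sets, so this needs an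
  argument: every pairing of \<open>T f\<close> equals an integral of \<open>f\<close> times
  something, hence vanishes.\<close>

lemma T_null:
  assumes f: "f \<in> Linfc" and z: "AE x in lebesgue. f x = 0"
  shows "AE x in lebesgue. T f x = 0"
proof -
  have [measurable]: "T f \<in> borel_measurable lebesgue" using f by auto
  have "AE x in lebesgue. x \<in> cube 0 (real m) \<longrightarrow> T f x = 0" for m :: nat
  proof -
    let ?g = "\<lambda>x. sgn (T f x) * indicator (cube 0 (real m)) x"
    have "AE x in lebesgue. f x * Tt ?g x = 0" using z by eventually_elim simp
    then have "(LINT x|lebesgue. f x * Tt ?g x) = 0" by (rule integral_eq_zero_AE)
    then have "(\<integral>\<^sup>+x\<in>cube 0 (real m). ennreal \<bar>T f x\<bar> \<partial>lebesgue) = 0"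
      using T_dual(3)[OF f cube_meas subset_refl] by simp
    then have "AE x in lebesgue. ennreal \<bar>T f x\<bar> * indicator (cube 0 (real m)) x = 0"
      by (subst (asm) nn_integral_0_iff_AE) auto
    then show ?thesis by eventually_elim (auto simp: indicator_def)
  qed
  then have "AE x in lebesgue. \<forall>m::nat. x \<in> cube 0 (real m) \<longrightarrow> T f x = 0"
    unfolding AE_all_countable by blast
  then show ?thesis
  proof eventually_elim
    fix x :: "real ^ 'n" assume *: "\<forall>m::nat. x \<in> cube 0 (real m) \<longrightarrow> T f x = 0"
    obtain B where B: "B > 0" "\<And>l. l \<ge> B \<Longrightarrow> {x} \<subseteq> cube 0 l" using bounded_subset_cube[of "{x}"] by auto
    obtain m :: nat where "B \<le> real m" using real_arch_simple by blast
    then show "T f x = 0" using * B by blast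
  qed
qed

text \<open>The hypothesis knows \<open>Tt\<close> only on indicators. So the sign of
  \<open>T f\<close> on the cube is split into the sets where \<open>T f\<close> is positive and
  where it is negative; each contributes at most B * M times the volume, whence the factor 2. As
  \<open>f\<close> lives on the cube, only the integral of \<open>Tt (indicator E)\<close> over that
  cube matters. The bound on \<open>f\<close> is needed only almost everywhere, which is how the
  good function is bounded later.\<close>

lemma T_testing:
  assumes test: "\<And>E. E \<in> sets lebesgue \<Longrightarrow> E \<subseteq> cube c l \<Longrightarrow>
      (\<integral>\<^sup>+x\<in>cube c l. ennreal \<bar>Tt (indicator E) x\<bar> \<partial>lebesgue) \<le> ennreal (B * l ^ CARD('n))"
    and f: "f \<in> Linfc" "AE x in lebesgue. \<bar>f x\<bar> \<le> M" "\<And>x. f x \<noteq> 0 \<Longrightarrow> x \<in> cube c l"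
    and pos: "M \<ge> 0" "B \<ge> 0" "l \<ge> 0"
  shows "(\<integral>\<^sup>+x\<in>cube c l. ennreal \<bar>T f x\<bar> \<partial>lebesgue) \<le> ennreal (2 * B * M * l ^ CARD('n))"
proof -
  let ?Q = "cube c l"
  have [measurable]: "T f \<in> borel_measurable lebesgue" "f \<in> borel_measurable lebesgue"
    using f Linfc_measurable by auto
  have half: "ennreal \<bar>LINT x|lebesgue. T f x * indicator E x\<bar> \<le> ennreal (B * M * l ^ CARD('n))"
    if E: "E \<in> sets lebesgue" "E \<subseteq> ?Q" for E
  proof -
    let ?h = "Tt (indicator E)"
    have Ei: "indicator E \<in> Linfc" using E by (rule Linfc_indicator)
    \<comment> \<open>Measurability of \<open>Tt (indicator E)\<close> on the cube is not assumed;
      it comes from integrability of the pairing with the indicator of the cube.\<close>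
    have [measurable]: "(\<lambda>x. indicator ?Q x * ?h x) \<in> borel_measurable lebesgue"
      using pairing(2)[OF Linfc_indicator[OF cube_meas subset_refl] Ei] by blast
    have "ennreal \<bar>LINT x|lebesgue. T f x * indicator E x\<bar> = ennreal \<bar>LINT x|lebesgue. f x * ?h x\<bar>"
      using pairing(3)[OF f(1) Ei] by simp
    also have "\<dots> \<le> (\<integral>\<^sup>+x. ennreal \<bar>f x * ?h x\<bar> \<partial>lebesgue)"
      using integral_norm_bound_ennreal[OF pairing(2)[OF f(1) Ei]] by simp
    also have "\<dots> \<le> (\<integral>\<^sup>+x. ennreal M * ennreal \<bar>indicator ?Q x * ?h x\<bar> \<partial>lebesgue)"
    proof (rule nn_integral_mono_AE)
      show "AE x in lebesgue. ennreal \<bar>f x * ?h x\<bar> \<le> ennreal M * ennreal \<bar>indicator ?Q x * ?h x\<bar>"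
        using f(2)
      proof eventually_elim
        fix x assume "\<bar>f x\<bar> \<le> M"
        then have "\<bar>f x\<bar> \<le> M * indicator ?Q x" using f(3)[of x] pos by (auto simp: indicator_def)
        then have "\<bar>f x * ?h x\<bar> \<le> M * \<bar>indicator ?Q x * ?h x\<bar>"
          using mult_right_mono[of "\<bar>f x\<bar>" "M * indicator ?Q x" "\<bar>?h x\<bar>"] by (simp add: abs_mult mult.assoc)
        then show "ennreal \<bar>f x * ?h x\<bar> \<le> ennreal M * ennreal \<bar>indicator ?Q x * ?h x\<bar>"
          using pos by (simp add: ennreal_mult[symmetric] ennreal_leI)
      qed
    qed
    also have "\<dots> = ennreal M * (\<integral>\<^sup>+x. ennreal \<bar>indicator ?Q x * ?h x\<bar> \<partial>lebesgue)"
      by (rule nn_integral_cmult) measurable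
    also have "(\<integral>\<^sup>+x. ennreal \<bar>indicator ?Q x * ?h x\<bar> \<partial>lebesgue) = (\<integral>\<^sup>+x\<in>?Q. ennreal \<bar>?h x\<bar> \<partial>lebesgue)"
      by (intro nn_integral_cong) (auto simp: indicator_def)
    also have "ennreal M * \<dots> \<le> ennreal M * ennreal (B * l ^ CARD('n))"
      by (intro mult_left_mono test E) auto
    also have "\<dots> = ennreal (B * M * l ^ CARD('n))" using pos by (simp add: ennreal_mult[symmetric] mult_ac)
    finally show ?thesis .
  qed
  define E1 where "E1 = {x \<in> space lebesgue. T f x > 0} \<inter> ?Q"
  define E2 where "E2 = {x \<in> space lebesgue. T f x < 0} \<inter> ?Q"
  have E: "E1 \<in> sets lebesgue" "E2 \<in> sets lebesgue" unfolding E1_def E2_def by measurable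
  have sub: "E1 \<subseteq> ?Q" "E2 \<subseteq> ?Q" by (auto simp: E1_def E2_def)
  have int: "integrable lebesgue (\<lambda>x. T f x * indicator E1 x)" "integrable lebesgue (\<lambda>x. T f x * indicator E2 x)"
    using pairing(1)[OF f(1) Linfc_indicator[OF E(1) sub(1)]] pairing(1)[OF f(1) Linfc_indicator[OF E(2) sub(2)]] by auto
  have "(\<integral>\<^sup>+x\<in>?Q. ennreal \<bar>T f x\<bar> \<partial>lebesgue) =
     (\<integral>\<^sup>+x. ennreal (T f x * indicator E1 x) + ennreal (- (T f x * indicator E2 x)) \<partial>lebesgue)"
    by (intro nn_integral_cong) (auto simp: E1_def E2_def indicator_def abs_if ennreal_neg split: if_splits)
  also have "\<dots> = (\<integral>\<^sup>+x. ennreal (T f x * indicator E1 x) \<partial>lebesgue) + (\<integral>\<^sup>+x. ennreal (- (T f x * indicator E2 x)) \<partial>lebesgue)"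
    using E by (intro nn_integral_add) auto
  also have "\<dots> \<le> ennreal (B * M * l ^ CARD('n)) + ennreal (B * M * l ^ CARD('n))"
  proof (rule add_mono)
    have "(\<integral>\<^sup>+x. ennreal (T f x * indicator E1 x) \<partial>lebesgue) = ennreal (LINT x|lebesgue. T f x * indicator E1 x)"
      by (intro nn_integral_eq_integral int) (auto simp: E1_def indicator_def)
    also have "\<dots> \<le> ennreal \<bar>LINT x|lebesgue. T f x * indicator E1 x\<bar>" by (intro ennreal_leI) auto
    also note half[OF E(1) sub(1)]
    finally show "(\<integral>\<^sup>+x. ennreal (T f x * indicator E1 x) \<partial>lebesgue) \<le> ennreal (B * M * l ^ CARD('n))" .
    have "(\<integral>\<^sup>+x. ennreal (- (T f x * indicator E2 x)) \<partial>lebesgue) = ennreal (LINT x|lebesgue. - (T f x * indicator E2 x))"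
      using int by (intro nn_integral_eq_integral) (auto simp: E2_def indicator_def)
    also have "\<dots> \<le> ennreal \<bar>LINT x|lebesgue. T f x * indicator E2 x\<bar>" by (intro ennreal_leI) auto
    also note half[OF E(2) sub(2)]
    finally show "(\<integral>\<^sup>+x. ennreal (- (T f x * indicator E2 x)) \<partial>lebesgue) \<le> ennreal (B * M * l ^ CARD('n))" .
  qed
  also have "\<dots> = ennreal (2 * B * M * l ^ CARD('n))"
    using pos by (simp add: ennreal_plus[symmetric] del: ennreal_plus)
  finally show ?thesis .
qed

end

section \<open>Kernel estimates\<close>

text \<open>Measurability is asked for one annulus at a time, because a finite
  \<open>Lr_norm\<close> gives measurability of the kernel difference only there.\<close>

lemma nn_integral_annuli:
  fixes f :: "real ^ 'n \<Rightarrow> ennreal"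
  assumes l: "l > 0"
    and m: "\<And>k. (\<lambda>x. f x * indicator (cube c (2 ^ Suc k * l) - cube c (2 ^ k * l)) x) \<in> borel_measurable lebesgue"
  shows "(\<integral>\<^sup>+x\<in>- cube c l. f x \<partial>lebesgue) \<le>
    (\<Sum>k. \<integral>\<^sup>+x\<in>cube c (2 ^ Suc k * l) - cube c (2 ^ k * l). f x \<partial>lebesgue)"
proof -
  let ?A = "\<lambda>k::nat. cube c (2 ^ Suc k * l) - cube c (2 ^ k * l)"
  have sub: "- cube c l \<subseteq> (\<Union>k. ?A k)"
  proof
    fix x assume x: "x \<in> - cube c l"
    obtain b where b: "b > 0" "{x - c} \<subseteq> cube 0 b" using bounded_subset_cube[of "{x - c}"] by auto
    obtain k where k: "b / l < 2 ^ k" using real_arch_pow[of 2 "b / l"] by auto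
    then have "b \<le> 2 ^ k * l" using l by (simp add: field_simps)
    then have "x - c \<in> cube 0 (2 ^ k * l)" using b cube_mono by blast
    then have ex: "x \<in> cube c (2 ^ k * l)" by (simp add: mem_cube)
    define j where "j = (LEAST k. x \<in> cube c (2 ^ k * l))"
    have j: "x \<in> cube c (2 ^ j * l)" unfolding j_def using ex by (rule LeastI)
    have "j \<noteq> 0" using j x by (cases j) auto
    then obtain i where i: "j = Suc i" by (cases j) auto
    have "x \<notin> cube c (2 ^ i * l)" using not_less_Least[of i "\<lambda>k. x \<in> cube c (2 ^ k * l)"] i by (simp add: j_def)
    then show "x \<in> (\<Union>k. ?A k)" using j i by blast
  qed
  have "(\<integral>\<^sup>+x\<in>- cube c l. f x \<partial>lebesgue) \<le> (\<integral>\<^sup>+x\<in>(\<Union>k. ?A k). f x \<partial>lebesgue)"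
    using sub by (intro nn_integral_mono mult_left_mono) (auto simp: indicator_def)
  also have "\<dots> \<le> (\<integral>\<^sup>+k. (\<integral>\<^sup>+x\<in>?A k. f x \<partial>lebesgue) \<partial>count_space UNIV)"
    using m by (intro nn_integral_UN_le) auto
  also have "\<dots> = (\<Sum>k. \<integral>\<^sup>+x\<in>?A k. f x \<partial>lebesgue)" by (rule nn_integral_count_space_nat)
  finally show ?thesis .
qed

lemma Lr_norm_measurable:
  assumes "Lr_norm r A g < \<infinity>" "A \<in> sets lebesgue"
  shows "(\<lambda>x. g x * indicator A x) \<in> borel_measurable lebesgue"
proof -
  have "g \<in> borel_measurable (lebesgue_on A)" using assms by (auto simp: Lr_norm_def split: if_splits)
  then have "(\<lambda>x. if x \<in> A then g x else 0) \<in> borel_measurable lebesgue" using assms(2) by (rule borel_measurable_if_I)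
  moreover have "(\<lambda>x. if x \<in> A then g x else 0) = (\<lambda>x. g x * indicator A x)" by (auto simp: indicator_def)
  ultimately show ?thesis by simp
qed

lemma nn_integral_le_Lr_norm_1:
  assumes A: "A \<in> sets lebesgue"
  shows "(\<integral>\<^sup>+x\<in>A. ennreal \<bar>g x\<bar> \<partial>lebesgue) \<le> Lr_norm 1 A g"
proof (cases "g \<in> borel_measurable (lebesgue_on A)")
  case True
  have "(\<integral>\<^sup>+x\<in>A. ennreal \<bar>g x\<bar> \<partial>lebesgue) = (\<integral>\<^sup>+x. ennreal \<bar>g x\<bar> \<partial>lebesgue_on A)"
    using A by (subst nn_integral_restrict_space) auto
  then show ?thesis using True by (simp add: Lr_norm_def Let_def less_top)
qed (simp add: Lr_norm_def)

lemma Hormander_bound: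
  fixes K :: "real ^ 'n \<Rightarrow> real ^ 'n \<Rightarrow> real"
  assumes "K \<in> Hormander r"
  obtains H where "H > 0" "\<And>c l x x'. l > 0 \<Longrightarrow> x \<in> cube c (l / 2) \<Longrightarrow> x' \<in> cube c (l / 2) \<Longrightarrow>
    (\<Sum>k. ennreal (measure lebesgue (cube c (2 ^ Suc k * l)) powr enn2real (inverse (conj_exponent r))) *
       Lr_norm r (cube c (2 ^ Suc k * l) - cube c (2 ^ k * l)) (\<lambda>y. K x y - K x' y)) \<le> ennreal H"
proof -
  let ?S = "\<lambda>c l x x'. (\<Sum>k. ennreal (measure lebesgue (cube c (2 ^ Suc k * l)) powr enn2real (inverse (conj_exponent r))) *
       Lr_norm r (cube c (2 ^ Suc k * l) - cube c (2 ^ k * l)) (\<lambda>y. K x y - K x' y))"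
  let ?s = "SUP (c, l) \<in> {(c, l). l > 0}. SUP x \<in> cube c (l / 2). SUP x' \<in> cube c (l / 2). ?S c l x x'"
  have fin: "?s < \<infinity>" using assms by (simp add: Hormander_def)
  have le: "?S c l x x' \<le> ?s" if "l > 0" "x \<in> cube c (l / 2)" "x' \<in> cube c (l / 2)" for c l x x'
    by (rule SUP_upper2[of "(c, l)"], use that in simp, simp only: split_conv,
        rule SUP_upper2[OF that(2)], rule SUP_upper2[OF that(3)], rule order_refl)
  show thesis
  proof (rule that[of "enn2real ?s + 1"])
    show "enn2real ?s + 1 > 0" by (simp add: add_nonneg_pos)
    fix c x x' :: "real ^ 'n" and l :: real
    assume "l > 0" "x \<in> cube c (l / 2)" "x' \<in> cube c (l / 2)"
    from le[OF this] have "?S c l x x' \<le> ennreal (enn2real ?s)" using fin by simp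
    also have "\<dots> \<le> ennreal (enn2real ?s + 1)" by (intro ennreal_leI) simp
    finally show "?S c l x x' \<le> ennreal (enn2real ?s + 1)" .
  qed
qed

text \<open>For r = 1 the conjugate exponent is infinite, the weight is a zeroth power of a positive
  volume, and the Hormander sum dominates the plain integral. The condition is applied to the
  doubled cube, whose half is \<open>cube c l\<close>; its annuli start at side 2 * l.\<close>

lemma Hormander_1_bound:
  fixes K :: "real ^ 'n \<Rightarrow> real ^ 'n \<Rightarrow> real"
  assumes "K \<in> Hormander 1"
  obtains H where "H > 0" "\<And>c l x x'. l > 0 \<Longrightarrow> x \<in> cube c l \<Longrightarrow> x' \<in> cube c l \<Longrightarrow>
    (\<integral>\<^sup>+y\<in>- cube c (2 * l). ennreal \<bar>K x y - K x' y\<bar> \<partial>lebesgue) \<le> ennreal H"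
proof -
  obtain H where H: "H > 0" and b: "\<And>c l x x'. l > 0 \<Longrightarrow> x \<in> cube c (l / 2) \<Longrightarrow> x' \<in> cube c (l / 2) \<Longrightarrow>
    (\<Sum>k. ennreal (measure lebesgue (cube c (2 ^ Suc k * l)) powr enn2real (inverse (conj_exponent 1))) *
       Lr_norm 1 (cube c (2 ^ Suc k * l) - cube c (2 ^ k * l)) (\<lambda>y. K x y - K x' y)) \<le> ennreal H"
    using Hormander_bound[OF assms] by blast
  show thesis
  proof (rule that[OF H])
    fix c :: "real ^ 'n" and l x x' assume l: "l > 0" and x: "x \<in> cube c l" "x' \<in> cube c l"
    let ?A = "\<lambda>k. cube c (2 ^ Suc k * (2 * l)) - cube c (2 ^ k * (2 * l))"
    let ?g = "\<lambda>y. K x y - K x' y"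
    have c1: "enn2real (inverse (conj_exponent 1)) = 0" by (simp add: conj_exponent_def)
    have m1: "measure lebesgue (cube c (2 ^ Suc k * (2 * l))) powr 0 = 1" for k
      using l by simp
    have s: "(\<Sum>k. Lr_norm 1 (?A k) ?g) \<le> ennreal H"
      using b[of "2 * l" x c x'] l x unfolding c1 m1 by simp
    have fin: "Lr_norm 1 (?A k) ?g < \<infinity>" for k
    proof -
      have "Lr_norm 1 (?A k) ?g = sum (\<lambda>k. Lr_norm 1 (?A k) ?g) {k}" by simp
      also have "\<dots> \<le> (\<Sum>k. Lr_norm 1 (?A k) ?g)" by (rule sum_le_suminf) auto
      also have "\<dots> < \<infinity>" using s le_less_trans by fastforce
      finally show ?thesis .
    qed
    have "(\<integral>\<^sup>+y\<in>- cube c (2 * l). ennreal \<bar>?g y\<bar> \<partial>lebesgue) \<le> (\<Sum>k. \<integral>\<^sup>+y\<in>?A k. ennreal \<bar>?g y\<bar> \<partial>lebesgue)"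
    proof (rule nn_integral_annuli)
      fix k
      have [measurable]: "(\<lambda>y. ?g y * indicator (?A k) y) \<in> borel_measurable lebesgue"
        by (rule Lr_norm_measurable[OF fin]) simp
      have "(\<lambda>y. ennreal \<bar>?g y * indicator (?A k) y\<bar>) \<in> borel_measurable lebesgue" by measurable
      moreover have "(\<lambda>y. ennreal \<bar>?g y * indicator (?A k) y\<bar>) = (\<lambda>y. ennreal \<bar>?g y\<bar> * indicator (?A k) y)"
        by (auto simp: indicator_def)
      ultimately show "(\<lambda>y. ennreal \<bar>?g y\<bar> * indicator (?A k) y) \<in> borel_measurable lebesgue" by (simp only:)
    qed (use l in simp)
    also have "\<dots> \<le> (\<Sum>k. Lr_norm 1 (?A k) ?g)"
      by (intro suminf_le nn_integral_le_Lr_norm_1) auto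
    finally show "(\<integral>\<^sup>+y\<in>- cube c (2 * l). ennreal \<bar>?g y\<bar> \<partial>lebesgue) \<le> ennreal H" using s by (rule order_trans)
  qed
qed

text \<open>Holder's inequality on each annulus: the hypothesis on \<open>F\<close> yields the
  factor a times the volume to the power 1 / p, and this power of the volume is exactly the weight
  in the Hormander sum. The estimate holds for all pairs of points, not almost all, since the kernel
  representation is pointwise off the support; this is what allows one good point to control a whole
  cube.\<close>

lemma kernel_oscillation:
  fixes T :: "(real ^ 'n \<Rightarrow> real) \<Rightarrow> real ^ 'n \<Rightarrow> real"
  assumes hk: "has_kernel T K" and r: "1 < r" and p: "p = enn2real (conj_exponent r)"
    and H: "\<And>x x'. x \<in> cube c l \<Longrightarrow> x' \<in> cube c l \<Longrightarrow>
      (\<Sum>k. ennreal (measure lebesgue (cube c (2 ^ Suc k * (2 * l))) powr enn2real (inverse (conj_exponent r))) *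
         Lr_norm r (cube c (2 ^ Suc k * (2 * l)) - cube c (2 ^ k * (2 * l))) (\<lambda>y. K x y - K x' y)) \<le> ennreal H" "H \<ge> 0"
    and l: "l > 0" and F: "F \<in> Linfc" "\<And>y. F y \<noteq> 0 \<Longrightarrow> y \<notin> cube c (3 * l)"
    and a: "a \<ge> 0" "\<And>k::nat. (LINT y:cube c (2 ^ Suc k * (2 * l))|lebesgue. \<bar>F y\<bar> powr p) \<le> a powr p * (2 ^ Suc k * (2 * l)) ^ CARD('n)"
    and x: "x \<in> cube c l" "x' \<in> cube c l"
  shows "\<bar>T F x - T F x'\<bar> \<le> H * a"
proof -
  note pr = conj_exponent_real[OF r, folded p]
  have p0: "p > 0" using pr(2) by simp
  let ?A = "\<lambda>k. cube c (2 ^ Suc k * (2 * l)) - cube c (2 ^ k * (2 * l))"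
  let ?V = "\<lambda>k::nat. measure lebesgue (cube c (2 ^ Suc k * (2 * l)))"
  let ?g = "\<lambda>y. K x y - K x' y"
  have V: "?V k = (2 ^ Suc k * (2 * l)) ^ CARD('n)" for k using l by simp
  have Vpos: "?V k > 0" for k unfolding V using l by simp
  have s: "(\<Sum>k. ennreal (?V k powr (1 / p)) * Lr_norm r (?A k) ?g) \<le> ennreal H"
    using H(1)[OF x] unfolding pr(3) by simp
  have fin: "Lr_norm r (?A k) ?g < \<infinity>" for k
  proof -
    have "ennreal (?V k powr (1 / p)) * Lr_norm r (?A k) ?g = sum (\<lambda>k. ennreal (?V k powr (1 / p)) * Lr_norm r (?A k) ?g) {k}" by simp
    also have "\<dots> \<le> (\<Sum>k. ennreal (?V k powr (1 / p)) * Lr_norm r (?A k) ?g)" by (rule sum_le_suminf) auto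
    also have "\<dots> < \<infinity>" using s le_less_trans by fastforce
    finally show ?thesis using Vpos[of k] by (auto simp: ennreal_mult_less_top ennreal_mult_eq_top_iff less_top[symmetric])
  qed
  have Fm[measurable]: "F \<in> borel_measurable lebesgue" using F Linfc_measurable by blast
  \<comment> \<open>\<open>supp F\<close> is a closure, so vanishing on the closed triple excludes
    only its interior; the closed cube \<open>cube c l\<close> lies in that interior.\<close>
  have ns: "z \<notin> supp F" if z: "z \<in> cube c l" for z
  proof -
    let ?O = "box (c - vec (3 * l / 2)) (c + vec (3 * l / 2))"
    have "?O \<inter> {y. F y \<noteq> 0} = {}" using F(2) box_subset_cbox unfolding cube_def by blast
    then have "?O \<inter> supp F = {}" unfolding supp_def using open_Int_closure_eq_empty[OF open_box] by blast
    moreover have "z \<in> ?O"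
    proof -
      have *: "\<bar>z $ i - c $ i\<bar> \<le> l / 2" for i using z by (simp add: mem_cube)
      have "c $ i - 3 * l / 2 < z $ i \<and> z $ i < c $ i + 3 * l / 2" for i using *[of i] l by arith
      then show ?thesis by (simp add: mem_box_cart)
    qed
    ultimately show ?thesis by blast
  qed
  have kx: "integrable lebesgue (\<lambda>y. K z y * F y)" "T F z = (LINT y|lebesgue. K z y * F y)" if "z \<in> cube c l" for z
    using hk F(1) ns[OF that] by (auto simp: has_kernel_def)
  have "T F x - T F x' = (LINT y|lebesgue. K x y * F y - K x' y * F y)"
    using kx[OF x(1)] kx[OF x(2)] by simp
  then have "ennreal \<bar>T F x - T F x'\<bar> \<le> (\<integral>\<^sup>+y. ennreal \<bar>K x y * F y - K x' y * F y\<bar> \<partial>lebesgue)"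
    using integral_norm_bound_ennreal[OF Bochner_Integration.integrable_diff[OF kx(1)[OF x(1)] kx(1)[OF x(2)]]] by simp
  also have "\<dots> = (\<integral>\<^sup>+y\<in>- cube c (2 * l). ennreal (\<bar>?g y\<bar> * \<bar>F y\<bar>) \<partial>lebesgue)"
  proof (rule nn_integral_cong)
    fix y
    show "ennreal \<bar>K x y * F y - K x' y * F y\<bar> = ennreal (\<bar>?g y\<bar> * \<bar>F y\<bar>) * indicator (- cube c (2 * l)) y"
    proof (cases "y \<in> cube c (2 * l)")
      case True
      then have "y \<in> cube c (3 * l)" using cube_mono[of "2 * l" "3 * l" c] l by auto
      then have "F y = 0" using F(2) by blast
      then show ?thesis by simp
    qed (simp add: left_diff_distrib[symmetric] abs_mult)
  qed
  also have "\<dots> \<le> (\<Sum>k. \<integral>\<^sup>+y\<in>?A k. ennreal (\<bar>?g y\<bar> * \<bar>F y\<bar>) \<partial>lebesgue)"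
  proof (rule nn_integral_annuli)
    fix k
    have [measurable]: "(\<lambda>y. ?g y * indicator (?A k) y) \<in> borel_measurable lebesgue"
      by (rule Lr_norm_measurable[OF fin]) simp
    have "(\<lambda>y. ennreal (\<bar>?g y * indicator (?A k) y\<bar> * \<bar>F y\<bar>)) \<in> borel_measurable lebesgue" by measurable
    moreover have "(\<lambda>y. ennreal (\<bar>?g y * indicator (?A k) y\<bar> * \<bar>F y\<bar>)) = (\<lambda>y. ennreal (\<bar>?g y\<bar> * \<bar>F y\<bar>) * indicator (?A k) y)"
      by (auto simp: indicator_def)
    ultimately show "(\<lambda>y. ennreal (\<bar>?g y\<bar> * \<bar>F y\<bar>) * indicator (?A k) y) \<in> borel_measurable lebesgue" by (simp only:)
  qed (use l in simp)
  also have "\<dots> \<le> (\<Sum>k. ennreal a * (ennreal (?V k powr (1 / p)) * Lr_norm r (?A k) ?g))"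
  proof (intro suminf_le)
    fix k
    have ip: "integrable lebesgue (\<lambda>y. \<bar>F y\<bar> powr p)" by (rule Linfc_powr_integrable[OF F(1) p0])
    have "(\<integral>\<^sup>+y\<in>?A k. ennreal (\<bar>F y\<bar> powr p) \<partial>lebesgue) \<le>
        (\<integral>\<^sup>+y. ennreal (indicator (cube c (2 ^ Suc k * (2 * l))) y * \<bar>F y\<bar> powr p) \<partial>lebesgue)"
      by (intro nn_integral_mono) (auto simp: indicator_def)
    also have "\<dots> = ennreal (LINT y:cube c (2 ^ Suc k * (2 * l))|lebesgue. \<bar>F y\<bar> powr p)"
      unfolding set_lebesgue_integral_def using integrable_mult_indicator[OF cube_meas ip]
      by (subst nn_integral_eq_integral) auto
    also have "\<dots> \<le> ennreal (a powr p * ?V k)"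
      unfolding V by (intro ennreal_leI a)
    finally have "(\<integral>\<^sup>+y\<in>?A k. ennreal (\<bar>?g y\<bar> * \<bar>F y\<bar>) \<partial>lebesgue) \<le> Lr_norm r (?A k) ?g * ennreal ((a powr p * ?V k) powr (1 / p))"
      by (intro Holder_Lr_norm[OF r p _ Fm _ _ fin]) auto
    also have "(a powr p * ?V k) powr (1 / p) = a * ?V k powr (1 / p)"
      using a(1) p0 by (simp add: powr_mult powr_powr)
    also have "Lr_norm r (?A k) ?g * ennreal (a * ?V k powr (1 / p)) = ennreal a * (ennreal (?V k powr (1 / p)) * Lr_norm r (?A k) ?g)"
      using a(1) by (simp add: ennreal_mult mult_ac)
    finally show "(\<integral>\<^sup>+y\<in>?A k. ennreal (\<bar>?g y\<bar> * \<bar>F y\<bar>) \<partial>lebesgue) \<le> ennreal a * (ennreal (?V k powr (1 / p)) * Lr_norm r (?A k) ?g)" .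
  qed auto
  also have "\<dots> = ennreal a * (\<Sum>k. ennreal (?V k powr (1 / p)) * Lr_norm r (?A k) ?g)"
    by (rule ennreal_suminf_cmult)
  also have "\<dots> \<le> ennreal a * ennreal H" using s by (rule mult_left_mono) simp
  also have "\<dots> = ennreal (H * a)" using a(1) H(2) by (simp add: ennreal_mult mult.commute)
  finally show ?thesis using a(1) H(2) by simp
qed

text \<open>Fubini's theorem is used for the Borel product, while \<open>K\<close> is only Lebesgue
  measurable off the diagonal. The null set \<open>N\<close> is kept explicit because
  \<open>K\<close> and its Borel version are compared along single sections in both
  variables.\<close>

lemma kernel_borel_version:
  fixes K :: "real ^ 'n \<Rightarrow> real ^ 'n \<Rightarrow> real"
  assumes "is_kernel K"
  obtains K' N where "K' \<in> borel_measurable (lborel \<Otimes>\<^sub>M lborel)" "N \<in> sets (lborel \<Otimes>\<^sub>M lborel)"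
    "AE x in lborel. AE y in lborel. (x, y) \<notin> N" "AE y in lborel. AE x in lborel. (x, y) \<notin> N"
    "\<And>x y. x \<noteq> y \<Longrightarrow> (x, y) \<notin> N \<Longrightarrow> K' (x, y) = K x y"
proof -
  let ?D = "{(x :: real ^ 'n, y). x \<noteq> y}"
  have "open ?D" using open_Collect_neq[of "fst :: (real ^ 'n) \<times> (real ^ 'n) \<Rightarrow> _" snd]
    by (simp add: case_prod_unfold continuous_on_fst continuous_on_snd)
  then have "(\<lambda>z. if z \<in> ?D then (\<lambda>(x, y). K x y) z else 0) \<in> borel_measurable lebesgue"
    using assms unfolding is_kernel_def by (intro borel_measurable_if_I) auto
  from completion_ex_borel_measurable_real[OF this]
  obtain K' where K': "K' \<in> borel_measurable lborel"
    "AE z in lborel. (if z \<in> ?D then (\<lambda>(x, y). K x y) z else 0) = K' z" by blast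
  then obtain N where N: "N \<in> null_sets lborel"
    "{z \<in> space lborel. \<not> (if z \<in> ?D then (\<lambda>(x, y). K x y) z else 0) = K' z} \<subseteq> N"
    unfolding eventually_ae_filter by blast
  have Ns: "N \<in> sets (lborel \<Otimes>\<^sub>M lborel)" unfolding lborel_prod using N(1) by (rule null_setsD2)
  have "AE z in lborel \<Otimes>\<^sub>M lborel. z \<notin> N" unfolding lborel_prod using N(1) by (rule AE_not_in)
  from lborel_pair.AE_pair[OF this] have 1: "AE x in lborel. AE y in lborel. (x, y) \<notin> N" .
  have "{z \<in> space (lborel \<Otimes>\<^sub>M lborel). (fst z, snd z) \<notin> N} = space (lborel \<Otimes>\<^sub>M lborel) - N" by auto
  then have "{z \<in> space (lborel \<Otimes>\<^sub>M lborel). (fst z, snd z) \<notin> N} \<in> sets (lborel \<Otimes>\<^sub>M lborel)"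
    using Ns by (simp only: sets.compl_sets)
  from lborel_pair.AE_commute[OF this] 1 have 2: "AE y in lborel. AE x in lborel. (x, y) \<notin> N" by simp
  have 3: "K' (x, y) = K x y" if "x \<noteq> y" "(x, y) \<notin> N" for x y
    using N(2) that by force
  have "K' \<in> borel_measurable (lborel \<Otimes>\<^sub>M lborel)" unfolding lborel_prod by (rule K'(1))
  from that[OF this Ns 1 2] 3 show thesis by blast
qed

lemma AE_lborel_ex:
  assumes "AE x in lborel. P x" "A \<in> sets borel" "emeasure lborel A > 0"
  shows "\<exists>x\<in>A. P x"
proof (rule ccontr)
  assume "\<not> ?thesis"
  then have "AE x in lborel. x \<notin> A" using assms(1) by (auto elim: eventually_mono)
  then have "A \<in> null_sets lborel" using assms(2) by (subst AE_iff_null_sets) auto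
  then show False using assms(3) by (simp add: null_sets_def)
qed

text \<open>The mean value zero allows \<open>K x y0\<close> to be subtracted under the integral.
  After Fubini the inner integral over x of the difference in the second variable is what the
  condition on the transposed kernel bounds.\<close>

lemma kernel_atom:
  fixes T :: "(real ^ 'n \<Rightarrow> real) \<Rightarrow> real ^ 'n \<Rightarrow> real"
  assumes hk: "has_kernel T K" and ker: "is_kernel K"
    and H: "\<And>y y'. y \<in> cube c l \<Longrightarrow> y' \<in> cube c l \<Longrightarrow>
      (\<integral>\<^sup>+x\<in>- cube c (2 * l). ennreal \<bar>K x y - K x y'\<bar> \<partial>lebesgue) \<le> ennreal H" "H \<ge> 0"
    and l: "l > 0" and b: "b \<in> Linfc" "\<And>y. b y \<noteq> 0 \<Longrightarrow> y \<in> cube c l" "(LINT y|lebesgue. b y) = 0"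
  shows "(\<integral>\<^sup>+x\<in>- cube c (2 * l). ennreal \<bar>T b x\<bar> \<partial>lebesgue) \<le> ennreal (H * (LINT y|lebesgue. \<bar>b y\<bar>))"
proof -
  let ?Q = "cube c l" and ?O = "- cube c (2 * l)"
  have QO: "?Q \<subseteq> cube c (2 * l)" using l by (intro cube_mono) auto
  obtain K' N where K'[measurable]: "K' \<in> borel_measurable (lborel \<Otimes>\<^sub>M lborel)"
    and N: "N \<in> sets (lborel \<Otimes>\<^sub>M lborel)"
    "AE x in lborel. AE y in lborel. (x, y) \<notin> N" "AE y in lborel. AE x in lborel. (x, y) \<notin> N"
    and K'eq: "\<And>x y. x \<noteq> y \<Longrightarrow> (x, y) \<notin> N \<Longrightarrow> K' (x, y) = K x y"
    using kernel_borel_version[OF ker] by blast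
  \<comment> \<open>Sections of \<open>K\<close> are controlled only for almost every \<open>y\<close>, so the centre of \<open>Q\<close> cannot serve as base point.\<close>
  have "\<exists>y\<in>?Q. AE x in lborel. (x, y) \<notin> N"
    using l by (intro AE_lborel_ex N(3)) auto
  then obtain y0 where y0: "y0 \<in> ?Q" "AE x in lborel. (x, y0) \<notin> N" by blast
  obtain b' where b'[measurable]: "b' \<in> borel_measurable lborel" and b'eq: "AE y in lborel. b y = b' y"
    using completion_ex_borel_measurable_real[OF Linfc_measurable[OF b(1)]] by blast
  \<comment> \<open>A Borel representative of \<open>b\<close>, cut off to the cube, so that
    \<open>G\<close> is jointly Borel measurable.\<close>
  define bb where "bb = (\<lambda>y. b' y * indicator ?Q y)"
  have bb[measurable]: "bb \<in> borel_measurable lborel" unfolding bb_def by measurable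
  have bbeq: "AE y in lborel. b y = bb y"
    using b'eq
  proof eventually_elim
    fix y assume "b y = b' y"
    then show "b y = bb y" using b(2)[of y] by (cases "b y = 0") (auto simp: bb_def indicator_def)
  qed
  have bb0: "bb y = 0" if "y \<notin> ?Q" for y using that by (simp add: bb_def)
  have bint: "integrable lebesgue b" using b(1) by (rule Linfc_integrable)
  define G where "G = (\<lambda>x y. ennreal (\<bar>K' (x, y) - K' (x, y0)\<bar> * \<bar>bb y\<bar>) * indicator ?O x)"
  have [measurable]: "(\<lambda>x. K' (x, y)) \<in> borel_measurable lborel" for y
    by (rule measurable_compose[OF _ K']) simp
  have [measurable]: "?O \<in> sets borel" by simp
  have Gm: "case_prod G \<in> borel_measurable (lborel \<Otimes>\<^sub>M lborel)"
    unfolding G_def by measurable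
  have pt: "AE x in lborel. ennreal \<bar>T b x\<bar> * indicator ?O x \<le> (\<integral>\<^sup>+y. G x y \<partial>lborel)"
    using N(2) y0(2)
  proof eventually_elim
    fix x assume x: "AE y in lborel. (x, y) \<notin> N" "(x, y0) \<notin> N"
    show "ennreal \<bar>T b x\<bar> * indicator ?O x \<le> (\<integral>\<^sup>+y. G x y \<partial>lborel)"
    proof (cases "x \<in> ?O")
      case True
      then have xQ: "x \<notin> ?Q" using QO by blast
      have "supp b \<subseteq> ?Q" using b(2) by (rule supp_subset) auto
      then have k: "integrable lebesgue (\<lambda>y. K x y * b y)" "T b x = (LINT y|lebesgue. K x y * b y)"
        using hk b(1) xQ unfolding has_kernel_def by blast+
      have k0: "integrable lebesgue (\<lambda>y. K x y0 * b y)" using bint by simp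
      have "T b x = (LINT y|lebesgue. K x y * b y - K x y0 * b y)"
        using k k0 b(3) by simp
      then have "ennreal \<bar>T b x\<bar> \<le> (\<integral>\<^sup>+y. ennreal \<bar>K x y * b y - K x y0 * b y\<bar> \<partial>lebesgue)"
        using integral_norm_bound_ennreal[OF Bochner_Integration.integrable_diff[OF k(1) k0]] by simp
      also have "\<dots> = (\<integral>\<^sup>+y. ennreal \<bar>K x y * b y - K x y0 * b y\<bar> \<partial>lborel)" by (rule nn_integral_completion)
      also have "\<dots> = (\<integral>\<^sup>+y. G x y \<partial>lborel)"
      proof (rule nn_integral_cong_AE)
        show "AE y in lborel. ennreal \<bar>K x y * b y - K x y0 * b y\<bar> = G x y"
          using x(1) bbeq
        proof eventually_elim
          fix y assume y: "(x, y) \<notin> N" "b y = bb y"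
          show "ennreal \<bar>K x y * b y - K x y0 * b y\<bar> = G x y"
          proof (cases "y \<in> ?Q")
            case True
            then have "K' (x, y) = K x y" "K' (x, y0) = K x y0" using K'eq xQ y0 x(2) y(1) by metis+
            then show ?thesis using \<open>x \<in> ?O\<close> y(2) by (simp add: G_def left_diff_distrib[symmetric] abs_mult)
          qed (use bb0 y(2) in \<open>simp add: G_def\<close>)
        qed
      qed
      finally show ?thesis using True by simp
    qed simp
  qed
  have "(\<integral>\<^sup>+x\<in>?O. ennreal \<bar>T b x\<bar> \<partial>lebesgue) = (\<integral>\<^sup>+x\<in>?O. ennreal \<bar>T b x\<bar> \<partial>lborel)" by (rule nn_integral_completion)
  also have "\<dots> \<le> (\<integral>\<^sup>+x. (\<integral>\<^sup>+y. G x y \<partial>lborel) \<partial>lborel)" using pt by (rule nn_integral_mono_AE)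
  also have "\<dots> = (\<integral>\<^sup>+y. (\<integral>\<^sup>+x. G x y \<partial>lborel) \<partial>lborel)" using lborel_pair.Fubini'[OF Gm] by simp
  also have "\<dots> \<le> (\<integral>\<^sup>+y. ennreal H * ennreal \<bar>bb y\<bar> \<partial>lborel)"
  proof (rule nn_integral_mono_AE)
    show "AE y in lborel. (\<integral>\<^sup>+x. G x y \<partial>lborel) \<le> ennreal H * ennreal \<bar>bb y\<bar>"
      using N(3)
    proof eventually_elim
      fix y assume y: "AE x in lborel. (x, y) \<notin> N"
      show "(\<integral>\<^sup>+x. G x y \<partial>lborel) \<le> ennreal H * ennreal \<bar>bb y\<bar>"
      proof (cases "y \<in> ?Q")
        case True
        have "(\<integral>\<^sup>+x. G x y \<partial>lborel) = (\<integral>\<^sup>+x. (ennreal \<bar>K' (x, y) - K' (x, y0)\<bar> * indicator ?O x) * ennreal \<bar>bb y\<bar> \<partial>lborel)"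
          by (intro nn_integral_cong) (simp add: G_def ennreal_mult mult_ac)
        also have "\<dots> = (\<integral>\<^sup>+x\<in>?O. ennreal \<bar>K' (x, y) - K' (x, y0)\<bar> \<partial>lborel) * ennreal \<bar>bb y\<bar>"
          by (rule nn_integral_multc) measurable
        also have "(\<integral>\<^sup>+x\<in>?O. ennreal \<bar>K' (x, y) - K' (x, y0)\<bar> \<partial>lborel) = (\<integral>\<^sup>+x\<in>?O. ennreal \<bar>K x y - K x y0\<bar> \<partial>lborel)"
        proof (rule nn_integral_cong_AE)
          show "AE x in lborel. ennreal \<bar>K' (x, y) - K' (x, y0)\<bar> * indicator ?O x = ennreal \<bar>K x y - K x y0\<bar> * indicator ?O x"
            using y y0(2)
          proof eventually_elim
            fix x assume x: "(x, y) \<notin> N" "(x, y0) \<notin> N"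
            show "ennreal \<bar>K' (x, y) - K' (x, y0)\<bar> * indicator ?O x = ennreal \<bar>K x y - K x y0\<bar> * indicator ?O x"
            proof (cases "x \<in> ?O")
              case xO: True
              then have "x \<noteq> y" "x \<noteq> y0" using QO True y0(1) by auto
              then show ?thesis using K'eq x by simp
            qed simp
          qed
        qed
        also have "\<dots> = (\<integral>\<^sup>+x\<in>?O. ennreal \<bar>K x y - K x y0\<bar> \<partial>lebesgue)" by (rule nn_integral_completion[symmetric])
        also have "\<dots> * ennreal \<bar>bb y\<bar> \<le> ennreal H * ennreal \<bar>bb y\<bar>"
          by (intro mult_right_mono H(1) True y0(1)) simp
        finally show ?thesis .
      qed (simp add: G_def bb0)
    qed
  qed
  also have "\<dots> = ennreal H * (\<integral>\<^sup>+y. ennreal \<bar>bb y\<bar> \<partial>lborel)" by (rule nn_integral_cmult) measurable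
  also have "(\<integral>\<^sup>+y. ennreal \<bar>bb y\<bar> \<partial>lborel) = (\<integral>\<^sup>+y. ennreal \<bar>b y\<bar> \<partial>lborel)"
    using bbeq by (intro nn_integral_cong_AE) (auto elim: eventually_mono)
  also have "\<dots> = (\<integral>\<^sup>+y. ennreal \<bar>b y\<bar> \<partial>lebesgue)" by (rule nn_integral_completion[symmetric])
  also have "\<dots> = ennreal (LINT y|lebesgue. \<bar>b y\<bar>)" using bint by (intro nn_integral_eq_integral) auto
  also have "ennreal H * \<dots> = ennreal (H * (LINT y|lebesgue. \<bar>b y\<bar>))" using H(2) by (simp add: ennreal_mult)
  finally show ?thesis .
qed

section \<open>Chebyshev's inequality, series over disjoint sets, and the decomposition of a
  function into good and bad parts\<close>

lemma markov_lmeasurable: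
  fixes f :: "'a::euclidean_space \<Rightarrow> real"
  assumes [measurable]: "f \<in> borel_measurable lebesgue" "D \<in> sets lebesgue"
    and le: "(\<integral>\<^sup>+x\<in>D. ennreal \<bar>f x\<bar> \<partial>lebesgue) \<le> ennreal I" and I: "I \<ge> 0" and t: "t > 0"
  shows "{x \<in> D. \<bar>f x\<bar> > t} \<in> lmeasurable" "measure lebesgue {x \<in> D. \<bar>f x\<bar> > t} \<le> I / t"
proof -
  let ?S = "{x \<in> D. \<bar>f x\<bar> > t}"
  have "?S = {x \<in> space lebesgue. \<bar>f x\<bar> > t} \<inter> D" by auto
  also have "\<dots> \<in> sets lebesgue" by measurable
  finally have S: "?S \<in> sets lebesgue" .
  have "ennreal t * emeasure lebesgue ?S = (\<integral>\<^sup>+x. ennreal t * indicator ?S x \<partial>lebesgue)"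
    using S by (simp add: nn_integral_cmult_indicator)
  also have "\<dots> \<le> (\<integral>\<^sup>+x\<in>D. ennreal \<bar>f x\<bar> \<partial>lebesgue)"
    by (intro nn_integral_mono) (auto simp: indicator_def intro!: ennreal_leI)
  finally have *: "ennreal t * emeasure lebesgue ?S \<le> ennreal I" using le by (rule order_trans)
  then have "emeasure lebesgue ?S < \<infinity>"
    using t by (auto simp: less_top[symmetric] ennreal_mult_eq_top_iff top_unique)
  then show m: "?S \<in> lmeasurable" using S by (intro fmeasurableI) auto
  have "t * measure lebesgue ?S \<le> I"
    using * t I by (simp add: emeasure_eq_measure2[OF m] ennreal_mult[symmetric] ennreal_le_iff)
  then show "measure lebesgue ?S \<le> I / t" using t by (simp add: field_simps)
qed

text \<open>Padding with empty sets indexes a possibly finite family by all of \<open>nat\<close>,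
  so that the integral of a signed function can be expanded as a series.\<close>

lemma countable_disjoint_enumeration:
  fixes A :: "'i::countable \<Rightarrow> 'a set"
  assumes "disjoint_family_on A I"
  obtains A' :: "nat \<Rightarrow> 'a set" where "disjoint_family A'" "(\<Union>j. A' j) = (\<Union>i\<in>I. A i)"
    "\<And>j. A' j = {} \<or> (\<exists>i\<in>I. A' j = A i)"
proof -
  define A' where "A' = (\<lambda>j. \<Union>i\<in>{i\<in>I. to_nat i = j}. A i)"
  have s: "A' (to_nat i) = A i" if "i \<in> I" for i
  proof -
    have "{i'\<in>I. to_nat i' = to_nat i} = {i}" using that by auto
    then show ?thesis by (simp add: A'_def)
  qed
  have e: "A' j = {} \<or> (\<exists>i\<in>I. to_nat i = j \<and> A' j = A i)" for j
  proof (cases "\<exists>i\<in>I. to_nat i = j")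
    case True then show ?thesis using s by blast
  next
    case False then show ?thesis by (auto simp: A'_def)
  qed
  show thesis
  proof (rule that)
    show "disjoint_family A'"
      unfolding disjoint_family_on_def
    proof (intro ballI impI)
      fix j k :: nat assume "j \<noteq> k"
      show "A' j \<inter> A' k = {}"
      proof (rule ccontr)
        assume ne: "A' j \<inter> A' k \<noteq> {}"
        obtain i where i: "i \<in> I" "to_nat i = j" "A' j = A i" using e[of j] ne by blast
        obtain i' where i': "i' \<in> I" "to_nat i' = k" "A' k = A i'" using e[of k] ne by blast
        have "i \<noteq> i'" using i i' \<open>j \<noteq> k\<close> by blast
        then have "A i \<inter> A i' = {}" using assms i i' unfolding disjoint_family_on_def by blast
        then show False using ne i i' by simp
      qed
    qed
    show "(\<Union>j. A' j) = (\<Union>i\<in>I. A i)" by (auto simp: A'_def)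
  qed (use e in blast)
qed

lemma abs_integral_disjoint_union_le:
  fixes \<psi> :: "'a \<Rightarrow> real" and A :: "nat \<Rightarrow> 'a set"
  assumes int: "integrable M \<psi>" and A: "disjoint_family A" "\<And>j. A j \<in> sets M"
    and z: "\<And>x. x \<notin> (\<Union>j. A j) \<Longrightarrow> \<psi> x = 0"
    and b: "\<And>j. ennreal \<bar>LINT x:A j|M. \<psi> x\<bar> \<le> \<beta> j"
  shows "ennreal \<bar>LINT x|M. \<psi> x\<bar> \<le> (\<Sum>j. \<beta> j)"
proof -
  let ?a = "\<lambda>j. LINT x:A j|M. \<psi> x"
  have "(LINT x|M. \<psi> x) = (LINT x:(\<Union>j. A j)|M. \<psi> x)"
    unfolding set_lebesgue_integral_def using z
    by (intro Bochner_Integration.integral_cong refl) (auto simp: indicator_def)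
  also have "\<dots> = (\<Sum>j. ?a j)"
  proof (rule lebesgue_integral_countable_add)
    show "set_integrable M (\<Union>j. A j) \<psi>"
      unfolding set_integrable_def using A by (intro integrable_mult_indicator int) auto
  qed (use A in \<open>auto simp: disjoint_family_on_def\<close>)
  finally have eq: "(LINT x|M. \<psi> x) = (\<Sum>j. ?a j)" .
  have "ennreal \<bar>\<Sum>j. ?a j\<bar> \<le> (\<Sum>j. ennreal \<bar>?a j\<bar>)"
  proof (cases "(\<Sum>j. ennreal \<bar>?a j\<bar>) = top")
    case False
    then have s: "summable (\<lambda>j. \<bar>?a j\<bar>)" by (intro summable_suminf_not_top) auto
    have "ennreal \<bar>\<Sum>j. ?a j\<bar> \<le> ennreal (\<Sum>j. \<bar>?a j\<bar>)" by (intro ennreal_leI summable_rabs s)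
    also have "\<dots> = (\<Sum>j. ennreal \<bar>?a j\<bar>)" by (rule suminf_ennreal2[symmetric]) (use s in auto)
    finally show ?thesis .
  qed simp
  also have "\<dots> \<le> (\<Sum>j. \<beta> j)" by (intro suminf_le b) auto
  finally show ?thesis unfolding eq .
qed

lemma Linfc_abs:
  assumes "f \<in> Linfc" shows "(\<lambda>x. \<bar>f x\<bar>) \<in> Linfc"
  by (rule Linfc_dominated[OF assms, of _ 1]) (use Linfc_measurable[OF assms] in auto)

text \<open>A selected cube has average above \<open>lam\<close>, so the bound on the total integral
  keeps its side at most \<open>l\<close>; it must also meet the support of \<open>f\<close>. This
  confines the good function to the tripled cube, where the testing bound can be used.\<close>

lemma cz_cubes_localized:
  fixes f :: "real ^ 'n \<Rightarrow> real"
  assumes f: "f \<in> Linfc" "\<And>y. f y \<noteq> 0 \<Longrightarrow> y \<in> cube c l" and lam: "lam > 0" and l: "l > 0"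
    and le: "(LINT x|lebesgue. \<bar>f x\<bar>) \<le> lam * l ^ CARD('n)"
    and q: "q \<in> cz_cubes (\<lambda>x. \<bar>f x\<bar>) lam"
  shows "tcube q \<subseteq> cube c (3 * l)"
proof -
  have h: "integrable lebesgue (\<lambda>x. \<bar>f x\<bar>)" using f(1) Linfc_abs Linfc_integrable by blast
  have low: "lam * tside q ^ CARD('n) < (LINT x:tcube q|lebesgue. \<bar>f x\<bar>)"
    using q by (simp add: cz_cubes_def maximal_tcubes_def)
  also have "\<dots> \<le> (LINT x|lebesgue. \<bar>f x\<bar>)"
    using h by (rule set_integral_le_integral) auto
  finally have "lam * tside q ^ CARD('n) \<le> lam * l ^ CARD('n)" using le by linarith
  then have "tside q ^ CARD('n) \<le> l ^ CARD('n)" using lam by simp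
  then have s: "tside q \<le> l" using l by (simp add: power_mono_iff)
  have "\<exists>z\<in>tcube q. f z \<noteq> 0"
  proof (rule ccontr)
    assume "\<not> ?thesis"
    then have "(LINT x:tcube q|lebesgue. \<bar>f x\<bar>) = 0"
      unfolding set_lebesgue_integral_def by (intro integral_eq_zero_AE AE_I2) (auto simp: indicator_def)
    then show False using low lam tside_pos(1)[of q] by (simp add: mult_less_0_iff)
  qed
  then obtain z where z: "z \<in> tcube q" "z \<in> cube c l" using f(2) by blast
  show ?thesis
  proof
    fix x assume x: "x \<in> tcube q"
    have "\<bar>x $ i - c $ i\<bar> \<le> 3 * l / 2" for i
    proof -
      have "- tside q / 2 \<le> x $ i - tcenter q $ i \<and> x $ i - tcenter q $ i < tside q / 2"
        "- tside q / 2 \<le> z $ i - tcenter q $ i \<and> z $ i - tcenter q $ i < tside q / 2"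
        using x z by (auto simp: mem_tcube_iff)
      moreover have "\<bar>z $ i - c $ i\<bar> \<le> l / 2" using z by (simp add: mem_cube)
      ultimately show ?thesis using s by argo
    qed
    then show "x \<in> cube c (3 * l)" by (simp add: mem_cube)
  qed
qed

text \<open>The good function \<open>g\<close> replaces \<open>f\<close> by its average on each
  selected cube. Its bound comes from \<open>cz_upper\<close> on these cubes and from
  \<open>cz_small\<close> off them, hence only almost everywhere. The bad part f - g is kept as one
  function; only its vanishing mean and its mass on each cube are recorded.\<close>

lemma cz_decomposition:
  fixes f :: "real ^ 'n \<Rightarrow> real"
  assumes f: "f \<in> Linfc" "\<And>y. f y \<noteq> 0 \<Longrightarrow> y \<in> cube c l" and lam: "lam > 0" and l: "l > 0"
    and le: "(LINT x|lebesgue. \<bar>f x\<bar>) \<le> lam * l ^ CARD('n)"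
  defines "M \<equiv> cz_cubes (\<lambda>x. \<bar>f x\<bar>) lam"
  obtains g where "g \<in> Linfc" "AE x in lebesgue. \<bar>g x\<bar> \<le> 3 ^ CARD('n) * lam"
    "\<And>y. g y \<noteq> 0 \<Longrightarrow> y \<in> cube c (3 * l)" "\<And>x. x \<notin> (\<Union>q\<in>M. tcube q) \<Longrightarrow> g x = f x"
    "\<And>q. q \<in> M \<Longrightarrow> (LINT x:tcube q|lebesgue. f x - g x) = 0"
    "\<And>q. q \<in> M \<Longrightarrow> (LINT x:tcube q|lebesgue. \<bar>f x - g x\<bar>) \<le> 2 * (LINT x:tcube q|lebesgue. \<bar>f x\<bar>)"
proof -
  have h: "integrable lebesgue (\<lambda>x. \<bar>f x\<bar>)" using f(1) Linfc_abs Linfc_integrable by blast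
  have fi: "integrable lebesgue f" using f(1) by (rule Linfc_integrable)
  have fm[measurable]: "f \<in> borel_measurable lebesgue" using f(1) by (rule Linfc_measurable)
  let ?W = "\<Union>q\<in>M. tcube q"
  define av where "av = (\<lambda>q. (LINT x:tcube q|lebesgue. f x) / tside q ^ CARD('n))"
  \<comment> \<open>The choice is unambiguous because the selected cubes are disjoint.\<close>
  define iq where "iq = (\<lambda>x. SOME q. q \<in> M \<and> x \<in> tcube q)"
  define g where "g = (\<lambda>x. if x \<in> ?W then av (iq x) else f x)"
  have dis: "disjoint_family_on tcube M" unfolding M_def by (rule cz_disjoint[OF h _ lam]) simp
  have iq: "iq x = q" if "q \<in> M" "x \<in> tcube q" for x q
  proof -
    have "iq x \<in> M \<and> x \<in> tcube (iq x)" unfolding iq_def by (rule someI[of _ q]) (use that in blast)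
    then show ?thesis using dis that unfolding disjoint_family_on_def by blast
  qed
  have gq: "g x = av q" if "q \<in> M" "x \<in> tcube q" for x q
    using iq[OF that] that by (auto simp: g_def)
  have gW: "g x = f x" if "x \<notin> ?W" for x using that by (simp add: g_def)
  have Wm: "?W \<in> sets lebesgue" by (intro sets.countable_UN') auto
  have gm: "g \<in> borel_measurable lebesgue"
  proof (rule measurable_piecewise_restrict[of "insert (- ?W) (tcube ` M)"])
    fix \<Omega> assume O: "\<Omega> \<in> insert (- ?W) (tcube ` M)"
    have "- ?W \<in> sets lebesgue" using sets.compl_sets[OF Wm] by (simp add: Compl_eq_Diff_UNIV)
    then show "\<Omega> \<inter> space lebesgue \<in> sets lebesgue" using O by auto
    show "g \<in> borel_measurable (restrict_space lebesgue \<Omega>)"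
    proof (cases "\<Omega> = - ?W")
      case True
      have "f \<in> borel_measurable (restrict_space lebesgue \<Omega>)" using fm by (rule measurable_restrict_space1)
      then show ?thesis
        by (subst measurable_cong[of _ g f]) (use True gW in \<open>auto simp: space_restrict_space\<close>)
    next
      case False
      then obtain q where q: "q \<in> M" "\<Omega> = tcube q" using O by blast
      show ?thesis
        by (subst measurable_cong[of _ g "\<lambda>_. av q"]) (use q gq in \<open>auto simp: space_restrict_space\<close>)
    qed
  qed auto
  have avb: "\<bar>av q\<bar> * tside q ^ CARD('n) \<le> (LINT x:tcube q|lebesgue. \<bar>f x\<bar>)" for q
  proof -
    have "\<bar>LINT x:tcube q|lebesgue. f x\<bar> \<le> (LINT x:tcube q|lebesgue. \<bar>f x\<bar>)"
      using set_integral_norm_bound[of lebesgue "tcube q" f] integrable_mult_indicator[OF tcube_meas fi]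
      by (simp add: set_integrable_def)
    then show ?thesis by (simp add: av_def)
  qed
  have av3: "\<bar>av q\<bar> \<le> 3 ^ CARD('n) * lam" if "q \<in> M" for q
  proof -
    have "(LINT x:tcube q|lebesgue. \<bar>f x\<bar>) \<le> 3 ^ CARD('n) * lam * tside q ^ CARD('n)"
      by (rule cz_upper[OF h _ lam]) (use that M_def in auto)
    with avb[of q] have "\<bar>av q\<bar> * tside q ^ CARD('n) \<le> 3 ^ CARD('n) * lam * tside q ^ CARD('n)" by linarith
    then show ?thesis using tside_pos(1)[of q] by (simp add: mult_le_cancel_right)
  qed
  have gsupp: "y \<in> cube c (3 * l)" if "g y \<noteq> 0" for y
  proof (cases "y \<in> ?W")
    case True
    then show ?thesis using cz_cubes_localized[OF f lam l le] unfolding M_def by blast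
  next
    case False
    then show ?thesis using that gW[of y] f(2)[of y] cube_mono[of l "3 * l" c] l by auto
  qed
  obtain Mf where Mf: "\<forall>x. \<bar>f x\<bar> \<le> Mf" using LinfcE[OF f(1)] by metis
  have gL: "g \<in> Linfc"
  proof (rule LinfcI[OF gm _ gsupp])
    show "\<bar>g x\<bar> \<le> max Mf (3 ^ CARD('n) * lam)" for x
    proof (cases "x \<in> ?W")
      case True
      then obtain q where "q \<in> M" "x \<in> tcube q" by blast
      then show ?thesis using gq[of q x] av3[of q] by (simp add: le_max_iff_disj)
    next
      case False
      then have "\<bar>g x\<bar> \<le> Mf" using gW[of x] Mf by metis
      then show ?thesis by simp
    qed
  qed
  have g3: "AE x in lebesgue. \<bar>g x\<bar> \<le> 3 ^ CARD('n) * lam"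
  proof -
    have "AE x in lebesgue. x \<notin> ?W \<longrightarrow> \<bar>f x\<bar> \<le> 2 * lam"
      unfolding M_def by (rule cz_small[OF h _ lam]) simp
    then show ?thesis
    proof eventually_elim
      fix x assume *: "x \<notin> ?W \<longrightarrow> \<bar>f x\<bar> \<le> 2 * lam"
      \<comment> \<open>The dimension is at least 1, so 3^n absorbs the factor 2 of
        \<open>cz_small\<close>.\<close>
      have "(3::real) ^ 1 \<le> 3 ^ CARD('n)" by (intro power_increasing) (auto simp: Suc_leI)
      then have "2 * lam \<le> 3 ^ CARD('n) * lam" using lam by (intro mult_right_mono) auto
      show "\<bar>g x\<bar> \<le> 3 ^ CARD('n) * lam"
      proof (cases "x \<in> ?W")
        case True
        then obtain q where "q \<in> M" "x \<in> tcube q" by blast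
        then show ?thesis using gq[of q x] av3[of q] by simp
      next
        case False
        then have "\<bar>g x\<bar> \<le> 2 * lam" using gW[OF False] * by metis
        then show ?thesis using \<open>2 * lam \<le> _\<close> by linarith
      qed
    qed
  qed
  have si: "set_integrable lebesgue (tcube q) f" "set_integrable lebesgue (tcube q) (\<lambda>x. \<bar>f x\<bar>)"
    "set_integrable lebesgue (tcube q) (\<lambda>_. k)" for q :: "'n tindex" and k :: real
    using integrable_mult_indicator[OF tcube_meas fi] integrable_mult_indicator[OF tcube_meas h]
    by (auto simp: set_integrable_def)
  have kint: "(LINT x:tcube q|lebesgue. k) = k * tside q ^ CARD('n)" for q :: "'n tindex" and k
    by (simp add: set_lebesgue_integral_def)
  have z: "(LINT x:tcube q|lebesgue. f x - g x) = 0" if q: "q \<in> M" for q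
  proof -
    have "(LINT x:tcube q|lebesgue. f x - g x) = (LINT x:tcube q|lebesgue. f x - av q)"
      using gq[OF q] by (intro set_lebesgue_integral_cong) auto
    also have "\<dots> = (LINT x:tcube q|lebesgue. f x) - av q * tside q ^ CARD('n)"
      using si by (subst set_integral_diff) (auto simp: kint)
    finally show ?thesis by (simp add: av_def)
  qed
  have d: "(LINT x:tcube q|lebesgue. \<bar>f x - g x\<bar>) \<le> 2 * (LINT x:tcube q|lebesgue. \<bar>f x\<bar>)" if q: "q \<in> M" for q
  proof -
    have "(LINT x:tcube q|lebesgue. \<bar>f x - g x\<bar>) = (LINT x:tcube q|lebesgue. \<bar>f x - av q\<bar>)"
      using gq[OF q] by (intro set_lebesgue_integral_cong) auto
    also have "\<dots> \<le> (LINT x:tcube q|lebesgue. \<bar>f x\<bar> + \<bar>av q\<bar>)"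
      using si by (intro set_integral_mono set_integral_add(1) set_integrable_abs set_integral_diff(1)) auto
    also have "\<dots> = (LINT x:tcube q|lebesgue. \<bar>f x\<bar>) + \<bar>av q\<bar> * tside q ^ CARD('n)"
      using si by (subst set_integral_add) (auto simp: kint)
    finally show ?thesis using avb[of q] by linarith
  qed
  show thesis using that[OF gL g3 gsupp gW z d] by blast
qed

section \<open>The localized weak-type estimate\<close>

text \<open>From here on the kernel is gone: \<open>testing\<close> is the hypothesis on the
  transpose, \<open>atom\<close> stands for the condition on the transposed kernel, and
  \<open>oscillation\<close> for the condition H_r, with \<open>p\<close> the exponent conjugate to
  r.\<close>

locale cz_operator = transposed_operator T Tt
  for T Tt :: "(real ^ 'n \<Rightarrow> real) \<Rightarrow> real ^ 'n \<Rightarrow> real" +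
  fixes B A1 A2 p :: real
  assumes constants: "B > 0" "A1 > 0" "A2 > 0" and p1: "p \<ge> 1"
    and testing: "\<And>c l E. l > 0 \<Longrightarrow> E \<in> sets lebesgue \<Longrightarrow> E \<subseteq> cube c l \<Longrightarrow>
      (\<integral>\<^sup>+x\<in>cube c l. ennreal \<bar>Tt (indicator E) x\<bar> \<partial>lebesgue) \<le> ennreal (B * l ^ CARD('n))"
    and atom: "\<And>b c l. l > 0 \<Longrightarrow> b \<in> Linfc \<Longrightarrow> (\<And>y. b y \<noteq> 0 \<Longrightarrow> y \<in> cube c l) \<Longrightarrow> (LINT y|lebesgue. b y) = 0 \<Longrightarrow>
      (\<integral>\<^sup>+x\<in>- cube c (2 * l). ennreal \<bar>T b x\<bar> \<partial>lebesgue) \<le> ennreal (A1 * (LINT y|lebesgue. \<bar>b y\<bar>))"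
    and oscillation: "\<And>F c l a x x'. l > 0 \<Longrightarrow> F \<in> Linfc \<Longrightarrow> (\<And>y. F y \<noteq> 0 \<Longrightarrow> y \<notin> cube c (3 * l)) \<Longrightarrow> a \<ge> 0 \<Longrightarrow>
      (\<And>k::nat. (LINT y:cube c (2 ^ Suc k * (2 * l))|lebesgue. \<bar>F y\<bar> powr p) \<le> a powr p * (2 ^ Suc k * (2 * l)) ^ CARD('n)) \<Longrightarrow>
      x \<in> cube c l \<Longrightarrow> x' \<in> cube c l \<Longrightarrow> \<bar>T F x - T F x'\<bar> \<le> A2 * a"
begin

text \<open>By duality with \<open>\<phi> = sgn (T b)\<close> on \<open>D\<close> only the integrable function \<open>b \<cdot> T\<^sup>* \<phi>\<close> is split over
  the cubes; no convergence of a series of functions \<open>T b\<^sub>q\<close> is needed.\<close>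

lemma bad_part:
  assumes b: "b \<in> Linfc" and M: "disjoint_family_on tcube M"
    and off: "\<And>x. x \<notin> (\<Union>q\<in>M. tcube q) \<Longrightarrow> b x = 0"
    and mean: "\<And>q. q \<in> M \<Longrightarrow> (LINT x:tcube q|lebesgue. b x) = 0"
    and u: "integrable lebesgue u" "\<And>x. u x \<ge> 0"
      "\<And>q. q \<in> M \<Longrightarrow> (LINT x:tcube q|lebesgue. \<bar>b x\<bar>) \<le> (LINT x:tcube q|lebesgue. u x)"
    and D: "D \<in> sets lebesgue" "D \<subseteq> cube c l"
      "\<And>q. q \<in> M \<Longrightarrow> D \<inter> cube (tcenter q) (2 * tside q) = {}"
  shows "(\<integral>\<^sup>+x\<in>D. ennreal \<bar>T b x\<bar> \<partial>lebesgue) \<le> ennreal (A1 * (LINT x|lebesgue. u x))"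
proof -
  define \<phi> where "\<phi> = (\<lambda>x. sgn (T b x) * indicator D x)"
  note dual = T_dual[OF b D(1,2), folded \<phi>_def]
  obtain A :: "nat \<Rightarrow> (real ^ 'n) set" where A: "disjoint_family A" "(\<Union>j. A j) = (\<Union>q\<in>M. tcube q)"
    "\<And>j. A j = {} \<or> (\<exists>q\<in>M. A j = tcube q)"
    using countable_disjoint_enumeration[OF M] by blast
  have Am: "A j \<in> sets lebesgue" for j using A(3)[of j] by auto
  have single: "ennreal \<bar>LINT x:A j|lebesgue. b x * Tt \<phi> x\<bar> \<le> ennreal A1 * ennreal (LINT x:A j|lebesgue. u x)" for j
  proof (cases "A j = {}")
    case True
    then show ?thesis by (simp add: set_lebesgue_integral_def)
  next
    case False
    then obtain q where q: "q \<in> M" "A j = tcube q" using A(3) by blast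
    define bq where "bq = (\<lambda>x. b x * indicator (tcube q) x)"
    have bq: "bq \<in> Linfc" unfolding bq_def by (rule Linfc_mult_indicator[OF b]) simp
    have bq_supp: "bq y \<noteq> 0 \<Longrightarrow> y \<in> cube (tcenter q) (tside q)" for y
      using tcube_subset_cube[of q] by (auto simp: bq_def indicator_def split: if_splits)
    have bq_mean: "(LINT y|lebesgue. bq y) = 0"
      using mean[OF q(1)] by (simp add: set_lebesgue_integral_def bq_def mult.commute)
    have bq_abs: "(LINT y|lebesgue. \<bar>bq y\<bar>) = (LINT x:tcube q|lebesgue. \<bar>b x\<bar>)"
      unfolding set_lebesgue_integral_def bq_def
      by (intro Bochner_Integration.integral_cong refl) (auto simp: indicator_def)
    \<comment> \<open>Pairing a second time, now with the single piece \<open>bq\<close>, moves the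
      operator back onto it. The test function lives on \<open>D\<close>, which avoids the doubled
      cube, so the estimate for atoms applies.\<close>
    have "(LINT x:A j|lebesgue. b x * Tt \<phi> x) = (LINT x|lebesgue. bq x * Tt \<phi> x)"
      unfolding set_lebesgue_integral_def bq_def q(2) by (simp add: mult_ac)
    also have "\<dots> = (LINT x|lebesgue. T bq x * \<phi> x)" using pairing(3)[OF bq dual(1)] by simp
    finally have "ennreal \<bar>LINT x:A j|lebesgue. b x * Tt \<phi> x\<bar> \<le> (\<integral>\<^sup>+x. ennreal \<bar>T bq x * \<phi> x\<bar> \<partial>lebesgue)"
      using integral_norm_bound_ennreal[OF pairing(1)[OF bq dual(1)]] by simp
    also have "\<dots> \<le> (\<integral>\<^sup>+x\<in>- cube (tcenter q) (2 * tside q). ennreal \<bar>T bq x\<bar> \<partial>lebesgue)"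
    proof (rule nn_integral_mono)
      fix x
      show "ennreal \<bar>T bq x * \<phi> x\<bar> \<le> ennreal \<bar>T bq x\<bar> * indicator (- cube (tcenter q) (2 * tside q)) x"
      proof (cases "x \<in> D")
        case True
        then have "x \<notin> cube (tcenter q) (2 * tside q)" using D(3)[OF q(1)] by blast
        moreover have "\<bar>T bq x * \<phi> x\<bar> \<le> \<bar>T bq x\<bar>"
          using mult_left_mono[of "\<bar>\<phi> x\<bar>" 1 "\<bar>T bq x\<bar>"] by (simp add: abs_mult \<phi>_def indicator_def sgn_if)
        ultimately show ?thesis by (simp add: ennreal_leI)
      qed (simp add: \<phi>_def)
    qed
    also have "\<dots> \<le> ennreal (A1 * (LINT y|lebesgue. \<bar>bq y\<bar>))"
      by (rule atom[OF _ bq bq_supp bq_mean]) simp_all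
    also have "\<dots> \<le> ennreal (A1 * (LINT x:tcube q|lebesgue. u x))"
      using u(3)[OF q(1)] constants by (intro ennreal_leI mult_left_mono) (auto simp: bq_abs)
    also have "\<dots> = ennreal A1 * ennreal (LINT x:tcube q|lebesgue. u x)"
      using constants u(2) by (intro ennreal_mult) (auto simp: set_lebesgue_integral_def)
    finally show ?thesis unfolding q(2) .
  qed
  have "(\<integral>\<^sup>+x\<in>D. ennreal \<bar>T b x\<bar> \<partial>lebesgue) = ennreal (LINT x|lebesgue. b x * Tt \<phi> x)" by (rule dual(3))
  also have "\<dots> \<le> ennreal \<bar>LINT x|lebesgue. b x * Tt \<phi> x\<bar>" by (intro ennreal_leI) simp
  also have "\<dots> \<le> (\<Sum>j. ennreal A1 * ennreal (LINT x:A j|lebesgue. u x))"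
    by (rule abs_integral_disjoint_union_le[OF pairing(2)[OF b dual(1)] A(1) Am _ single])
       (use off in \<open>simp add: A(2)\<close>)
  also have "\<dots> = ennreal A1 * (\<Sum>j. ennreal (LINT x:A j|lebesgue. u x))" by (rule ennreal_suminf_cmult)
  also have "(\<Sum>j. ennreal (LINT x:A j|lebesgue. u x)) = (\<integral>\<^sup>+j. ennreal (LINT x:A j|lebesgue. u x) \<partial>count_space UNIV)"
    by (rule nn_integral_count_space_nat[symmetric])
  also have "ennreal A1 * \<dots> \<le> ennreal A1 * ennreal (LINT x|lebesgue. u x)"
    using A(1) Am by (intro mult_left_mono sum_set_integral_le u(1,2)) auto
  also have "\<dots> = ennreal (A1 * (LINT x|lebesgue. u x))" using constants u(2) by (simp add: ennreal_mult)
  finally show ?thesis .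
qed

text \<open>Three exceptional sets share the budget: \<open>U1\<close>, where T of the good part is
  large; \<open>U2\<close>, the doubled selected cubes; and \<open>U3\<close>, where T of the bad
  part is large off \<open>U2\<close>. Each takes at most a third of \<epsilon> times the
  volume.\<close>

lemma weak_type_local:
  assumes \<epsilon>: "\<epsilon> > 0"
  obtains A where "A > 0" "\<And>c l f a. l > 0 \<Longrightarrow> f \<in> Linfc \<Longrightarrow> (\<And>y. f y \<noteq> 0 \<Longrightarrow> y \<in> cube c l) \<Longrightarrow> a > 0 \<Longrightarrow>
    (LINT x|lebesgue. \<bar>f x\<bar>) \<le> a * l ^ CARD('n) \<Longrightarrow>
    \<exists>U\<in>lmeasurable. measure lebesgue U \<le> \<epsilon> * l ^ CARD('n) \<and> (\<forall>x\<in>cube c l - U. \<bar>T f x\<bar> \<le> A * a)"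
proof -
  \<comment> \<open>The height is N * a: \<open>N\<close> large makes the doubled cubes small, and N
    \<ge> 1 keeps the selected cubes inside the triple. \<open>R\<close> is the testing bound on the
    tripled cube in units of a times the volume of the original cube, and \<open>A\<close> is what
    Chebyshev's inequality then requires for both parts.\<close>
  define N where "N = 1 + 3 * 2 ^ CARD('n) / \<epsilon>"
  define R where "R = 2 * B * (3 ^ CARD('n) * N) * 3 ^ CARD('n)"
  define A where "A = 3 * (R + 2 * A1) / \<epsilon>"
  have N: "N \<ge> 1" "2 ^ CARD('n) / N \<le> \<epsilon> / 3"
  proof -
    show "N \<ge> 1" using \<epsilon> by (simp add: N_def)
    have "3 * 2 ^ CARD('n) / \<epsilon> \<le> N" by (simp add: N_def)
    then have "3 * 2 ^ CARD('n) \<le> N * \<epsilon>" using \<epsilon> by (simp add: pos_divide_le_eq)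
    then show "2 ^ CARD('n) / N \<le> \<epsilon> / 3" using \<open>N \<ge> 1\<close> by (simp add: field_simps)
  qed
  have R: "R > 0" using constants N by (simp add: R_def)
  have A: "A > 0" using R constants \<epsilon> by (simp add: A_def)
  have RA: "R / A \<le> \<epsilon> / 3" "2 * A1 / A \<le> \<epsilon> / 3"
  proof -
    have "A * \<epsilon> = 3 * (R + 2 * A1)" using \<epsilon> by (simp add: A_def)
    then have "3 * R \<le> A * \<epsilon>" "3 * (2 * A1) \<le> A * \<epsilon>" using R constants by auto
    then show "R / A \<le> \<epsilon> / 3" "2 * A1 / A \<le> \<epsilon> / 3" using A by (simp_all add: field_simps)
  qed
  show thesis
  proof (rule that[of "2 * A"])
    show "2 * A > 0" using A by simp
    fix c :: "real ^ 'n" and l f and a :: real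
    assume l: "l > 0" and f: "f \<in> Linfc" "\<And>y. f y \<noteq> 0 \<Longrightarrow> y \<in> cube c l" and a: "a > 0"
      and le: "(LINT x|lebesgue. \<bar>f x\<bar>) \<le> a * l ^ CARD('n)"
    let ?L = "l ^ CARD('n)"
    let ?h = "\<lambda>x. \<bar>f x\<bar>"
    define lam where "lam = N * a"
    have lam: "lam > 0" using N a by (simp add: lam_def)
    have L: "?L > 0" using l by simp
    have "a * ?L \<le> lam * ?L" using N a L by (intro mult_right_mono) (auto simp: lam_def)
    then have le': "(LINT x|lebesgue. ?h x) \<le> lam * ?L" using le by linarith
    have h: "integrable lebesgue ?h" using f(1) Linfc_abs Linfc_integrable by blast
    define M where "M = cz_cubes ?h lam"
    obtain g where g: "g \<in> Linfc" "AE x in lebesgue. \<bar>g x\<bar> \<le> 3 ^ CARD('n) * lam"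
      "\<And>y. g y \<noteq> 0 \<Longrightarrow> y \<in> cube c (3 * l)" "\<And>x. x \<notin> (\<Union>q\<in>M. tcube q) \<Longrightarrow> g x = f x"
      "\<And>q. q \<in> M \<Longrightarrow> (LINT x:tcube q|lebesgue. f x - g x) = 0"
      "\<And>q. q \<in> M \<Longrightarrow> (LINT x:tcube q|lebesgue. \<bar>f x - g x\<bar>) \<le> 2 * (LINT x:tcube q|lebesgue. \<bar>f x\<bar>)"
      using cz_decomposition[OF f lam l le'] unfolding M_def by blast
    define b where "b = (\<lambda>x. f x - g x)"
    have b: "b \<in> Linfc" using Linfc_add[OF f(1) g(1), of 1 "-1"] by (simp add: b_def)
    have dis: "disjoint_family_on tcube M" unfolding M_def by (rule cz_disjoint[OF h _ lam]) simp
    have "AE x in lebesgue. T (\<lambda>y. g y + b y) x = T g x + T b x" by (rule T_add[OF g(1) b])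
    then have "AE x in lebesgue. T f x = T g x + T b x" by (simp add: b_def)
    \<comment> \<open>The null set where additivity fails joins the exceptional set, so the
      conclusion holds at every remaining point.\<close>
    then obtain Z where Z: "Z \<in> null_sets lebesgue" "{x \<in> space lebesgue. \<not> T f x = T g x + T b x} \<subseteq> Z"
      unfolding eventually_ae_filter by blast
    define U2 where "U2 = (\<Union>q\<in>M. cube (tcenter q) (2 * tside q))"
    have U2m: "U2 \<in> sets lebesgue" unfolding U2_def by (intro sets.countable_UN') auto
    have "emeasure lebesgue U2 \<le> (\<integral>\<^sup>+q. emeasure lebesgue (cube (tcenter q) (2 * tside q)) \<partial>count_space M)"
      unfolding U2_def by (intro emeasure_UN_le) auto
    also have "\<dots> = (\<integral>\<^sup>+q. ennreal (2 ^ CARD('n)) * emeasure lebesgue (tcube q) \<partial>count_space M)"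
      by (intro nn_integral_cong) (simp add: power_mult_distrib ennreal_mult)
    also have "\<dots> = ennreal (2 ^ CARD('n)) * (\<integral>\<^sup>+q. emeasure lebesgue (tcube q) \<partial>count_space M)"
      by (rule nn_integral_cmult) auto
    also have "\<dots> = ennreal (2 ^ CARD('n) / lam) * (ennreal lam * (\<integral>\<^sup>+q. emeasure lebesgue (tcube q) \<partial>count_space M))"
      using lam by (simp add: mult.assoc[symmetric] ennreal_mult[symmetric])
    also have "\<dots> \<le> ennreal (2 ^ CARD('n) / lam) * ennreal (LINT x|lebesgue. ?h x)"
      unfolding M_def by (intro mult_left_mono cz_measure[OF h _ lam]) auto
    also have "\<dots> = ennreal (2 ^ CARD('n) / lam * (LINT x|lebesgue. ?h x))"
      using lam by (simp add: ennreal_mult[symmetric])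
    also have "\<dots> \<le> ennreal (\<epsilon> / 3 * ?L)"
    proof (rule ennreal_leI)
      have "2 ^ CARD('n) / lam * (LINT x|lebesgue. ?h x) \<le> 2 ^ CARD('n) / lam * (a * ?L)"
        using le lam by (intro mult_left_mono) auto
      also have "\<dots> = 2 ^ CARD('n) / N * ?L" using a by (simp add: lam_def)
      also have "\<dots> \<le> \<epsilon> / 3 * ?L" using N(2) L by (intro mult_right_mono) auto
      finally show "2 ^ CARD('n) / lam * (LINT x|lebesgue. ?h x) \<le> \<epsilon> / 3 * ?L" .
    qed
    finally have U2e: "emeasure lebesgue U2 \<le> ennreal (\<epsilon> / 3 * ?L)" .
    then have U2l: "U2 \<in> lmeasurable" using U2m by (intro fmeasurableI) (auto simp: le_less_trans)
    have U2: "measure lebesgue U2 \<le> \<epsilon> / 3 * ?L"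
      using U2e \<epsilon> L by (simp add: emeasure_eq_measure2[OF U2l] ennreal_le_iff)
    define D where "D = cube c l - U2"
    have D: "D \<in> sets lebesgue" "D \<subseteq> cube c l" using U2m by (auto simp: D_def)
    have "(\<integral>\<^sup>+x\<in>D. ennreal \<bar>T b x\<bar> \<partial>lebesgue) \<le> ennreal (A1 * (LINT x|lebesgue. 2 * ?h x))"
    proof (rule bad_part[OF b dis _ _ _ _ _ D])
      show "x \<notin> (\<Union>q\<in>M. tcube q) \<Longrightarrow> b x = 0" for x using g(4) by (simp add: b_def)
      show "q \<in> M \<Longrightarrow> (LINT x:tcube q|lebesgue. b x) = 0" for q using g(5) by (simp add: b_def)
      show "q \<in> M \<Longrightarrow> (LINT x:tcube q|lebesgue. \<bar>b x\<bar>) \<le> (LINT x:tcube q|lebesgue. 2 * ?h x)" for q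
        using g(6)[of q] by (simp add: b_def)
      show "q \<in> M \<Longrightarrow> D \<inter> cube (tcenter q) (2 * tside q) = {}" for q by (auto simp: D_def U2_def)
    qed (use h in auto)
    also have "\<dots> \<le> ennreal (2 * A1 * (a * ?L))"
      using le constants by (intro ennreal_leI) (simp add: mult_left_mono)
    finally have Tb: "(\<integral>\<^sup>+x\<in>D. ennreal \<bar>T b x\<bar> \<partial>lebesgue) \<le> ennreal (2 * A1 * (a * ?L))" .
    define U3 where "U3 = {x \<in> D. \<bar>T b x\<bar> > A * a}"
    have Aa: "A * a > 0" using A a by simp
    have nn3: "0 \<le> 2 * A1 * (a * ?L)" using constants a L by simp
    have U3l: "U3 \<in> lmeasurable"
      unfolding U3_def by (rule markov_lmeasurable(1)[OF T_measurable[OF b] D(1) Tb nn3 Aa])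
    have "measure lebesgue U3 \<le> 2 * A1 * (a * ?L) / (A * a)"
      unfolding U3_def by (rule markov_lmeasurable(2)[OF T_measurable[OF b] D(1) Tb nn3 Aa])
    also have "\<dots> = 2 * A1 / A * ?L" using a by simp
    also have "\<dots> \<le> \<epsilon> / 3 * ?L" using RA(2) L by (intro mult_right_mono) auto
    finally have U3: "measure lebesgue U3 \<le> \<epsilon> / 3 * ?L" .
    have "(\<integral>\<^sup>+x\<in>cube c (3 * l). ennreal \<bar>T g x\<bar> \<partial>lebesgue) \<le> ennreal (2 * B * (3 ^ CARD('n) * lam) * (3 * l) ^ CARD('n))"
      by (rule T_testing[OF testing g(1,2,3)]) (use l lam constants in auto)
    then have Tg: "(\<integral>\<^sup>+x\<in>cube c (3 * l). ennreal \<bar>T g x\<bar> \<partial>lebesgue) \<le> ennreal (R * (a * ?L))"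
      by (simp add: R_def lam_def power_mult_distrib mult_ac)
    define U1 where "U1 = {x \<in> cube c (3 * l). \<bar>T g x\<bar> > A * a}"
    have nn1: "0 \<le> R * (a * ?L)" using R a L by simp
    have U1l: "U1 \<in> lmeasurable"
      unfolding U1_def by (rule markov_lmeasurable(1)[OF T_measurable[OF g(1)] cube_meas Tg nn1 Aa])
    have "measure lebesgue U1 \<le> R * (a * ?L) / (A * a)"
      unfolding U1_def by (rule markov_lmeasurable(2)[OF T_measurable[OF g(1)] cube_meas Tg nn1 Aa])
    also have "\<dots> = R / A * ?L" using a by simp
    also have "\<dots> \<le> \<epsilon> / 3 * ?L" using RA(1) L by (intro mult_right_mono) auto
    finally have U1: "measure lebesgue U1 \<le> \<epsilon> / 3 * ?L" .
    have Zl: "Z \<in> lmeasurable" "measure lebesgue Z = 0"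
      using Z(1) by (auto simp: fmeasurable_def null_sets_def measure_def)
    let ?U = "(U1 \<union> U2) \<union> (U3 \<union> Z)"
    have Ul: "?U \<in> lmeasurable" using U1l U2l U3l Zl by (intro fmeasurable.Un)
    have "measure lebesgue ?U \<le> measure lebesgue (U1 \<union> U2) + measure lebesgue (U3 \<union> Z)"
      using U1l U2l U3l Zl by (intro measure_Un_le) (auto intro: fmeasurableD)
    also have "\<dots> \<le> (measure lebesgue U1 + measure lebesgue U2) + (measure lebesgue U3 + measure lebesgue Z)"
      using U1l U2l U3l Zl by (intro add_mono measure_Un_le) (auto intro: fmeasurableD)
    also have "\<dots> \<le> \<epsilon> * ?L" using U1 U2 U3 Zl(2) by simp
    finally have "measure lebesgue ?U \<le> \<epsilon> * ?L" .
    moreover have "\<bar>T f x\<bar> \<le> 2 * A * a" if x: "x \<in> cube c l - ?U" for x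
    proof -
      have "T f x = T g x + T b x" using x Z(2) by auto
      moreover have "x \<in> D" using x by (simp add: D_def)
      then have "\<bar>T b x\<bar> \<le> A * a" using x by (auto simp: U3_def)
      moreover have "x \<in> cube c (3 * l)" using x cube_mono[of l "3 * l" c] l by auto
      then have "\<bar>T g x\<bar> \<le> A * a" using x by (auto simp: U1_def)
      ultimately show ?thesis by linarith
    qed
    ultimately show "\<exists>U\<in>lmeasurable. measure lebesgue U \<le> \<epsilon> * ?L \<and> (\<forall>x\<in>cube c l - U. \<bar>T f x\<bar> \<le> 2 * A * a)"
      using Ul by blast
  qed
qed

end

section \<open>Averages over tripled cubes and the exceptional set of a cube\<close>

context cz_operator
begin

definition avg3 :: "(real ^ 'n \<Rightarrow> real) \<Rightarrow> real ^ 'n \<Rightarrow> real \<Rightarrow> real" where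
  "avg3 f c l = cube_avg p (cube c (3 * l)) f"

definition trunc3 :: "(real ^ 'n \<Rightarrow> real) \<Rightarrow> real ^ 'n \<Rightarrow> real \<Rightarrow> real ^ 'n \<Rightarrow> real" where
  "trunc3 f c l = (\<lambda>x. f x * indicator (cube c (3 * l)) x)"

lemma trunc3_Linfc: "f \<in> Linfc \<Longrightarrow> trunc3 f c l \<in> Linfc"
  unfolding trunc3_def by (rule Linfc_mult_indicator) simp_all

lemma avg3_nonneg: "avg3 f c l \<ge> 0"
  by (simp add: avg3_def cube_avg_def)

lemma trunc3_powr_integral:
  assumes "f \<in> Linfc" "l > 0"
  shows "(LINT x|lebesgue. \<bar>trunc3 f c l x\<bar> powr p) = avg3 f c l powr p * (3 * l) ^ CARD('n)"
proof -
  let ?I = "LINT x:cube c (3 * l)|lebesgue. \<bar>f x\<bar> powr p"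
  have "?I \<ge> 0" by (simp add: set_lebesgue_integral_def)
  then have "avg3 f c l powr p = 1 / (3 * l) ^ CARD('n) * ?I"
    using p1 assms(2) by (simp add: avg3_def cube_avg_def powr_powr)
  moreover have "(LINT x|lebesgue. \<bar>trunc3 f c l x\<bar> powr p) = ?I"
    unfolding set_lebesgue_integral_def trunc3_def using p1
    by (intro Bochner_Integration.integral_cong refl) (auto simp: indicator_def)
  ultimately show ?thesis using assms(2) by simp
qed

text \<open>An elementary substitute for Jensen's inequality, at the cost of a factor 2: values up
  to the average a are bounded by a, and larger ones by a^(1-p) times their p-th power.\<close>

lemma trunc3_integral_le:
  assumes "f \<in> Linfc" "l > 0" and a: "avg3 f c l > 0"
  shows "(LINT x|lebesgue. \<bar>trunc3 f c l x\<bar>) \<le> 2 * avg3 f c l * (3 * l) ^ CARD('n)"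
proof -
  let ?a = "avg3 f c l" and ?F = "trunc3 f c l" and ?Q = "cube c (3 * l)"
  have pt: "\<bar>?F x\<bar> \<le> ?a * indicator ?Q x + ?a powr (1 - p) * \<bar>?F x\<bar> powr p" for x
  proof (cases "x \<in> ?Q")
    case True
    show ?thesis
    proof (cases "\<bar>?F x\<bar> \<le> ?a")
      case le: True
      show ?thesis using True le by (simp add: add_increasing2)
    next
      case False
      then have F: "\<bar>?F x\<bar> > 0" using a by linarith
      have "\<bar>?F x\<bar> powr (1 - p) \<le> ?a powr (1 - p)"
        using powr_mono2'[of "1 - p" ?a "\<bar>?F x\<bar>"] p1 a False by simp
      then have "\<bar>?F x\<bar> powr (1 - p) * \<bar>?F x\<bar> powr p \<le> ?a powr (1 - p) * \<bar>?F x\<bar> powr p"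
        by (intro mult_right_mono) auto
      moreover have "\<bar>?F x\<bar> powr (1 - p) * \<bar>?F x\<bar> powr p = \<bar>?F x\<bar>"
        using F by (simp add: powr_add[symmetric])
      ultimately show ?thesis using a True by simp
    qed
  next
    case False
    then have "?F x = 0" by (simp add: trunc3_def)
    then show ?thesis using a p1 by (simp add: indicator_def)
  qed
  have i1: "integrable lebesgue (\<lambda>x. ?a * indicator ?Q x)"
    using fmeasurableD2[OF cube_lmeasurable[of c "3 * l"]] by (auto simp: less_top)
  have i2: "integrable lebesgue (\<lambda>x. ?a powr (1 - p) * \<bar>?F x\<bar> powr p)"
    using Linfc_powr_integrable[OF trunc3_Linfc[OF assms(1)], of p c l] p1 by simp
  have "(LINT x|lebesgue. \<bar>?F x\<bar>) \<le> (LINT x|lebesgue. ?a * indicator ?Q x + ?a powr (1 - p) * \<bar>?F x\<bar> powr p)"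
    using Linfc_integrable[OF Linfc_abs[OF trunc3_Linfc[OF assms(1)]]] i1 i2 pt
    by (intro integral_mono) auto
  also have "\<dots> = (LINT x|lebesgue. ?a * indicator ?Q x) + (LINT x|lebesgue. ?a powr (1 - p) * \<bar>?F x\<bar> powr p)"
    by (rule Bochner_Integration.integral_add[OF i1 i2])
  also have "(LINT x|lebesgue. ?a * indicator ?Q x) = ?a * (3 * l) ^ CARD('n)"
    using assms(2) by simp
  also have "(LINT x|lebesgue. ?a powr (1 - p) * \<bar>?F x\<bar> powr p) = ?a powr (1 - p) * (?a powr p * (3 * l) ^ CARD('n))"
    using trunc3_powr_integral[OF assms(1,2)] by simp
  also have "\<dots> = ?a * (3 * l) ^ CARD('n)" using a by (simp add: powr_add[symmetric] mult.assoc[symmetric])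
  finally show ?thesis by (simp add: mult_ac)
qed

text \<open>The second clause bounds the uncentred L^p maximal function of the truncation at
  \<open>x\<close>. All cubes through \<open>x\<close> are needed, as it will be applied to dilates
  of a child cube and not of the given one.\<close>

definition controlled :: "real \<Rightarrow> (real ^ 'n \<Rightarrow> real) \<Rightarrow> real ^ 'n \<Rightarrow> real \<Rightarrow> real ^ 'n \<Rightarrow> bool" where
  "controlled A f c l x \<longleftrightarrow> \<bar>T (trunc3 f c l) x\<bar> \<le> A * avg3 f c l \<and>
    (\<forall>c' l'. l' > 0 \<longrightarrow> x \<in> cube c' l' \<longrightarrow>
      (LINT y:cube c' l'|lebesgue. \<bar>trunc3 f c l y\<bar> powr p) \<le> (A * avg3 f c l) powr p * l' ^ CARD('n))"

text \<open>Combines the local weak-type bound on the tripled cube with the maximal function of the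
  p-th power of the truncation.\<close>

lemma exceptional_set:
  assumes \<epsilon>: "\<epsilon> > 0"
  obtains A where "A > 0" "\<And>c l f. l > 0 \<Longrightarrow> f \<in> Linfc \<Longrightarrow>
    \<exists>U\<in>lmeasurable. measure lebesgue U \<le> \<epsilon> * l ^ CARD('n) \<and> (\<forall>x\<in>cube c l - U. controlled A f c l x)"
proof -
  \<comment> \<open>The weak-type bound is relative to the tripled cube, whose volume is 3^n times
    larger; the 2 leaves half of the budget for the maximal function.\<close>
  define \<epsilon>' where "\<epsilon>' = \<epsilon> / (2 * 3 ^ CARD('n))"
  have "\<epsilon>' > 0" using \<epsilon> by (simp add: \<epsilon>'_def)
  obtain Aw where Aw: "Aw > 0" "\<And>c l f a. l > 0 \<Longrightarrow> f \<in> Linfc \<Longrightarrow> (\<And>y. f y \<noteq> 0 \<Longrightarrow> y \<in> cube c l) \<Longrightarrow> a > 0 \<Longrightarrow>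
    (LINT x|lebesgue. \<bar>f x\<bar>) \<le> a * l ^ CARD('n) \<Longrightarrow>
    \<exists>U\<in>lmeasurable. measure lebesgue U \<le> \<epsilon>' * l ^ CARD('n) \<and> (\<forall>x\<in>cube c l - U. \<bar>T f x\<bar> \<le> Aw * a)"
    using weak_type_local[OF \<open>\<epsilon>' > 0\<close>] by blast
  obtain C :: real where C: "C > 0"
    "\<And>(h :: real ^ 'n \<Rightarrow> real) lam. integrable lebesgue h \<Longrightarrow> (\<And>x. h x \<ge> 0) \<Longrightarrow> lam > 0 \<Longrightarrow>
      \<exists>U\<in>lmeasurable. measure lebesgue U \<le> C * (LINT x|lebesgue. h x) / lam \<and>
        (\<forall>x c l. x \<notin> U \<longrightarrow> l > 0 \<longrightarrow> x \<in> cube c l \<longrightarrow> (LINT y:cube c l|lebesgue. h y) \<le> lam * l ^ CARD('n))"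
    using maximal_function by blast
  \<comment> \<open>At height (Am * a)^p the maximal bound is C * 3^n / Am^p times the volume, and
    Am^p \<ge> Am makes this at most half of \<epsilon> times the volume.\<close>
  define Am where "Am = 1 + 2 * C * 3 ^ CARD('n) / \<epsilon>"
  have Am: "Am \<ge> 1" using C \<epsilon> by (simp add: Am_def)
  define A where "A = 2 * Aw + Am"
  have A: "A > 0" "2 * Aw \<le> A" "Am \<le> A" using Aw Am by (auto simp: A_def)
  show thesis
  proof (rule that[OF A(1)])
    fix c :: "real ^ 'n" and l :: real and f :: "real ^ 'n \<Rightarrow> real" assume l: "l > 0" and f: "f \<in> Linfc"
    let ?a = "avg3 f c l" and ?F = "trunc3 f c l" and ?L = "l ^ CARD('n)"
    have L: "?L > 0" using l by simp
    have F: "?F \<in> Linfc" using f by (rule trunc3_Linfc)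
    have Fp: "integrable lebesgue (\<lambda>x. \<bar>?F x\<bar> powr p)" using Linfc_powr_integrable[OF F] p1 by simp
    have I: "(LINT x|lebesgue. \<bar>?F x\<bar> powr p) = ?a powr p * (3 * l) ^ CARD('n)"
      using trunc3_powr_integral[OF f l] .
    show "\<exists>U\<in>lmeasurable. measure lebesgue U \<le> \<epsilon> * ?L \<and> (\<forall>x\<in>cube c l - U. controlled A f c l x)"
    \<comment> \<open>A zero average offers no positive height; then the truncation vanishes almost
      everywhere and \<open>T_null\<close> takes over.\<close>
    proof (cases "?a = 0")
      case True
      then have "(LINT x|lebesgue. \<bar>?F x\<bar> powr p) = 0" using I by simp
      then have "AE x in lebesgue. \<bar>?F x\<bar> powr p = 0"
        using integral_nonneg_eq_0_iff_AE[OF Fp] by simp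
      then have "AE x in lebesgue. ?F x = 0" by eventually_elim simp
      from T_null[OF F this] obtain Z where Z: "Z \<in> null_sets lebesgue" "{x \<in> space lebesgue. \<not> T ?F x = 0} \<subseteq> Z"
        unfolding eventually_ae_filter by blast
      have Zl: "Z \<in> lmeasurable" "measure lebesgue Z = 0"
        using Z(1) by (auto simp: fmeasurable_def null_sets_def measure_def)
      have "(LINT y:cube c' l'|lebesgue. \<bar>?F y\<bar> powr p) \<le> 0" for c' l'
        using set_integral_le_integral[OF Fp, of "cube c' l'"] \<open>(LINT x|lebesgue. \<bar>?F x\<bar> powr p) = 0\<close> by simp
      then show ?thesis unfolding controlled_def using Zl Z(2) \<epsilon> L True by (intro bexI[OF _ Zl(1)]) auto
    next
      case False
      then have a: "?a > 0" using avg3_nonneg[of f c l] by simp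
      have "\<exists>U\<in>lmeasurable. measure lebesgue U \<le> \<epsilon>' * (3 * l) ^ CARD('n) \<and> (\<forall>x\<in>cube c (3 * l) - U. \<bar>T ?F x\<bar> \<le> Aw * (2 * ?a))"
        using l a trunc3_integral_le[OF f l a]
        by (intro Aw(2) F) (auto simp: trunc3_def indicator_def split: if_splits)
      then obtain U1 where U1: "U1 \<in> lmeasurable" "measure lebesgue U1 \<le> \<epsilon>' * (3 * l) ^ CARD('n)"
        "\<And>x. x \<in> cube c (3 * l) - U1 \<Longrightarrow> \<bar>T ?F x\<bar> \<le> Aw * (2 * ?a)" by blast
      have U1': "measure lebesgue U1 \<le> \<epsilon> / 2 * ?L" using U1(2) by (simp add: \<epsilon>'_def power_mult_distrib)
      let ?lam = "(Am * ?a) powr p"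
      have "?lam > 0" using Am a by simp
      from C(2)[OF Fp _ this] obtain U2 where U2: "U2 \<in> lmeasurable"
        "measure lebesgue U2 \<le> C * (LINT x|lebesgue. \<bar>?F x\<bar> powr p) / ?lam"
        "\<And>x c l. x \<notin> U2 \<Longrightarrow> l > 0 \<Longrightarrow> x \<in> cube c l \<Longrightarrow> (LINT y:cube c l|lebesgue. \<bar>?F y\<bar> powr p) \<le> ?lam * l ^ CARD('n)"
        by auto
      have "C * (LINT x|lebesgue. \<bar>?F x\<bar> powr p) / ?lam = C * 3 ^ CARD('n) / Am powr p * ?L"
        using a Am by (simp add: I powr_mult power_mult_distrib)
      also have "\<dots> \<le> \<epsilon> / 2 * ?L"
      proof (rule mult_right_mono)
        have "Am powr 1 \<le> Am powr p" using Am p1 by (intro powr_mono) auto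
        then have "Am \<le> Am powr p" using Am by simp
        have "2 * C * 3 ^ CARD('n) / \<epsilon> \<le> Am powr p" using \<open>Am \<le> Am powr p\<close> by (simp add: Am_def)
        then have "2 * C * 3 ^ CARD('n) \<le> Am powr p * \<epsilon>" using \<epsilon> by (simp add: pos_divide_le_eq)
        then show "C * 3 ^ CARD('n) / Am powr p \<le> \<epsilon> / 2" using Am by (simp add: field_simps)
      qed (use L in simp)
      finally have U2': "measure lebesgue U2 \<le> \<epsilon> / 2 * ?L" using U2(2) by linarith
      have "measure lebesgue (U1 \<union> U2) \<le> measure lebesgue U1 + measure lebesgue U2"
        using U1 U2 by (intro measure_Un_le) (auto intro: fmeasurableD)
      also have "\<dots> \<le> \<epsilon> * ?L" using U1' U2' by simp
      finally have m: "measure lebesgue (U1 \<union> U2) \<le> \<epsilon> * ?L" .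
      show ?thesis
        unfolding controlled_def
      proof (rule bexI[of _ "U1 \<union> U2"], intro conjI ballI allI impI)
        fix x assume x: "x \<in> cube c l - (U1 \<union> U2)"
        then have "x \<in> cube c (3 * l) - U1" using cube_mono[of l "3 * l" c] l by auto
        then have "\<bar>T ?F x\<bar> \<le> 2 * Aw * ?a" using U1(3)[of x] by (simp add: mult_ac)
        also have "\<dots> \<le> A * ?a" using A(2) a by (intro mult_right_mono) auto
        finally show "\<bar>T ?F x\<bar> \<le> A * ?a" .
        fix c' l' assume l': "0 < l'" "x \<in> cube c' l'"
        then have "(LINT y:cube c' l'|lebesgue. \<bar>?F y\<bar> powr p) \<le> ?lam * l' ^ CARD('n)" using U2(3) x by blast
        also have "\<dots> \<le> (A * ?a) powr p * l' ^ CARD('n)"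
          using A(3) Am a p1 l' by (intro mult_right_mono powr_mono2) auto
        finally show "(LINT y:cube c' l'|lebesgue. \<bar>?F y\<bar> powr p) \<le> (A * ?a) powr p * l' ^ CARD('n)" .
      qed (use m U1 U2 in auto)
    qed
  qed
qed

end

section \<open>Trees of triadic cubes\<close>

text \<open>Let O_k be the triadic cube of level k centred at 0, with the support inside O_m. The
  roots are the level m cubes in O_(m+1), and the level k cubes in O_(k+1) outside O_k for k > m. In
  units of its side, a root of level k has a centre with coordinates -1, 0 or 1, so its triple
  contains O_k and with it the support. The function \<kappa> records the shell of a point.\<close>

lemma root_cubes:
  fixes f :: "real ^ 'n \<Rightarrow> real"
  assumes "f \<in> Linfc"
  obtains R :: "'n tindex set" where "disjoint_family_on tcube R" "(\<Union>q\<in>R. tcube q) = UNIV"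
    "\<And>q y. q \<in> R \<Longrightarrow> f y \<noteq> 0 \<Longrightarrow> y \<in> cube (tcenter q) (3 * tside q)"
proof -
  obtain M l where l: "l > 0" "\<forall>x l'. f x \<noteq> 0 \<longrightarrow> l \<le> l' \<longrightarrow> x \<in> cube 0 l'"
    using LinfcE[OF assms] by metis
  obtain m where m: "l < 3 ^ m" using real_arch_pow[of 3 l] by auto
  let ?k = "\<lambda>j::nat. int m + int j"
  let ?O = "\<lambda>k. tcube (tindex k (0 :: real ^ 'n))"
  have c0: "tcenter (tindex k (0 :: real ^ 'n)) = 0" for k by (simp add: tcenter_def tindex_def vec_eq_iff)
  have Omem: "x \<in> ?O k \<longleftrightarrow> (\<forall>i. - (3 powi k) / 2 \<le> x $ i \<and> x $ i < 3 powi k / 2)" for x k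
    by (simp add: mem_tcube_iff c0 tside_tindex)
  have ex: "\<exists>j. x \<in> ?O (?k j + 1)" for x
  proof -
    obtain b where b: "b > 0" "{x} \<subseteq> cube 0 b" using bounded_subset_cube[of "{x}"] by auto
    obtain j where j: "b < 3 ^ j" using real_arch_pow[of 3 b] by auto
    have "(3::real) powi (int j) \<le> 3 powi (?k j + 1)" by (intro power_int_increasing) auto
    then have s: "b < 3 powi (?k j + 1)" using j by simp
    have "- (3 powi (?k j + 1)) / 2 \<le> x $ i \<and> x $ i < 3 powi (?k j + 1) / 2" for i
    proof -
      have "\<bar>x $ i\<bar> \<le> b / 2" using b by (simp add: mem_cube)
      then show ?thesis using s by argo
    qed
    then show ?thesis unfolding Omem by blast
  qed
  define \<kappa> where "\<kappa> = (\<lambda>x. LEAST j. x \<in> ?O (?k j + 1))"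
  have k1: "x \<in> ?O (?k (\<kappa> x) + 1)" for x unfolding \<kappa>_def using ex by (rule LeastI_ex)
  have k2: "x \<notin> ?O (?k j + 1)" if "j < \<kappa> x" for x j using not_less_Least that unfolding \<kappa>_def by blast
  define R where "R = range (\<lambda>x. tindex (?k (\<kappa> x)) x)"
  have Otrans: "y \<in> ?O k'" if "tindex k x = tindex k y" "k \<le> k'" "x \<in> ?O k'" for x y k k'
    using tindex_mono[OF that(1,2)] that(3) by (simp add: mem_tcube)
  \<comment> \<open>Membership in O_k' is decided by the index at any level up to k', so the shell
    is constant on a root. This gives disjointness.\<close>
  have same: "\<kappa> y = \<kappa> x" if y: "y \<in> tcube (tindex (?k (\<kappa> x)) x)" for x y
  proof -
    have eq: "tindex (?k (\<kappa> x)) y = tindex (?k (\<kappa> x)) x" using y by (simp add: mem_tcube)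
    have "y \<in> ?O (?k (\<kappa> x) + 1)" using Otrans[OF eq[symmetric] _ k1] by simp
    then have le: "\<kappa> y \<le> \<kappa> x" using k2[of "\<kappa> x" y] by (meson not_le)
    show ?thesis
    proof (rule ccontr)
      assume "\<kappa> y \<noteq> \<kappa> x"
      then have lt: "\<kappa> y < \<kappa> x" using le by simp
      then obtain j where j: "\<kappa> x = Suc j" by (cases "\<kappa> x") auto
      have "tcube (tindex (?k (\<kappa> y) + 1) (0 :: real ^ 'n)) \<subseteq> ?O (?k j + 1)"
        using lt j by (intro tcube_subset_tindex) auto
      then have "y \<in> ?O (?k j + 1)" using k1[of y] by blast
      moreover have "?k (\<kappa> x) \<le> ?k j + 1" using j by simp
      ultimately have "x \<in> ?O (?k j + 1)" using Otrans[OF eq] by blast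
      then show False using k2[of j x] j by simp
    qed
  qed
  have dis: "disjoint_family_on tcube R"
    unfolding disjoint_family_on_def
  proof (intro ballI impI)
    fix q q' assume q: "q \<in> R" "q' \<in> R" "q \<noteq> q'"
    then obtain x x' where x: "q = tindex (?k (\<kappa> x)) x" "q' = tindex (?k (\<kappa> x')) x'" by (auto simp: R_def)
    show "tcube q \<inter> tcube q' = {}"
    proof (rule ccontr)
      assume "tcube q \<inter> tcube q' \<noteq> {}"
      then obtain y where y: "y \<in> tcube q" "y \<in> tcube q'" by blast
      then have "\<kappa> y = \<kappa> x" "\<kappa> y = \<kappa> x'" using same x by blast+
      then show False using x y q(3) by (simp add: mem_tcube)
    qed
  qed
  have "x \<in> (\<Union>q\<in>R. tcube q)" for x using mem_tindex[of x "?k (\<kappa> x)"] unfolding R_def by blast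
  then have cov: "(\<Union>q\<in>R. tcube q) = UNIV" by blast
  have sup: "y \<in> cube (tcenter q) (3 * tside q)" if q: "q \<in> R" and y: "f y \<noteq> 0" for q y
  proof -
    obtain x where x: "q = tindex (?k (\<kappa> x)) x" using q by (auto simp: R_def)
    let ?s = "tside q"
    have s: "?s = 3 powi (?k (\<kappa> x))" by (simp add: x tside_tindex)
    have s3: "3 powi (?k (\<kappa> x) + 1) = 3 * ?s" by (simp add: s power_int_add)
    have xq: "x \<in> tcube q" unfolding x by simp
    have "cube 0 ?s \<subseteq> cube (tcenter q) (3 * ?s)"
    proof (rule cube_subset)
      fix i
      have 1: "- ?s / 2 \<le> x $ i - tcenter q $ i \<and> x $ i - tcenter q $ i < ?s / 2" using xq by (simp add: mem_tcube_iff)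
      have 2: "- (3 * ?s) / 2 \<le> x $ i \<and> x $ i < 3 * ?s / 2" using k1[of x] unfolding Omem s3 by blast
      have "tcenter q $ i < 2 * ?s" "tcenter q $ i > - 2 * ?s" using 1 2 by argo+
      then have "?s * of_int (snd q $ i) < ?s * 2" "?s * of_int (snd q $ i) > ?s * (- 2)" by (simp_all add: tcenter_def)
      then have "real_of_int (snd q $ i) < 2" "real_of_int (snd q $ i) > - 2"
        using tside_pos(1)[of q] by (auto simp only: mult_less_cancel_left_pos)
      then have "\<bar>snd q $ i\<bar> \<le> 1" by linarith
      then have "\<bar>real_of_int (snd q $ i)\<bar> \<le> 1" by linarith
      then have "?s * \<bar>real_of_int (snd q $ i)\<bar> \<le> ?s * 1" by (intro mult_left_mono) auto
      then show "\<bar>0 $ i - tcenter q $ i\<bar> \<le> (3 * ?s - ?s) / 2" by (simp add: tcenter_def abs_mult)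
    qed
    moreover have "y \<in> cube 0 ?s"
    proof -
      have "(3::real) powi int m \<le> 3 powi (?k (\<kappa> x))" by (intro power_int_increasing) auto
      then have "l \<le> ?s" using m s by simp
      then show ?thesis using l(2) y by blast
    qed
    ultimately show ?thesis by blast
  qed
  show thesis by (rule that[OF dis cov sup])
qed

text \<open>A sparse family is a set of cubes, not of indices, so the sets E and the sums over the
  family have to be carried back to the triadic index.\<close>

lemma inj_triple_cube: "inj (\<lambda>q :: 'n::finite tindex. cube (tcenter q) (3 * tside q))"
proof (rule injI)
  fix q q' :: "'n tindex" assume "cube (tcenter q) (3 * tside q) = cube (tcenter q') (3 * tside q')"
  then have "tcenter q = tcenter q' \<and> 3 * tside q = 3 * tside q'" by (rule cube_inj) auto
  then have eq: "tcenter q = tcenter q'" "tside q = tside q'" by auto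
  have "(3::real) powi fst q = 3 powi fst q'" using eq(2) by (simp add: tside_def)
  then have "fst q = fst q'"
    using power_int_strict_increasing[of "fst q" "fst q'" "3::real"] power_int_strict_increasing[of "fst q'" "fst q" "3::real"]
    by (cases "fst q" "fst q'" rule: linorder_cases) auto
  moreover have "tcenter q \<in> tcube q" "tcenter q \<in> tcube q'" using eq tcenter_mem by metis+
  ultimately show "q = q'" by (simp add: mem_tcube)
qed

text \<open>The combinatorial part in isolation. The conditions on \<open>ch\<close> are imposed at
  all indices, so the generations arise by plain iteration.\<close>

locale tcube_tree =
  fixes R :: "'n::finite tindex set" and ch :: "'n tindex \<Rightarrow> 'n tindex set"
  assumes root_disjoint: "disjoint_family_on tcube R" and root_cover: "(\<Union>q\<in>R. tcube q) = UNIV"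
    and child_subset: "\<And>q q'. q' \<in> ch q \<Longrightarrow> tcube q' \<subseteq> tcube q"
    and child_level: "\<And>q q'. q' \<in> ch q \<Longrightarrow> fst q' < fst q"
    and child_disjoint: "\<And>q. disjoint_family_on tcube (ch q)"
    and child_half: "\<And>q. emeasure lebesgue (\<Union>q'\<in>ch q. tcube q') \<le> ennreal (1 / 2) * emeasure lebesgue (tcube q)"
begin

primrec gen :: "nat \<Rightarrow> 'n tindex set" where
  "gen 0 = R"
| "gen (Suc k) = (\<Union>q\<in>gen k. ch q)"

definition tree :: "'n tindex set" where "tree = (\<Union>k. gen k)"

definition core :: "'n tindex \<Rightarrow> (real ^ 'n) set" where
  "core q = tcube q - (\<Union>q'\<in>ch q. tcube q')"

lemma gen_disjoint: "disjoint_family_on tcube (gen k)"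
proof (induction k)
  case 0 then show ?case using root_disjoint by simp
next
  case (Suc k)
  show ?case
    unfolding disjoint_family_on_def
  proof (intro ballI impI)
    fix a b assume ab: "a \<in> gen (Suc k)" "b \<in> gen (Suc k)" "a \<noteq> b"
    then obtain a' b' where a': "a' \<in> gen k" "a \<in> ch a'" "b' \<in> gen k" "b \<in> ch b'" by auto
    show "tcube a \<inter> tcube b = {}"
    proof (cases "a' = b'")
      case True
      then show ?thesis using child_disjoint[of a'] a' ab unfolding disjoint_family_on_def by blast
    next
      case False
      then have "tcube a' \<inter> tcube b' = {}" using Suc.IH a' unfolding disjoint_family_on_def by blast
      then show ?thesis using child_subset a' by blast
    qed
  qed
qed

lemma gen_mono: "(\<Union>q\<in>gen (k + j). tcube q) \<subseteq> (\<Union>q\<in>gen k. tcube q)"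
proof (induction j)
  case (Suc j)
  have "(\<Union>q\<in>gen (k + Suc j). tcube q) \<subseteq> (\<Union>q\<in>gen (k + j). tcube q)" using child_subset by fastforce
  then show ?case using Suc.IH by blast
qed simp

lemma core_meas [measurable]: "core q \<in> sets lebesgue"
proof -
  have "(\<Union>q'\<in>ch q. tcube q') \<in> sets lebesgue" by (intro sets.countable_UN') auto
  then show ?thesis unfolding core_def by auto
qed

lemma core_measure: "measure lebesgue (core q) \<ge> 1 / 2 * measure lebesgue (tcube q)"
proof -
  let ?C = "\<Union>q'\<in>ch q. tcube q'"
  have C: "?C \<in> sets lebesgue" by (intro sets.countable_UN') auto
  have sub: "?C \<subseteq> tcube q" using child_subset by blast
  have Cl: "?C \<in> lmeasurable" by (rule fmeasurableI2[OF tcube_lmeasurable sub C])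
  have "ennreal (measure lebesgue ?C) \<le> ennreal (1 / 2 * measure lebesgue (tcube q))"
    using child_half[of q] unfolding emeasure_eq_measure2[OF Cl] by (simp add: ennreal_mult[symmetric] del: ennreal_half)
  then have "measure lebesgue ?C \<le> 1 / 2 * measure lebesgue (tcube q)"
    by (subst (asm) ennreal_le_iff) auto
  moreover have "measure lebesgue (core q) = measure lebesgue (tcube q) - measure lebesgue ?C"
    unfolding core_def by (rule measurable_measure_Diff[OF tcube_lmeasurable C sub])
  ultimately show ?thesis by simp
qed

text \<open>A cube of a later generation lies in the union of the generation just after that of
  \<open>a\<close>. A common point with \<open>core a\<close> would thus lie in a child of some cube
  of the generation of \<open>a\<close>, which by disjointness is \<open>a\<close> itself; but the
  core omits the children.\<close>

lemma core_disjoint: "disjoint_family_on core tree"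
  unfolding disjoint_family_on_def
proof (intro ballI impI)
  have main: "core a \<inter> core b = {}" if "a \<in> gen k" "b \<in> gen (k + j)" "a \<noteq> b" for a b k j
  proof (cases j)
    case 0
    then show ?thesis using gen_disjoint[of k] that unfolding disjoint_family_on_def core_def by auto
  next
    case (Suc i)
    have "tcube b \<subseteq> (\<Union>q\<in>gen (Suc k + i). tcube q)" using that Suc by auto
    then have b: "tcube b \<subseteq> (\<Union>q\<in>gen (Suc k). tcube q)" using gen_mono[of "Suc k" i] by blast
    have "core a \<inter> tcube b = {}"
    proof (rule ccontr)
      assume "core a \<inter> tcube b \<noteq> {}"
      then obtain x where x0: "x \<in> core a" "x \<in> (\<Union>q\<in>gen (Suc k). tcube q)" using b by blast
      then obtain a' q where x: "x \<in> core a" "a' \<in> gen k" "q \<in> ch a'" "x \<in> tcube q"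
        unfolding gen.simps by blast
      then have "x \<in> tcube a'" "x \<in> tcube a" using child_subset[OF x(3)] unfolding core_def by blast+
      then have "a' = a" using gen_disjoint[of k] x(2) that(1) unfolding disjoint_family_on_def by blast
      then show False using x unfolding core_def by blast
    qed
    then show ?thesis unfolding core_def by blast
  qed
  fix a b assume "a \<in> tree" "b \<in> tree" and ne: "a \<noteq> b"
  then obtain k k' where k: "a \<in> gen k" "b \<in> gen k'" by (auto simp: tree_def)
  show "core a \<inter> core b = {}"
  proof (cases "k \<le> k'")
    case True
    then show ?thesis using main[of a k b "k' - k"] k ne by simp
  next
    case False
    then show ?thesis using main[of b k' a "k - k'"] k ne by (simp add: Int_commute)
  qed
qed

text \<open>The core of \<open>q\<close> has at least half the measure of \<open>tcube q\<close>,
  which is 1 / 3^n of the measure of the triple. Injectivity lets the core be read off from the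
  triple.\<close>

lemma sparse_triples: "sparse_family (1 / (2 * 3 ^ CARD('n))) ((\<lambda>q. cube (tcenter q) (3 * tside q)) ` tree)"
proof -
  let ?Q = "\<lambda>q :: 'n tindex. cube (tcenter q) (3 * tside q)"
  note inj = inj_triple_cube
  show ?thesis
    unfolding sparse_family_def
  proof (intro conjI ballI exI)
    fix Q assume "Q \<in> ?Q ` tree"
    then obtain q :: "'n tindex" where "Q = ?Q q" by blast
    moreover have "3 * tside q > 0" by simp
    ultimately show "is_cube Q" unfolding is_cube_def by blast
  next
    let ?E = "\<lambda>Q. core (inv ?Q Q)"
    fix Q assume "Q \<in> ?Q ` tree"
    then obtain q where q: "q \<in> tree" "Q = ?Q q" by blast
    then have E: "?E Q = core q" using arg_cong[OF inv_f_f[OF inj, of q], of core] by simp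
    show "?E Q \<in> sets lebesgue" by (rule core_meas)
    have "tcube q \<subseteq> ?Q q"
      using tcube_subset_cube[of q] cube_mono[of "tside q" "3 * tside q" "tcenter q"] tside_pos(2)[of q] by auto
    then show "?E Q \<subseteq> Q" unfolding E unfolding q(2) core_def by blast
    show "measure lebesgue (?E Q) \<ge> 1 / (2 * 3 ^ CARD('n)) * measure lebesgue Q"
      using core_measure[of q] unfolding E unfolding q(2) by (simp add: power_mult_distrib)
  next
    let ?E = "\<lambda>Q. core (inv ?Q Q)"
    have E: "?E (?Q q) = core q" for q by (rule arg_cong[OF inv_f_f[OF inj]])
    show "disjoint_family_on ?E (?Q ` tree)"
      unfolding disjoint_family_on_def
    proof (intro ballI impI)
      fix P Q assume "P \<in> ?Q ` tree" "Q \<in> ?Q ` tree" and ne: "P \<noteq> Q"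
      then obtain q q' where q: "q \<in> tree" "P = ?Q q" "q' \<in> tree" "Q = ?Q q'" by blast
      have "q \<noteq> q'" using q(2,4) ne by metis
      then have "core q \<inter> core q' = {}"
        using core_disjoint q(1,3) unfolding disjoint_family_on_def by metis
      then show "?E P \<inter> ?E Q = {}" unfolding q(2,4) E .
    qed
  qed
qed

lemma gen_root: "q \<in> gen k \<Longrightarrow> \<exists>r\<in>R. tcube q \<subseteq> tcube r"
proof (induction k arbitrary: q)
  case (Suc k)
  then obtain q' where "q' \<in> gen k" "q \<in> ch q'" by auto
  then show ?case using Suc.IH[of q'] child_subset[of q q'] by blast
qed auto

text \<open>Halving is iterated inside one root, since the roots together have infinite measure.
  Every cube of the tree lies in a root, so it is contained in \<open>tcube r\<close> or disjoint
  from it.\<close>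

lemma gen_measure:
  assumes "r \<in> R"
  shows "emeasure lebesgue ((\<Union>q\<in>gen k. tcube q) \<inter> tcube r) \<le> ennreal ((1 / 2) ^ k) * emeasure lebesgue (tcube r)"
proof (induction k)
  case 0
  have "emeasure lebesgue ((\<Union>q\<in>gen 0. tcube q) \<inter> tcube r) \<le> emeasure lebesgue (tcube r)"
    by (rule emeasure_mono) simp_all
  then show ?case by simp
next
  case (Suc k)
  let ?G = "{q \<in> gen k. tcube q \<subseteq> tcube r}"
  have split: "tcube q \<subseteq> tcube r \<or> tcube q \<inter> tcube r = {}" if qk: "q \<in> gen k" for q
  proof -
    obtain r' where "r' \<in> R" "tcube q \<subseteq> tcube r'" using gen_root[OF qk] by blast
    then show ?thesis using root_disjoint assms unfolding disjoint_family_on_def by (cases "r' = r") blast+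
  qed
  have sub: "(\<Union>q\<in>gen (Suc k). tcube q) \<inter> tcube r \<subseteq> (\<Union>q\<in>?G. \<Union>q'\<in>ch q. tcube q')"
  proof
    fix x assume x: "x \<in> (\<Union>q\<in>gen (Suc k). tcube q) \<inter> tcube r"
    then obtain q q' where q: "q \<in> gen k" "q' \<in> ch q" "x \<in> tcube q'" by auto
    then have "x \<in> tcube q" using child_subset by blast
    then have "q \<in> ?G" using split[OF q(1)] x q(1) by blast
    then show "x \<in> (\<Union>q\<in>?G. \<Union>q'\<in>ch q. tcube q')" using q by blast
  qed
  have m: "(\<Union>q'\<in>ch q. tcube q') \<in> sets lebesgue" for q by (intro sets.countable_UN') auto
  have "emeasure lebesgue ((\<Union>q\<in>gen (Suc k). tcube q) \<inter> tcube r) \<le> emeasure lebesgue (\<Union>q\<in>?G. \<Union>q'\<in>ch q. tcube q')"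
    using m by (intro emeasure_mono sub sets.countable_UN') auto
  also have "\<dots> \<le> (\<integral>\<^sup>+q. emeasure lebesgue (\<Union>q'\<in>ch q. tcube q') \<partial>count_space ?G)"
    using m by (intro emeasure_UN_le) auto
  also have "\<dots> \<le> (\<integral>\<^sup>+q. ennreal (1 / 2) * emeasure lebesgue (tcube q) \<partial>count_space ?G)"
    by (intro nn_integral_mono child_half)
  also have "\<dots> = ennreal (1 / 2) * (\<integral>\<^sup>+q. emeasure lebesgue (tcube q) \<partial>count_space ?G)"
    by (rule nn_integral_cmult) auto
  also have "\<dots> \<le> ennreal (1 / 2) * emeasure lebesgue ((\<Union>q\<in>gen k. tcube q) \<inter> tcube r)"
  proof (intro mult_left_mono disjoint_UN_le)
    show "disjoint_family_on tcube ?G" using gen_disjoint[of k] unfolding disjoint_family_on_def by blast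
    have "(\<Union>q\<in>gen k. tcube q) \<in> sets lebesgue" by (intro sets.countable_UN') auto
    then show "(\<Union>q\<in>gen k. tcube q) \<inter> tcube r \<in> sets lebesgue" by (intro sets.Int) auto
  qed auto
  also have "\<dots> \<le> ennreal (1 / 2) * (ennreal ((1 / 2) ^ k) * emeasure lebesgue (tcube r))"
    by (intro mult_left_mono Suc.IH) simp
  also have "\<dots> = ennreal ((1 / 2) ^ Suc k) * emeasure lebesgue (tcube r)"
    unfolding mult.assoc[symmetric] by (subst ennreal_mult[symmetric]) simp_all
  finally show ?case .
qed

lemma AE_leaves: "AE x in lebesgue. \<exists>k. x \<notin> (\<Union>q\<in>gen k. tcube q)"
proof -
  let ?N = "\<lambda>r. (\<Inter>k. (\<Union>q\<in>gen k. tcube q) \<inter> tcube r)"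
  have "?N r \<in> null_sets lebesgue" if r: "r \<in> R" for r
  proof -
    have Gm: "(\<Union>q\<in>gen k. tcube q) \<inter> tcube r \<in> sets lebesgue" for k
      by (intro sets.Int sets.countable_UN') auto
    then have Nm: "?N r \<in> sets lebesgue" by (intro sets.countable_INT') auto
    have le: "emeasure lebesgue (?N r) \<le> ennreal ((1 / 2) ^ k * tside r ^ CARD('n))" for k
    proof -
      have "emeasure lebesgue (?N r) \<le> emeasure lebesgue ((\<Union>q\<in>gen k. tcube q) \<inter> tcube r)"
        using Gm by (intro emeasure_mono) auto
      also have "\<dots> \<le> ennreal ((1 / 2) ^ k) * emeasure lebesgue (tcube r)" by (rule gen_measure[OF r])
      finally show ?thesis by (simp add: ennreal_mult)
    qed
    have "(\<lambda>k. (1 / 2) ^ k * tside r ^ CARD('n)) \<longlonglongrightarrow> 0 * tside r ^ CARD('n)"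
      by (intro tendsto_mult tendsto_const LIMSEQ_power_zero) auto
    then have "(\<lambda>k. ennreal ((1 / 2) ^ k * tside r ^ CARD('n))) \<longlonglongrightarrow> ennreal (0 * tside r ^ CARD('n))"
      by (rule tendsto_ennrealI)
    then have "emeasure lebesgue (?N r) \<le> ennreal (0 * tside r ^ CARD('n))"
      by (rule LIMSEQ_le_const) (use le in auto)
    then show ?thesis using Nm by (simp add: null_sets_def)
  qed
  then have "(\<Union>r\<in>R. ?N r) \<in> null_sets lebesgue" by (intro null_sets_UN') auto
  from AE_not_in[OF this] show ?thesis
  proof eventually_elim
    fix x assume x: "x \<notin> (\<Union>r\<in>R. ?N r)"
    obtain r where "r \<in> R" "x \<in> tcube r" using root_cover by blast
    then show "\<exists>k. x \<notin> (\<Union>q\<in>gen k. tcube q)" using x by blast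
  qed
qed

end

section \<open>Sparse domination\<close>

context tcube_tree
begin

text \<open>Telescopes along the finite chain of cubes through \<open>x\<close>. Each cube is
  charged at most twice, as a child and as a parent or last cube; the extra term C * v q on the left
  prepares the charge as a child, whence 2 * C. The bound on levels shows that the new cube is not
  yet in \<open>Y\<close>.\<close>

lemma tree_sum:
  fixes t v :: "'n tindex \<Rightarrow> real"
  assumes stop: "\<And>q. q \<in> tree \<Longrightarrow> x \<in> core q \<Longrightarrow> t q \<le> C * v q"
    and step: "\<And>q q'. q \<in> tree \<Longrightarrow> q' \<in> ch q \<Longrightarrow> x \<in> tcube q' \<Longrightarrow> t q \<le> t q' + C * v q + C * v q'"
    and q: "q \<in> gen k" "x \<in> tcube q" "x \<notin> (\<Union>q\<in>gen (k + m). tcube q)"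
  shows "\<exists>Y. finite Y \<and> Y \<subseteq> tree \<and> (\<forall>q'\<in>Y. x \<in> tcube q' \<and> fst q' \<le> fst q) \<and> t q + C * v q \<le> 2 * C * (\<Sum>q'\<in>Y. v q')"
  using q
proof (induction m arbitrary: k q)
  case 0
  then show ?case by auto
next
  case (Suc m)
  have qt: "q \<in> tree" using Suc.prems(1) unfolding tree_def by blast
  show ?case
  proof (cases "x \<in> (\<Union>q'\<in>ch q. tcube q')")
    case False
    then have "x \<in> core q" using Suc.prems(2) by (simp add: core_def)
    from stop[OF qt this] show ?thesis
      using qt Suc.prems(2) by (intro exI[of _ "{q}"]) simp
  next
    case True
    then obtain q' where q': "q' \<in> ch q" "x \<in> tcube q'" by blast
    have "q' \<in> gen (Suc k)" unfolding gen.simps using q'(1) Suc.prems(1) by blast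
    moreover have "x \<notin> (\<Union>q\<in>gen (Suc k + m). tcube q)" using Suc.prems(3) by simp
    ultimately obtain Y where Y: "finite Y" "Y \<subseteq> tree" "\<forall>a\<in>Y. x \<in> tcube a \<and> fst a \<le> fst q'"
      "t q' + C * v q' \<le> 2 * C * (\<Sum>a\<in>Y. v a)"
      using Suc.IH[of q' "Suc k"] q'(2) by blast
    have lt: "fst q' < fst q" by (rule child_level[OF q'(1)])
    then have "q \<notin> Y" using Y(3) by force
    have "t q + C * v q \<le> 2 * C * (\<Sum>a\<in>insert q Y. v a)"
      using step[OF qt q'] Y(1,4) \<open>q \<notin> Y\<close> by (simp add: algebra_simps)
    moreover have "\<forall>a\<in>insert q Y. x \<in> tcube a \<and> fst a \<le> fst q" using Y(3) lt Suc.prems(2) by force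
    ultimately show ?thesis using Y(1,2) qt by (intro exI[of _ "insert q Y"]) simp
  qed
qed

end

context cz_operator
begin

abbreviation tavg :: "(real ^ 'n \<Rightarrow> real) \<Rightarrow> 'n tindex \<Rightarrow> real" where
  "tavg f q \<equiv> avg3 f (tcenter q) (tside q)"

abbreviation ttrunc :: "(real ^ 'n \<Rightarrow> real) \<Rightarrow> 'n tindex \<Rightarrow> real ^ 'n \<Rightarrow> real" where
  "ttrunc f q \<equiv> trunc3 f (tcenter q) (tside q)"

text \<open>A predicate of the constant, so that \<open>C\<close> can be fixed before
  \<open>f\<close> while the tree depends on \<open>f\<close>.\<close>

definition stopping :: "real \<Rightarrow> (real ^ 'n \<Rightarrow> real) \<Rightarrow> ('n tindex \<Rightarrow> 'n tindex set) \<Rightarrow> bool" where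
  "stopping C f ch \<longleftrightarrow>
    (\<forall>q. \<forall>q'\<in>ch q. tcube q' \<subseteq> tcube q \<and> fst q' < fst q) \<and> (\<forall>q. disjoint_family_on tcube (ch q)) \<and>
    (\<forall>q. emeasure lebesgue (\<Union>q'\<in>ch q. tcube q') \<le> ennreal (1 / 2) * emeasure lebesgue (tcube q)) \<and>
    (\<forall>q. AE x in lebesgue. x \<in> tcube q - (\<Union>q'\<in>ch q. tcube q') \<longrightarrow> \<bar>T (ttrunc f q) x\<bar> \<le> C * tavg f q) \<and>
    (\<forall>q. \<forall>q'\<in>ch q. AE x in lebesgue. x \<in> tcube q' \<longrightarrow> \<bar>T (ttrunc f q) x\<bar> \<le> \<bar>T (ttrunc f q') x\<bar> + C * tavg f q + C * tavg f q')"

text \<open>By \<open>small\<close> some point \<open>x'\<close> of the child avoids both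
  exceptional sets. At \<open>x'\<close> the remainder \<open>R\<close>, the difference of the two
  truncations, is controlled through both of them, and \<open>oscillation\<close> spreads this over
  the child because \<open>R\<close> vanishes on its triple.\<close>

lemma child_comparison:
  assumes f: "f \<in> Linfc" and sub: "tcube q' \<subseteq> tcube q" and A: "A > 0"
    and Um: "U \<in> lmeasurable" "U' \<in> lmeasurable"
    and small: "measure lebesgue (U \<inter> tcube q') + measure lebesgue U' < measure lebesgue (tcube q')"
    and U: "\<And>x. x \<in> tcube q - U \<Longrightarrow> controlled A f (tcenter q) (tside q) x"
    and U': "\<And>x. x \<in> tcube q' - U' \<Longrightarrow> controlled A f (tcenter q') (tside q') x"
  shows "AE x in lebesgue. x \<in> tcube q' \<longrightarrow>
    \<bar>T (ttrunc f q) x\<bar> \<le> \<bar>T (ttrunc f q') x\<bar> + (A2 * A + A) * tavg f q + A * tavg f q'"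
proof -
  let ?c = "tcenter q'" and ?l = "tside q'"
  define R where "R = (\<lambda>x. ttrunc f q x * indicator (- cube ?c (3 * ?l)) x)"
  have F: "ttrunc f q \<in> Linfc" "ttrunc f q' \<in> Linfc" using f by (auto intro: trunc3_Linfc)
  have R: "R \<in> Linfc" unfolding R_def by (rule Linfc_mult_indicator[OF F(1)]) auto
  have dec: "(\<lambda>x. ttrunc f q' x + R x) = ttrunc f q"
  proof
    fix x show "ttrunc f q' x + R x = ttrunc f q x"
      using tcube_triple[OF sub] by (auto simp: R_def trunc3_def indicator_def)
  qed
  have "AE x in lebesgue. T (\<lambda>x. ttrunc f q' x + R x) x = T (ttrunc f q') x + T R x" by (rule T_add[OF F(2) R])
  then have lin: "AE x in lebesgue. T (ttrunc f q) x = T (ttrunc f q') x + T R x" unfolding dec .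
  then obtain Z where Z: "Z \<in> null_sets lebesgue" "{x \<in> space lebesgue. \<not> T (ttrunc f q) x = T (ttrunc f q') x + T R x} \<subseteq> Z"
    unfolding eventually_ae_filter by blast
  have Zl: "Z \<in> lmeasurable" "measure lebesgue Z = 0"
    using Z(1) by (auto simp: fmeasurable_def null_sets_def measure_def)
  have "\<exists>x'\<in>tcube q'. x' \<notin> U \<and> x' \<notin> U' \<and> x' \<notin> Z"
  proof (rule ccontr)
    assume "\<not> ?thesis"
    then have sub: "tcube q' \<subseteq> (U \<inter> tcube q') \<union> (U' \<union> Z)" by blast
    have m: "U \<inter> tcube q' \<in> lmeasurable" using Um by (intro fmeasurable.Int) auto
    have "measure lebesgue (tcube q') \<le> measure lebesgue ((U \<inter> tcube q') \<union> (U' \<union> Z))"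
      using m Um Zl by (intro measure_mono_fmeasurable[OF sub]) auto
    also have "\<dots> \<le> measure lebesgue (U \<inter> tcube q') + measure lebesgue (U' \<union> Z)"
      using m Um Zl by (intro measure_Un_le) (auto intro: fmeasurableD)
    also have "\<dots> \<le> measure lebesgue (U \<inter> tcube q') + (measure lebesgue U' + measure lebesgue Z)"
      using m Um Zl by (intro add_left_mono measure_Un_le) (auto intro: fmeasurableD)
    finally show False using small Zl(2) by linarith
  qed
  then obtain x' where x': "x' \<in> tcube q'" "x' \<notin> U" "x' \<notin> U'" "x' \<notin> Z" by blast
  have x'q: "x' \<in> tcube q - U" using x' sub by blast
  have "T (ttrunc f q) x' = T (ttrunc f q') x' + T R x'" using Z(2) x'(4) by auto
  then have TR: "\<bar>T R x'\<bar> \<le> A * tavg f q + A * tavg f q'"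
    using U[OF x'q] U'[of x'] x' unfolding controlled_def by auto
  have osc: "\<bar>T R x - T R x'\<bar> \<le> A2 * (A * tavg f q)" if x: "x \<in> tcube q'" for x
  proof (rule oscillation[OF tside_pos(1)[of q'] R])
    show "R y \<noteq> 0 \<Longrightarrow> y \<notin> cube ?c (3 * ?l)" for y by (auto simp: R_def)
    show "0 \<le> A * tavg f q" using A avg3_nonneg by simp
    show "x \<in> cube ?c ?l" "x' \<in> cube ?c ?l" using x x' tcube_subset_cube by blast+
    fix k :: nat
    let ?Q = "cube ?c (2 ^ Suc k * (2 * ?l))"
    have ip: "integrable lebesgue (\<lambda>y. \<bar>g y\<bar> powr p)" if "g \<in> Linfc" for g :: "real ^ 'n \<Rightarrow> real"
      using Linfc_powr_integrable[OF that] p1 by simp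
    have "?l \<le> 2 ^ Suc k * (2 * ?l)"
      using mult_right_mono[OF one_le_power[of "2::real" "Suc k"], of "?l"] tside_pos(1)[of q'] by simp
    \<comment> \<open>All dilates of the child contain the one good point \<open>x'\<close>, so the
      maximal clause of \<open>controlled\<close> for the parent bounds the p-th power integrals
      over them.\<close>
    then have "x' \<in> ?Q" using x'(1) tcube_subset_cube[of q'] cube_mono by blast
    then have le: "(LINT y:?Q|lebesgue. \<bar>ttrunc f q y\<bar> powr p) \<le> (A * tavg f q) powr p * (2 ^ Suc k * (2 * ?l)) ^ CARD('n)"
      by (intro conjunct2[OF U[OF x'q, unfolded controlled_def], rule_format]) auto
    have "(LINT y:?Q|lebesgue. \<bar>R y\<bar> powr p) \<le> (LINT y:?Q|lebesgue. \<bar>ttrunc f q y\<bar> powr p)"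
      unfolding set_lebesgue_integral_def
      using integrable_mult_indicator[OF cube_meas ip[OF R]] integrable_mult_indicator[OF cube_meas ip[OF F(1)]]
      by (intro integral_mono) (auto simp: R_def indicator_def)
    then show "(LINT y:?Q|lebesgue. \<bar>R y\<bar> powr p) \<le> (A * tavg f q) powr p * (2 ^ Suc k * (2 * ?l)) ^ CARD('n)"
      using le by linarith
  qed
  show ?thesis
    using lin
  proof (eventually_elim, intro impI)
    fix x assume x: "T (ttrunc f q) x = T (ttrunc f q') x + T R x" "x \<in> tcube q'"
    have "\<bar>T R x\<bar> \<le> A2 * (A * tavg f q) + A * tavg f q + A * tavg f q'" using osc[OF x(2)] TR by linarith
    then show "\<bar>T (ttrunc f q) x\<bar> \<le> \<bar>T (ttrunc f q') x\<bar> + (A2 * A + A) * tavg f q + A * tavg f q'"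
      unfolding x(1) by (simp add: algebra_simps)
  qed
qed

lemma stopping_children:
  obtains C where "C > 0" "\<And>f. f \<in> Linfc \<Longrightarrow> \<exists>ch. stopping C f ch"
proof -
  \<comment> \<open>The exceptional set has density at most \<epsilon> and children are selected at
    height 2 * \<epsilon>, so they fill at most half of the cube. Inside a child the density of that
    set is at most 3^n * 2 * \<epsilon> = 1/4, and the child's own exceptional set adds at most 1/8,
    so good points remain.\<close>
  define \<epsilon> :: real where "\<epsilon> = 1 / (8 * 3 ^ CARD('n))"
  have \<epsilon>: "\<epsilon> > 0" by (simp add: \<epsilon>_def)
  have \<epsilon>8: "\<epsilon> \<le> 1 / 8"
    unfolding \<epsilon>_def using one_le_power[of "3::real" "CARD('n)"] by (intro divide_left_mono) auto
  have \<epsilon>4: "3 ^ CARD('n) * (2 * \<epsilon>) = 1 / 4" by (simp add: \<epsilon>_def)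
  obtain A where A: "A > 0" and exc: "\<And>c l f. l > 0 \<Longrightarrow> f \<in> Linfc \<Longrightarrow>
    \<exists>U\<in>lmeasurable. measure lebesgue U \<le> \<epsilon> * l ^ CARD('n) \<and> (\<forall>x\<in>cube c l - U. controlled A f c l x)"
    using exceptional_set[OF \<epsilon>] by blast
  define C where "C = A2 * A + A"
  have C: "C > 0" "A \<le> C" using A constants by (simp_all add: C_def add_pos_pos)
  show thesis
  proof (rule that[OF C(1)])
    fix f :: "real ^ 'n \<Rightarrow> real" assume f: "f \<in> Linfc"
    define P where "P = (\<lambda>(q :: 'n tindex) U. U \<in> lmeasurable \<and> measure lebesgue U \<le> \<epsilon> * tside q ^ CARD('n) \<and>
      (\<forall>x\<in>cube (tcenter q) (tside q) - U. controlled A f (tcenter q) (tside q) x))"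
    have "\<exists>U. P q U" for q
      using exc[OF tside_pos(1)[of q] f, of "tcenter q"] unfolding P_def Bex_def .
    then have "\<forall>q. \<exists>U. P q U" by (rule allI)
    from choice[OF this] obtain U where U0: "\<forall>q. P q (U q)" ..
    have U: "U q \<in> lmeasurable" "measure lebesgue (U q) \<le> \<epsilon> * tside q ^ CARD('n)"
      "x \<in> tcube q - U q \<Longrightarrow> controlled A f (tcenter q) (tside q) x" for q x
      using spec[OF U0, of q] tcube_subset_cube[of q] unfolding P_def by blast+
    \<comment> \<open>The set supplied for \<open>q\<close> may extend beyond \<open>q\<close>;
      cutting it off makes every selected cube meet \<open>q\<close>.\<close>
    define V where "V = (\<lambda>q. U q \<inter> tcube q)"
    have V: "V q \<in> lmeasurable" for q unfolding V_def using U(1) by (intro fmeasurable.Int) auto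
    have Vle: "measure lebesgue (V q) \<le> \<epsilon> * tside q ^ CARD('n)" for q
    proof -
      have "measure lebesgue (V q) \<le> measure lebesgue (U q)"
        using U(1) V by (intro measure_mono_fmeasurable) (auto simp: V_def fmeasurableD)
      then show ?thesis using U(2)[of q] by linarith
    qed
    let ?h = "\<lambda>q. indicator (V q) :: real ^ 'n \<Rightarrow> real"
    have h: "integrable lebesgue (?h q)" for q
      using V[of q] by (intro integrable_real_indicator) (auto simp: fmeasurable_def)
    have hint: "(LINT x:tcube q'|lebesgue. ?h q x) = measure lebesgue (V q \<inter> tcube q')" for q q'
    proof -
      have "(LINT x:tcube q'|lebesgue. ?h q x) = (LINT x|lebesgue. indicator (V q \<inter> tcube q') x)"
        unfolding set_lebesgue_integral_def
        by (intro Bochner_Integration.integral_cong refl) (auto simp: indicator_def)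
      then show ?thesis by simp
    qed
    define ch where "ch = (\<lambda>q. cz_cubes (?h q) (2 * \<epsilon>))"
    have e2: "2 * \<epsilon> > 0" using \<epsilon> by simp
    have low: "2 * \<epsilon> * tside q' ^ CARD('n) < measure lebesgue (V q \<inter> tcube q')" if "q' \<in> ch q" for q q'
      using cz_lower[OF h _ e2] that unfolding ch_def hint by simp
    have up: "measure lebesgue (V q \<inter> tcube q') \<le> 1 / 4 * tside q' ^ CARD('n)" if "q' \<in> ch q" for q q'
      using cz_upper[OF h _ e2] that unfolding ch_def hint \<epsilon>4 by simp
    have sub: "tcube q' \<subseteq> tcube q \<and> fst q' < fst q" if q': "q' \<in> ch q" for q q'
    proof -
      have m: "V q \<inter> tcube q' \<in> lmeasurable" using V by (intro fmeasurable.Int) auto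
      have "measure lebesgue (V q \<inter> tcube q') \<le> measure lebesgue (V q)"
        using V m by (intro measure_mono_fmeasurable) (auto simp: fmeasurableD)
      \<comment> \<open>Selection at twice the density of the whole set forces a strictly smaller
        side, and nesting then puts the child inside \<open>q\<close>.\<close>
      then have "2 * \<epsilon> * tside q' ^ CARD('n) < \<epsilon> * tside q ^ CARD('n)" using low[OF q'] Vle[of q] by linarith
      then have "2 * tside q' ^ CARD('n) < tside q ^ CARD('n)" using \<epsilon> by (simp add: mult.assoc mult.left_commute)
      then have "tside q' ^ CARD('n) < tside q ^ CARD('n)" using zero_less_power[OF tside_pos(1)[of q'], of "CARD('n)"] by linarith
      then have "tside q' < tside q" by (rule power_less_imp_less_base) simp
      then have lev: "fst q' < fst q"
        unfolding tside_def using power_int_increasing[of "fst q" "fst q'" "3::real"] by (meson not_le one_le_numeral)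
      have pos: "0 < 2 * \<epsilon> * tside q' ^ CARD('n)" using \<epsilon> by simp
      have "V q \<inter> tcube q' \<noteq> {}"
      proof
        assume e: "V q \<inter> tcube q' = {}"
        show False using low[OF q'] pos unfolding e measure_empty by linarith
      qed
      then have "tcube q' \<inter> tcube q \<noteq> {}" by (auto simp: V_def)
      then show ?thesis using tcube_nested[of q' q] lev by simp
    qed
    have dis: "disjoint_family_on tcube (ch q)" for q
      unfolding ch_def by (rule cz_disjoint[OF h _ e2]) simp
    have half: "emeasure lebesgue (\<Union>q'\<in>ch q. tcube q') \<le> ennreal (1 / 2) * emeasure lebesgue (tcube q)" for q
    proof -
      have "emeasure lebesgue (\<Union>q'\<in>ch q. tcube q') \<le> (\<integral>\<^sup>+q'. emeasure lebesgue (tcube q') \<partial>count_space (ch q))"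
        by (intro emeasure_UN_le) auto
      also have "\<dots> = ennreal (1 / (2 * \<epsilon>)) * (ennreal (2 * \<epsilon>) * (\<integral>\<^sup>+q'. emeasure lebesgue (tcube q') \<partial>count_space (ch q)))"
        unfolding mult.assoc[symmetric] using \<epsilon> by (subst ennreal_mult[symmetric]) auto
      also have "\<dots> \<le> ennreal (1 / (2 * \<epsilon>)) * ennreal (LINT x|lebesgue. ?h q x)"
        unfolding ch_def by (intro mult_left_mono cz_measure[OF h _ e2]) auto
      also have "\<dots> \<le> ennreal (1 / (2 * \<epsilon>)) * ennreal (\<epsilon> * tside q ^ CARD('n))"
        using Vle[of q] by (intro mult_left_mono ennreal_leI) auto
      also have "\<dots> = ennreal (1 / (2 * \<epsilon>) * (\<epsilon> * tside q ^ CARD('n)))" using \<epsilon> by (intro ennreal_mult[symmetric]) auto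
      also have "1 / (2 * \<epsilon>) * (\<epsilon> * tside q ^ CARD('n)) = 1 / 2 * tside q ^ CARD('n)" using \<epsilon> by simp
      also have "ennreal \<dots> = ennreal (1 / 2) * emeasure lebesgue (tcube q)"
        unfolding emeasure_tcube by (rule ennreal_mult) auto
      finally show ?thesis .
    qed
    have stop: "AE x in lebesgue. x \<in> tcube q - (\<Union>q'\<in>ch q. tcube q') \<longrightarrow> \<bar>T (ttrunc f q) x\<bar> \<le> C * tavg f q" for q
    proof -
      have "AE x in lebesgue. x \<notin> (\<Union>q'\<in>ch q. tcube q') \<longrightarrow> ?h q x \<le> 2 * (2 * \<epsilon>)"
        unfolding ch_def by (rule cz_small[OF h _ e2]) simp
      then show ?thesis
      proof (eventually_elim, intro impI)
        fix x assume x: "x \<notin> (\<Union>q'\<in>ch q. tcube q') \<longrightarrow> ?h q x \<le> 2 * (2 * \<epsilon>)" "x \<in> tcube q - (\<Union>q'\<in>ch q. tcube q')"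
        \<comment> \<open>Off the children the indicator is at most 4 * \<epsilon> \<le> 1/2, hence
          it is 0.\<close>
        then have "?h q x < 1" using \<epsilon>8 by auto
        then have "x \<in> tcube q - U q" using x(2) by (auto simp: V_def indicator_def split: if_splits)
        then have "\<bar>T (ttrunc f q) x\<bar> \<le> A * tavg f q" using U(3)[of x q] by (simp add: controlled_def)
        also have "\<dots> \<le> C * tavg f q" using C avg3_nonneg by (intro mult_right_mono) auto
        finally show "\<bar>T (ttrunc f q) x\<bar> \<le> C * tavg f q" .
      qed
    qed
    have step: "AE x in lebesgue. x \<in> tcube q' \<longrightarrow> \<bar>T (ttrunc f q) x\<bar> \<le> \<bar>T (ttrunc f q') x\<bar> + C * tavg f q + C * tavg f q'"
      if q': "q' \<in> ch q" for q q'
    proof -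
      have s: "tcube q' \<subseteq> tcube q" using sub[OF q'] by simp
      have VU: "V q \<inter> tcube q' = U q \<inter> tcube q'" using s by (auto simp: V_def)
      have pos: "tside q' ^ CARD('n) > 0" by simp
      have "\<epsilon> * tside q' ^ CARD('n) \<le> 1 / 8 * tside q' ^ CARD('n)" using \<epsilon>8 pos by (intro mult_right_mono) auto
      then have small: "measure lebesgue (U q \<inter> tcube q') + measure lebesgue (U q') < measure lebesgue (tcube q')"
        using up[OF q'] U(2)[of q'] pos unfolding VU measure_tcube by linarith
      have "AE x in lebesgue. x \<in> tcube q' \<longrightarrow>
        \<bar>T (ttrunc f q) x\<bar> \<le> \<bar>T (ttrunc f q') x\<bar> + (A2 * A + A) * tavg f q + A * tavg f q'"
        by (rule child_comparison[OF f s A U(1) U(1) small U(3) U(3)])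
      then show ?thesis
      proof (eventually_elim, intro impI)
        fix x assume x: "x \<in> tcube q' \<longrightarrow> \<bar>T (ttrunc f q) x\<bar> \<le> \<bar>T (ttrunc f q') x\<bar> + (A2 * A + A) * tavg f q + A * tavg f q'"
          "x \<in> tcube q'"
        have "A * tavg f q' \<le> C * tavg f q'" using C avg3_nonneg by (intro mult_right_mono) auto
        then show "\<bar>T (ttrunc f q) x\<bar> \<le> \<bar>T (ttrunc f q') x\<bar> + C * tavg f q + C * tavg f q'"
          using x unfolding C_def by linarith
      qed
    qed
    show "\<exists>ch. stopping C f ch"
      unfolding stopping_def
      by (rule exI[of _ ch]) (intro conjI allI ballI sub dis half stop step; assumption)
  qed
qed

lemma sparse_domination:
  "\<exists>C>0. \<forall>f\<in>Linfc. \<exists>S. sparse_family (1 / (2 * 3 ^ CARD('n))) S \<and>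
    (AE x in lebesgue. ennreal \<bar>T f x\<bar> \<le> ennreal C * (\<Sum>\<^sub>\<infinity>Q\<in>S. ennreal (cube_avg p Q f) * indicator Q x))"
proof -
  obtain C where C: "C > 0" and children: "\<And>f. f \<in> Linfc \<Longrightarrow> \<exists>ch. stopping C f ch"
    using stopping_children by blast
  show ?thesis
  proof (intro exI[of _ "2 * C"] conjI ballI)
    show "2 * C > 0" using C by simp
    fix f :: "real ^ 'n \<Rightarrow> real" assume f: "f \<in> Linfc"
    obtain R :: "'n tindex set" where R: "disjoint_family_on tcube R" "(\<Union>q\<in>R. tcube q) = UNIV"
      "\<And>q y. q \<in> R \<Longrightarrow> f y \<noteq> 0 \<Longrightarrow> y \<in> cube (tcenter q) (3 * tside q)"
      using root_cubes[OF f] by blast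
    obtain ch where "stopping C f ch" using children[OF f] by blast
    note s = this[unfolded stopping_def]
    note ch = s[THEN conjunct1] s[THEN conjunct2, THEN conjunct1] s[THEN conjunct2, THEN conjunct2, THEN conjunct1]
    note stop = s[THEN conjunct2, THEN conjunct2, THEN conjunct2, THEN conjunct1]
    note step = s[THEN conjunct2, THEN conjunct2, THEN conjunct2, THEN conjunct2]
    interpret tcube_tree R ch
      by standard (use R(1,2) ch in blast)+
    let ?Q = "\<lambda>q :: 'n tindex. cube (tcenter q) (3 * tside q)"
    \<comment> \<open>There are only countably many indices, so the null sets of all cubes can be
      discarded together.\<close>
    have "AE x in lebesgue. \<forall>q. x \<in> tcube q - (\<Union>q'\<in>ch q. tcube q') \<longrightarrow> \<bar>T (ttrunc f q) x\<bar> \<le> C * tavg f q"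
      unfolding AE_all_countable using stop by blast
    moreover have "AE x in lebesgue. \<forall>q. \<forall>q'\<in>ch q. x \<in> tcube q' \<longrightarrow> \<bar>T (ttrunc f q) x\<bar> \<le> \<bar>T (ttrunc f q') x\<bar> + C * tavg f q + C * tavg f q'"
      unfolding AE_all_countable using step by (intro allI AE_ball_countable') auto
    ultimately have "AE x in lebesgue. ennreal \<bar>T f x\<bar> \<le> ennreal (2 * C) * (\<Sum>\<^sub>\<infinity>Q\<in>?Q ` tree. ennreal (cube_avg p Q f) * indicator Q x)"
      using AE_leaves
    proof eventually_elim
      fix x
      assume x1: "\<forall>q. x \<in> tcube q - (\<Union>q'\<in>ch q. tcube q') \<longrightarrow> \<bar>T (ttrunc f q) x\<bar> \<le> C * tavg f q"
        and x2: "\<forall>q. \<forall>q'\<in>ch q. x \<in> tcube q' \<longrightarrow> \<bar>T (ttrunc f q) x\<bar> \<le> \<bar>T (ttrunc f q') x\<bar> + C * tavg f q + C * tavg f q'"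
        and x3: "\<exists>k. x \<notin> (\<Union>q\<in>gen k. tcube q)"
      obtain r where r: "r \<in> R" "x \<in> tcube r" using R(2) by blast
      obtain k where k: "x \<notin> (\<Union>q\<in>gen (0 + k). tcube q)" using x3 by auto
      have "\<exists>Y. finite Y \<and> Y \<subseteq> tree \<and> (\<forall>q'\<in>Y. x \<in> tcube q' \<and> fst q' \<le> fst r) \<and>
        \<bar>T (ttrunc f r) x\<bar> + C * tavg f r \<le> 2 * C * (\<Sum>q'\<in>Y. tavg f q')"
        using r k x1 x2 by (intro tree_sum[where k = 0 and m = k]) (auto simp: core_def)
      then obtain Y where Y: "finite Y" "Y \<subseteq> tree" "\<forall>q'\<in>Y. x \<in> tcube q'"
        "\<bar>T (ttrunc f r) x\<bar> + C * tavg f r \<le> 2 * C * (\<Sum>q'\<in>Y. tavg f q')" by blast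
      \<comment> \<open>The triple of a root contains the support, so the chain starts with
        \<open>T f\<close> itself.\<close>
      have "ttrunc f r = f"
      proof
        fix y show "ttrunc f r y = f y" using R(3)[OF r(1), of y] by (cases "f y = 0") (auto simp: trunc3_def)
      qed
      moreover have "C * tavg f r \<ge> 0" using C avg3_nonneg by simp
      ultimately have "\<bar>T f x\<bar> \<le> 2 * C * (\<Sum>q'\<in>Y. tavg f q')" using Y(4) by simp
      then have "ennreal \<bar>T f x\<bar> \<le> ennreal (2 * C * (\<Sum>q'\<in>Y. tavg f q'))" by (rule ennreal_leI)
      also have "\<dots> = ennreal (2 * C) * ennreal (\<Sum>q'\<in>Y. tavg f q')"
        using C avg3_nonneg by (intro ennreal_mult sum_nonneg) auto
      also have "ennreal (\<Sum>q'\<in>Y. tavg f q') = (\<Sum>q'\<in>Y. ennreal (tavg f q'))"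
        using avg3_nonneg by (intro sum_ennreal[symmetric]) auto
      also have "\<dots> = (\<Sum>q'\<in>Y. ennreal (cube_avg p (?Q q') f) * indicator (?Q q') x)"
      proof (rule sum.cong[OF refl])
        fix q assume "q \<in> Y"
        then have "x \<in> cube (tcenter q) (tside q)" using Y(3) tcube_subset_cube by blast
        then have "x \<in> ?Q q" using cube_mono[of "tside q" "3 * tside q"] tside_pos(2)[of q] by auto
        then show "ennreal (tavg f q) = ennreal (cube_avg p (?Q q) f) * indicator (?Q q) x" by (simp add: avg3_def)
      qed
      also have "\<dots> = (\<Sum>Q\<in>?Q ` Y. ennreal (cube_avg p Q f) * indicator Q x)"
        by (rule sum.reindex_cong[symmetric, of ?Q Y]) (auto intro: inj_on_subset[OF inj_triple_cube])
      \<comment> \<open>The chain through \<open>x\<close> gives a finite partial sum of the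
        nonnegative sum over the whole family.\<close>
      also have "\<dots> \<le> (\<Sum>\<^sub>\<infinity>Q\<in>?Q ` tree. ennreal (cube_avg p Q f) * indicator Q x)"
        using Y(1,2) by (subst nonneg_infsum_complete) (auto intro!: SUP_upper)
      finally show "ennreal \<bar>T f x\<bar> \<le> ennreal (2 * C) * (\<Sum>\<^sub>\<infinity>Q\<in>?Q ` tree. ennreal (cube_avg p Q f) * indicator Q x)"
        by (simp add: mult_left_mono)
    qed
    then show "\<exists>S. sparse_family (1 / (2 * 3 ^ CARD('n))) S \<and>
      (AE x in lebesgue. ennreal \<bar>T f x\<bar> \<le> ennreal (2 * C) * (\<Sum>\<^sub>\<infinity>Q\<in>S. ennreal (cube_avg p Q f) * indicator Q x))"
      using sparse_triples by blast
  qed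
qed

end

theorem theorem4p1:
  fixes T Tt :: "(real ^ 'n \<Rightarrow> real) \<Rightarrow> real ^ 'n \<Rightarrow> real"
    and K :: "real ^ 'n \<Rightarrow> real ^ 'n \<Rightarrow> real"
    and r :: ennreal
  assumes "linear_operator T"
    and "is_kernel K"
    and "has_kernel T K"
    and "is_transpose T Tt"
    and "1 < r"
    and "K \<in> Hormander r"
    and "(\<lambda>x y. K y x) \<in> Hormander 1"
    and "\<exists>C>0. \<forall>Q E. is_cube Q \<and> E \<in> sets lebesgue \<and> E \<subseteq> Q \<longrightarrow>
           (\<integral>\<^sup>+x\<in>Q. ennreal \<bar>Tt (indicator E) x\<bar> \<partial>lebesgue) \<le> ennreal (C * measure lebesgue Q)"
  shows "\<exists>C>0. \<forall>f\<in>Linfc. \<exists>S. sparse_family (1 / (2 * 3 ^ CARD('n))) S \<and>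
           (AE x in lebesgue. ennreal \<bar>T f x\<bar> \<le>
              ennreal C * (\<Sum>\<^sub>\<infinity>Q\<in>S. ennreal (cube_avg (enn2real (conj_exponent r)) Q f) * indicator Q x))"
proof -
  obtain B where B: "B > 0" "\<forall>Q E. is_cube Q \<and> E \<in> sets lebesgue \<and> E \<subseteq> Q \<longrightarrow>
      (\<integral>\<^sup>+x\<in>Q. ennreal \<bar>Tt (indicator E) x\<bar> \<partial>lebesgue) \<le> ennreal (B * measure lebesgue Q)"
    using assms(8) by blast
  obtain A1 where A1: "A1 > 0" "\<And>c l y y'. l > 0 \<Longrightarrow> y \<in> cube c l \<Longrightarrow> y' \<in> cube c l \<Longrightarrow>
      (\<integral>\<^sup>+x\<in>- cube c (2 * l). ennreal \<bar>K x y - K x y'\<bar> \<partial>lebesgue) \<le> ennreal A1"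
    using Hormander_1_bound[OF assms(7)] by blast
  obtain A2 where A2: "A2 > 0" "\<And>c l x x'. l > 0 \<Longrightarrow> x \<in> cube c (l / 2) \<Longrightarrow> x' \<in> cube c (l / 2) \<Longrightarrow>
      (\<Sum>k. ennreal (measure lebesgue (cube c (2 ^ Suc k * l)) powr enn2real (inverse (conj_exponent r))) *
         Lr_norm r (cube c (2 ^ Suc k * l) - cube c (2 ^ k * l)) (\<lambda>y. K x y - K x' y)) \<le> ennreal A2"
    using Hormander_bound[OF assms(6)] by blast
  interpret cz_operator T Tt B A1 A2 "enn2real (conj_exponent r)"
  proof
    show "linear_operator T" "is_transpose T Tt" "B > 0" "A1 > 0" "A2 > 0" by fact+
    show "enn2real (conj_exponent r) \<ge> 1" by (rule conj_exponent_real(2)[OF assms(5)])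
  next
    fix c :: "real ^ 'n" and l :: real and E assume "l > 0" "E \<in> sets lebesgue" "E \<subseteq> cube c l"
    moreover have "is_cube (cube c l)" unfolding is_cube_def using \<open>l > 0\<close> by blast
    ultimately show "(\<integral>\<^sup>+x\<in>cube c l. ennreal \<bar>Tt (indicator E) x\<bar> \<partial>lebesgue) \<le> ennreal (B * l ^ CARD('n))"
      using B(2)[rule_format, of "cube c l" E] by simp
  next
    fix b :: "real ^ 'n \<Rightarrow> real" and c :: "real ^ 'n" and l :: real
    assume b: "l > 0" "b \<in> Linfc" "\<And>y. b y \<noteq> 0 \<Longrightarrow> y \<in> cube c l" "(LINT y|lebesgue. b y) = 0"
    show "(\<integral>\<^sup>+x\<in>- cube c (2 * l). ennreal \<bar>T b x\<bar> \<partial>lebesgue) \<le> ennreal (A1 * (LINT y|lebesgue. \<bar>b y\<bar>))"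
      by (rule kernel_atom[OF assms(3,2) A1(2)[OF b(1)] less_imp_le[OF A1(1)] b])
  next
    fix F :: "real ^ 'n \<Rightarrow> real" and c x x' :: "real ^ 'n" and l a :: real
    assume F: "l > 0" "F \<in> Linfc" "\<And>y. F y \<noteq> 0 \<Longrightarrow> y \<notin> cube c (3 * l)" "a \<ge> 0"
      "\<And>k::nat. (LINT y:cube c (2 ^ Suc k * (2 * l))|lebesgue. \<bar>F y\<bar> powr enn2real (conj_exponent r))
        \<le> a powr enn2real (conj_exponent r) * (2 ^ Suc k * (2 * l)) ^ CARD('n)"
      "x \<in> cube c l" "x' \<in> cube c l"
    show "\<bar>T F x - T F x'\<bar> \<le> A2 * a"
    proof (rule kernel_oscillation[OF assms(3,5) refl _ less_imp_le[OF A2(1)] F])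
      \<comment> \<open>The Hormander condition is applied to the doubled cube, whose half is
        \<open>cube c l\<close>.\<close>
      fix x x' assume "x \<in> cube c l" "x' \<in> cube c l"
      then show "(\<Sum>k. ennreal (measure lebesgue (cube c (2 ^ Suc k * (2 * l))) powr enn2real (inverse (conj_exponent r))) *
         Lr_norm r (cube c (2 ^ Suc k * (2 * l)) - cube c (2 ^ k * (2 * l))) (\<lambda>y. K x y - K x' y)) \<le> ennreal A2"
        using A2(2)[of "2 * l" x c x'] F(1) by simp
    qed
  qed
  show ?thesis by (rule sparse_domination)
qed

end
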